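(* Let $X$ be an infinite compact metrizable abelian group and let $G$ be a subgroup of $X$. (1) Suppose $G$ is dense in $X$, and let $\mathbf{u}=\{u_n\}_{n\ge 1}$ be a sequence in $\widehat{X}$. Then $G$ is characterized by $\mathbf{u}$ (that is, $G=s_{\mathbf{u}}(X)$) if and only if there exists a dually closed subgroup $G_{\mathbf{u}}$ of $X\times\mathbb{T}^H_0$ such that the restriction to $G_{\mathbf{u}}$ of the projection $\pi_X:X\times\mathbb{T}^H_0\to X$, $\pi_X(x,\omega)=x$, is a bijection onto $G$, and for every $n$ the character $u_n$ satisfies $$(u_n,g)=\pi_n(g,\omega)\quad\text{for all }(g,\omega)\in G_{\mathbf{u}},$$ where $\pi_n(x,(z_k)_{k\ge 1})=z_n$. (2) $G$ is characterized in $X$ if and only if $G$ is characterized in its closure $\mathrm{Cl}_X(G)$.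
   Context: $\mathbb{T}=\{z\in\mathbb{C}:|z|=1\}$. For an abelian topological group $Y$, $\widehat{Y}$ is the group of all continuous characters $Y\to\mathbb{T}$; $(\chi,y)$ denotes the value of $\chi$ at $y$. For a compact metrizable abelian group $X$ and a sequence $\mathbf{u}=\{u_n\}$ in $\widehat{X}$, put $s_{\mathbf{u}}(X)=\{x\in X:(u_n,x)\to 1\}$. A subgroup $G$ of $X$ is characterized by $\mathbf{u}$ if $G=s_{\mathbf{u}}(X)$; $G$ is characterized (in $X$) if it is characterized by some sequence $\mathbf{u}$ in $\widehat{X}$. $\mathbb{T}^H_0=\{(z_n)_{n\ge1}\in\mathbb{T}^{\mathbb{N}}: z_n\to 1\}$ is a group under coordinatewise multiplication, with the topology given by the metric $d_0((z_n^1),(z_n^2))=\sup_n|z_n^1-z_n^2|$; it is a Polish group. A subgroup $H$ of an abelian topological group $Y$ is dually closed if for every $y\in Y\setminus H$ there is $\chi\in\widehat{Y}$ with $\chi(h)=1$ for all $h\in H$ and $\chi(y)\neq 1$. *)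

theory Defs
  imports "HOL-Analysis.Analysis" "HOL-Algebra.Group"
begin

locale abelian_topological_group = comm_group Y for Y (structure) +
  fixes T :: "'a topology"
  assumes topspace_eq_carrier: "topspace T = carrier Y"
    and continuous_mult: "continuous_map (prod_topology T T) T (\<lambda>(x, y). x \<otimes> y)"
    and continuous_inv: "continuous_map T T (\<lambda>x. inv x)"

definition circle_group :: "complex monoid" where
  "circle_group = \<lparr>carrier = sphere 0 1, mult = (*), one = 1\<rparr>"

text \<open>As for \<^const>\<open>hom\<close>, only the values of a character on the carrier matter; no convention
  is imposed on its values elsewhere.\<close>

definition characters :: "('a, 'm) monoid_scheme \<Rightarrow> 'a topology \<Rightarrow> ('a \<Rightarrow> complex) set" where
  "characters Y T =
     {f. f \<in> hom Y circle_group \<and> continuous_map T (top_of_set (sphere 0 1)) f}"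

definition s_set :: "('a, 'm) monoid_scheme \<Rightarrow> (nat \<Rightarrow> 'a \<Rightarrow> complex) \<Rightarrow> 'a set" where
  "s_set X u = {x \<in> carrier X. (\<lambda>n. u n x) \<longlonglongrightarrow> 1}"

definition characterized_by ::
    "('a, 'm) monoid_scheme \<Rightarrow> (nat \<Rightarrow> 'a \<Rightarrow> complex) \<Rightarrow> 'a set \<Rightarrow> bool" where
  "characterized_by X u G \<longleftrightarrow> G = s_set X u"

definition characterized_in ::
    "('a, 'm) monoid_scheme \<Rightarrow> 'a topology \<Rightarrow> 'a set \<Rightarrow> bool" where
  "characterized_in X T G \<longleftrightarrow> (\<exists>u. (\<forall>n. u n \<in> characters X T) \<and> characterized_by X u G)"

definition dually_closed :: "('a, 'm) monoid_scheme \<Rightarrow> 'a topology \<Rightarrow> 'a set \<Rightarrow> bool" where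
  "dually_closed Y T H \<longleftrightarrow>
     (\<forall>y \<in> carrier Y - H. \<exists>f \<in> characters Y T. (\<forall>h\<in>H. f h = 1) \<and> f y \<noteq> 1)"

text \<open>The group $\mathbb{T}^H_0$, with sequences indexed from 0.\<close>

definition TH0 :: "(nat \<Rightarrow> complex) monoid" where
  "TH0 = \<lparr>carrier = {z. (\<forall>n. z n \<in> sphere 0 1) \<and> z \<longlonglongrightarrow> 1},
          mult = (\<lambda>z w n. z n * w n), one = (\<lambda>n. 1)\<rparr>"

text \<open>The value off the carrier is set to 0 because \<^locale>\<open>Metric_space\<close> asks for nonnegativity
  and symmetry on the whole type, where the supremum may be taken over an unbounded set.\<close>

definition d0 :: "(nat \<Rightarrow> complex) \<Rightarrow> (nat \<Rightarrow> complex) \<Rightarrow> real" where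
  "d0 z w =
     (if z \<in> carrier TH0 \<and> w \<in> carrier TH0 then (SUP n. dist (z n) (w n)) else 0)"

definition TH0_topology :: "(nat \<Rightarrow> complex) topology" where
  "TH0_topology = Metric_space.mtopology (carrier TH0) d0"

lemma comm_group_circle_group: "comm_group circle_group"
proof (rule comm_groupI)
  fix x assume "x \<in> carrier circle_group"
  moreover from this have "x \<noteq> 0"
    by (auto simp: circle_group_def)
  ultimately show "\<exists>y\<in>carrier circle_group. y \<otimes>\<^bsub>circle_group\<^esub> x = \<one>\<^bsub>circle_group\<^esub>"
    by (intro bexI[of _ "inverse x"]) (auto simp: circle_group_def norm_inverse)
qed (auto simp: circle_group_def norm_mult)

lemma comm_group_TH0: "comm_group TH0"
proof (rule comm_groupI)
  fix x assume x: "x \<in> carrier TH0"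
  have "(\<lambda>n. inverse (x n)) \<longlonglongrightarrow> inverse 1"
    using x by (intro tendsto_inverse) (auto simp: TH0_def)
  moreover have "x n \<noteq> 0" for n
    using x by (auto simp: TH0_def dest: spec[of _ n])
  ultimately show "\<exists>y\<in>carrier TH0. y \<otimes>\<^bsub>TH0\<^esub> x = \<one>\<^bsub>TH0\<^esub>"
    using x by (intro bexI[of _ "\<lambda>n. inverse (x n)"]) (auto simp: TH0_def norm_inverse)
next
  fix x y assume "x \<in> carrier TH0" "y \<in> carrier TH0"
  then show "x \<otimes>\<^bsub>TH0\<^esub> y \<in> carrier TH0"
    using tendsto_mult[of x 1 sequentially y 1] by (auto simp: TH0_def norm_mult)
qed (auto simp: TH0_def mult_ac)

lemma dist_le_d0:
  assumes "z \<in> carrier TH0" "w \<in> carrier TH0"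
  shows "dist (z n) (w n) \<le> d0 z w"
proof -
  have "dist (z n) (w n) \<le> 2" for n
    using assms norm_triangle_ineq4[of "z n" "w n"] by (auto simp: TH0_def dist_norm)
  then have "bdd_above (range (\<lambda>n. dist (z n) (w n)))"
    by (intro bdd_aboveI2)
  then show ?thesis
    using assms by (auto simp: d0_def intro: cSUP_upper)
qed

lemma Metric_space_TH0: "Metric_space (carrier TH0) d0"
proof
  fix x y
  show "0 \<le> d0 x y"
  proof (cases "x \<in> carrier TH0 \<and> y \<in> carrier TH0")
    case True
    then show ?thesis
      using dist_le_d0[of x y 0] order_trans[OF zero_le_dist] by blast
  qed (auto simp: d0_def)
  show "d0 x y = d0 y x"
    by (simp add: d0_def dist_commute)
next
  fix x y assume xy: "x \<in> carrier TH0" "y \<in> carrier TH0"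
  show "d0 x y = 0 \<longleftrightarrow> x = y"
  proof
    assume "d0 x y = 0"
    then show "x = y"
      using dist_le_d0[OF xy] by (intro ext) simp
  qed (use xy in \<open>simp add: d0_def\<close>)
next
  fix x y z assume xyz: "x \<in> carrier TH0" "y \<in> carrier TH0" "z \<in> carrier TH0"
  have "dist (x n) (z n) \<le> d0 x y + d0 y z" for n
    using dist_triangle[of "x n" "z n" "y n"] dist_le_d0[OF xyz(1,2), of n]
      dist_le_d0[OF xyz(2,3), of n] by linarith
  then show "d0 x z \<le> d0 x y + d0 y z"
    using xyz by (subst (1) d0_def) (auto intro: cSUP_least)
qed

end

theory Submission
  imports Defs
begin

text \<open>
  A subgroup characterized by \<open>u\<close> is the set of points whose sequence of character values lies
  in \<open>TH0\<close>, so it is the first projection of the graph of \<open>x \<mapsto> (u n x)\<^sub>n\<close>, cut off at \<open>TH0\<close>.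

  For the first claim, that graph is dually closed because a point \<open>(x, z)\<close> off it has
  \<open>u n x \<noteq> z n\<close> for some \<open>n\<close>, and the character \<open>(x, z) \<mapsto> u n x / z n\<close> detects this.
  Conversely, let \<open>x\<close> satisfy \<open>u n x \<longlonglongrightarrow> 1\<close> and let \<open>f\<close> be a character of the product that is
  trivial on the graph over \<open>G\<close>. Every continuous character of \<open>TH0\<close> depends on finitely many
  coordinates only (\<open>TH0_character_finitely_determined\<close>): otherwise elements of a small ball with
  disjoint supports could be multiplied until the argument of the value passes a quarter turn,
  although the product stays in the ball. Hence \<open>f\<close> agrees on the graph with a continuous function
  of \<open>x\<close> alone. That function is 1 on the dense set \<open>G\<close>, hence everywhere, so \<open>f\<close> cannot separate
  \<open>(x, u x)\<close> from the graph, and dual closedness puts \<open>x\<close> into \<open>G\<close>.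

  For the second claim, let \<open>K\<close> be the closure of \<open>G\<close>. A sequence characterizing \<open>G\<close> in \<open>X\<close>
  restricts to \<open>K\<close>. Conversely, the characters of \<open>K\<close> in a given sequence are extended to \<open>X\<close>
  (\<open>character_extension\<close>) and interleaved with countably many characters that are trivial on \<open>K\<close>
  and together cut out \<open>K\<close> (\<open>separating_sequence\<close>). Each of the latter is repeated infinitely
  often, so that its value at a point of the characterized set must be equal to 1.

  Both of these ingredients need enough characters on a compact abelian group, and this is where
  the work lies. An invariant mean on continuous functions (\<open>invariant_mean_exists\<close>)
  gives an inner product and self-adjoint convolution operators, which have
  equicontinuous images of bounded sets and hence eigenfunctions (\<open>spectral_lemma\<close>). On an eigenspace
  the translations commute with each other and have common eigenvectors, and a function that
  is an eigenvector of every translation is a multiple of a character. The outcome is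
  \<open>character_with_nonzero_coefficient\<close>: a nonzero Hermitian continuous function has a nonzero
  Fourier coefficient. Applied to functions that transform under \<open>K\<close> by a given character,
  it extends that character; applied to a suitable \<open>K\<close>-invariant function, it yields a character
  trivial on \<open>K\<close> but not at a given point outside \<open>K\<close>.
\<close>

section \<open>Continuous functions on a compact abelian group\<close>

text \<open>Tychonoff's theorem for the topology of pointwise convergence. It supplies limit points
  twice below: for functionals, to obtain the invariant mean, and for functions, to obtain
  eigenfunctions and characters.\<close>

lemma compact_pointwise_Collect:
  fixes K :: "'i \<Rightarrow> ('b::topological_space) set"
  assumes "\<And>i. compact (K i)"
  shows "compact {f. \<forall>i. f i \<in> K i}"
proof -
  have "compactin (product_topology (\<lambda>i. euclidean) UNIV) (PiE UNIV K)"
    using assms by (simp add: compactin_PiE)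
  moreover have "PiE UNIV K = {f. \<forall>i. f i \<in> K i}"
    by (auto simp: PiE_def)
  ultimately show ?thesis
    by (simp add: euclidean_product_topology)
qed

lemmas closed_pointwise_intros = closed_Collect_conj closed_Collect_all closed_Collect_imp
  open_Collect_const closed_Collect_eq closed_Collect_le continuous_on_product_coordinates

locale compact_abelian_group = abelian_topological_group Y T
  for Y :: "('a, 'm) monoid_scheme" (structure) and T +
  assumes compact: "compact_space T" and Hausdorff: "Hausdorff_space T"
begin

text \<open>Values off the carrier are unconstrained, so equations between elements of this set
  are stated on the carrier.\<close>

definition cont :: "('a \<Rightarrow> complex) set" where
  "cont = {f. continuous_map T euclidean f}"

lemma cont_compose2:
  assumes "f \<in> cont" "g \<in> cont" "continuous_on UNIV (\<lambda>p. h (fst p) (snd p))"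
  shows "(\<lambda>x. h (f x) (g x)) \<in> cont"
proof -
  have "continuous_map T (prod_topology euclidean euclidean) (\<lambda>x. (f x, g x))"
    using assms(1,2) unfolding continuous_map_pairwise by (simp add: cont_def o_def)
  moreover have "continuous_map euclidean euclidean (\<lambda>p. h (fst p) (snd p))"
    using assms(3) by (subst continuous_map_iff_continuous2)
  ultimately have "continuous_map T euclidean ((\<lambda>p. h (fst p) (snd p)) \<circ> (\<lambda>x. (f x, g x)))"
    using continuous_map_compose unfolding prod_topology_euclidean by blast
  then show ?thesis
    by (simp add: cont_def o_def)
qed

lemma cont_compose:
  assumes "f \<in> cont" "continuous_on UNIV h"
  shows "(\<lambda>x. h (f x)) \<in> cont"
  using continuous_map_compose[of T euclidean f euclidean h] assms by (simp add: cont_def o_def)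

lemma cont_const [simp, intro]: "(\<lambda>x. c) \<in> cont"
  by (simp add: cont_def)

lemma cont_add [intro]: "f \<in> cont \<Longrightarrow> g \<in> cont \<Longrightarrow> (\<lambda>x. f x + g x) \<in> cont"
  using cont_compose2[of f g "\<lambda>a b. a+b"] by (simp add: continuous_intros)

lemma cont_diff [intro]: "f \<in> cont \<Longrightarrow> g \<in> cont \<Longrightarrow> (\<lambda>x. f x - g x) \<in> cont"
  using cont_compose2[of f g "(-)"] by (simp add: continuous_intros)

lemma cont_mult [intro]: "f \<in> cont \<Longrightarrow> g \<in> cont \<Longrightarrow> (\<lambda>x. f x * g x) \<in> cont"
  using cont_compose2[of f g "(*)"] by (simp add: continuous_intros)

lemma cont_cnj [intro]: "f \<in> cont \<Longrightarrow> (\<lambda>x. cnj (f x)) \<in> cont"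
  using cont_compose[of f cnj] by (simp add: continuous_intros)

lemma cont_sum [intro]: "(\<And>i. i \<in> I \<Longrightarrow> f i \<in> cont) \<Longrightarrow> (\<lambda>x. \<Sum>i\<in>I. f i x) \<in> cont"
  by (induction I rule: infinite_finite_induct) auto

lemmas cont_intros = cont_const cont_add cont_diff cont_mult cont_cnj cont_sum

lemma cont_cong:
  assumes "f \<in> cont" "\<And>x. x \<in> carrier Y \<Longrightarrow> f x = g x"
  shows "g \<in> cont"
  using assms continuous_map_eq[of T euclidean f g] by (simp add: cont_def topspace_eq_carrier)

lemma continuous_map_translate:
  assumes "a \<in> carrier Y"
  shows "continuous_map T T (\<lambda>x. a \<otimes> x)"
proof -
  have "continuous_map T (prod_topology T T) (\<lambda>x. (a, x))"
    using assms by (intro continuous_map_pairedI) (auto simp: topspace_eq_carrier)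
  from continuous_map_compose[OF this continuous_mult] show ?thesis
    by (simp add: o_def)
qed

lemma cont_translate:
  assumes "f \<in> cont" "a \<in> carrier Y"
  shows "(\<lambda>x. f (a \<otimes> x)) \<in> cont"
  using continuous_map_compose[OF continuous_map_translate[OF assms(2)], of euclidean f] assms(1)
  by (simp add: cont_def o_def)

lemma cont_inv:
  assumes "f \<in> cont"
  shows "(\<lambda>x. f (inv x)) \<in> cont"
  using continuous_map_compose[OF continuous_inv, of euclidean f] assms
  by (simp add: cont_def o_def)

lemma cont_bounded:
  assumes "f \<in> cont"
  obtains B where "B > 0" "\<And>x. x \<in> carrier Y \<Longrightarrow> norm (f x) \<le> B"
proof -
  have "compact (f ` carrier Y)"
    using image_compactin[of T "topspace T" euclidean f] assms compact
    by (auto simp: cont_def compact_space_def topspace_eq_carrier)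
  then obtain B where "B > 0" "\<And>x. x \<in> carrier Y \<Longrightarrow> norm (f x) \<le> B"
    using compact_imp_bounded bounded_pos by (metis imageI)
  then show ?thesis
    by (rule that)
qed

text \<open>By the tube lemma, the open set of pairs \<open>(v, x)\<close> at which \<open>f\<close> moves by less than \<open>e\<close> contains
  a tube around the slice at the identity.\<close>

lemma uniform_continuity:
  assumes "f \<in> cont" "e > 0"
  obtains V where "openin T V" "\<one> \<in> V"
    "\<And>v x. v \<in> V \<Longrightarrow> x \<in> carrier Y \<Longrightarrow> norm (f (v \<otimes> x) - f x) < e"
proof -
  let ?P = "prod_topology T T"
  define F where "F p = norm (f (fst p \<otimes> snd p) - f (snd p))" for p
  have m: "continuous_map ?P T (\<lambda>p. fst p \<otimes> snd p)"
    using continuous_mult by (simp add: case_prod_unfold)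
  have "continuous_map ?P euclidean (\<lambda>p. f (fst p \<otimes> snd p))"
    using continuous_map_compose[OF m, of euclidean f] assms(1) by (simp add: cont_def o_def)
  moreover have "continuous_map ?P euclidean (\<lambda>p. f (snd p))"
    using continuous_map_compose[OF continuous_map_snd, of T euclidean f T] assms(1)
    by (simp add: cont_def o_def)
  ultimately have "continuous_map ?P euclidean F"
    unfolding F_def by (intro continuous_intros)
  then have op: "openin ?P {p \<in> topspace ?P. F p \<in> {..<e}}"
    by (rule openin_continuous_map_preimage) auto
  have 1: "\<one> \<in> topspace T"
    by (simp add: topspace_eq_carrier)
  \<comment> \<open>At the identity the displacement vanishes.\<close>
  have "{\<one>} \<times> topspace T \<subseteq> {p \<in> topspace ?P. F p \<in> {..<e}}"
    using assms(2) by (auto simp: F_def topspace_eq_carrier)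
  from tube_lemma_right[OF op _ 1 this] compact
  obtain U V where UV: "openin T U" "\<one> \<in> U" "topspace T \<subseteq> V"
      "U \<times> V \<subseteq> {p \<in> topspace ?P. F p \<in> {..<e}}"
    by (auto simp: compact_space_def)
  show ?thesis
  proof (rule that[OF UV(1,2)])
    fix v x assume "v \<in> U" "x \<in> carrier Y"
    then have "(v, x) \<in> U \<times> V"
      using UV(3) by (auto simp: topspace_eq_carrier)
    then have "(v, x) \<in> {p \<in> topspace ?P. F p \<in> {..<e}}"
      using UV(4) by blast
    then show "norm (f (v \<otimes> x) - f x) < e"
      by (simp add: F_def)
  qed
qed

lemma openin_translates:
  assumes "openin T V" "a \<in> carrier Y"
  shows "openin T {x \<in> carrier Y. a \<otimes> x \<in> V}"
  using openin_continuous_map_preimage[OF continuous_map_translate[OF assms(2)] assms(1)]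
  by (simp add: topspace_eq_carrier)

lemma finite_translates_cover:
  assumes "openin T V" "z \<in> V"
  obtains A where "finite A" "A \<subseteq> carrier Y" "\<And>x. x \<in> carrier Y \<Longrightarrow> \<exists>a\<in>A. a \<otimes> x \<in> V"
proof -
  have zc: "z \<in> carrier Y"
    using assms openin_subset topspace_eq_carrier by blast
  define W where "W a = {x \<in> carrier Y. a \<otimes> x \<in> V}" for a
  have "\<exists>\<F>. finite \<F> \<and> \<F> \<subseteq> W ` carrier Y \<and> topspace T \<subseteq> \<Union>\<F>"
  proof (rule compactinD)
    show "compactin T (topspace T)"
      using compact by (simp add: compact_space_def)
    show "topspace T \<subseteq> \<Union>(W ` carrier Y)"
    proof
      fix x assume "x \<in> topspace T"
      then have x: "x \<in> carrier Y" by (simp add: topspace_eq_carrier)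
      then have "x \<in> W (z \<otimes> inv x)"
        using zc assms(2) by (simp add: W_def m_assoc)
      then show "x \<in> \<Union>(W ` carrier Y)"
        using x zc by (meson UN_I inv_closed m_closed)
    qed
  qed (use openin_translates[OF assms(1)] in \<open>auto simp: W_def\<close>)
  then obtain A where A: "finite A" "A \<subseteq> carrier Y" "topspace T \<subseteq> \<Union>(W ` A)"
    by (metis finite_subset_image)
  show ?thesis
  proof (rule that[OF A(1,2)])
    fix x assume "x \<in> carrier Y"
    then have "x \<in> \<Union>(W ` A)"
      using A(3) by (auto simp: topspace_eq_carrier)
    then show "\<exists>a\<in>A. a \<otimes> x \<in> V"
      by (auto simp: W_def)
  qed
qed

text \<open>Uniform smallness of the displacement near the identity gives continuity at every point by
  translation. Most functions constructed below are shown to be continuous in this way.\<close>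

lemma cont_if_uniform:
  assumes "\<And>e. e > 0 \<Longrightarrow> \<exists>V. openin T V \<and> \<one> \<in> V \<and>
      (\<forall>v\<in>V. \<forall>x\<in>carrier Y. norm (f (v \<otimes> x) - f x) \<le> e)"
  shows "f \<in> cont"
proof -
  have "\<exists>U. openin T U \<and> x \<in> U \<and> (\<forall>y\<in>U. f y \<in> ball (f x) e)"
    if x: "x \<in> topspace T" and e: "e > 0" for x e
  proof -
    from assms[of "e/2"] e obtain V where V: "openin T V" "\<one> \<in> V"
        "\<And>v x. v \<in> V \<Longrightarrow> x \<in> carrier Y \<Longrightarrow> norm (f (v \<otimes> x) - f x) \<le> e/2"
      by (auto)
    have xc: "x \<in> carrier Y" using x by (simp add: topspace_eq_carrier)
    let ?U = "{y \<in> carrier Y. inv x \<otimes> y \<in> V}"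
    have "f y \<in> ball (f x) e" if "y \<in> ?U" for y
    proof -
      have "norm (f ((inv x \<otimes> y) \<otimes> x) - f x) \<le> e/2"
        using that xc by (intro V(3)) auto
      moreover have "(inv x \<otimes> y) \<otimes> x = y"
        using that xc by (simp add: m_comm[of "inv x \<otimes> y" x] m_assoc[symmetric])
      ultimately show ?thesis
        using e by (simp add: dist_norm norm_minus_commute)
    qed
    then show ?thesis
      using openin_translates[OF V(1), of "inv x"] V(2) xc by (intro exI[of _ ?U]) auto
  qed
  then show ?thesis
    using Met_TC.continuous_map_to_metric[of T f] by (simp add: cont_def del: mem_ball)
qed

section \<open>The invariant mean\<close>

definition sup_norm :: "('a \<Rightarrow> complex) \<Rightarrow> real" where
  "sup_norm f = (SUP x\<in>carrier Y. norm (f x))"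

lemma norm_le_sup_norm:
  assumes "f \<in> cont" "x \<in> carrier Y"
  shows "norm (f x) \<le> sup_norm f"
proof -
  obtain B where "\<And>x. x \<in> carrier Y \<Longrightarrow> norm (f x) \<le> B"
    using cont_bounded[OF assms(1)] by blast
  then have "bdd_above ((\<lambda>x. norm (f x)) ` carrier Y)"
    by (intro bdd_aboveI2)
  then show ?thesis
    unfolding sup_norm_def by (intro cSUP_upper assms(2))
qed

lemma sup_norm_le:
  assumes "\<And>x. x \<in> carrier Y \<Longrightarrow> norm (f x) \<le> B"
  shows "sup_norm f \<le> B"
  unfolding sup_norm_def using assms by (intro cSUP_least) auto

lemma sup_norm_nonneg: "f \<in> cont \<Longrightarrow> 0 \<le> sup_norm f"
  using norm_le_sup_norm[of f \<one>] norm_ge_zero order_trans by blast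

text \<open>Setting \<open>m f = 0\<close> off \<^term>\<open>cont\<close> makes the set of means a closed part of a product of compact
  discs. Invariance is recorded for a set \<open>S\<close> of translations, because it is achieved for
  one translation at a time.\<close>

definition invariant_mean :: "'a set \<Rightarrow> (('a \<Rightarrow> complex) \<Rightarrow> complex) \<Rightarrow> bool" where
  "invariant_mean S m \<longleftrightarrow>
     (\<forall>f. f \<notin> cont \<longrightarrow> m f = 0) \<and>
     (\<forall>f\<in>cont. norm (m f) \<le> sup_norm f) \<and>
     (\<forall>f\<in>cont. \<forall>g\<in>cont. m (\<lambda>x. f x + g x) = m f + m g) \<and>
     (\<forall>f\<in>cont. \<forall>c. m (\<lambda>x. c * f x) = c * m f) \<and>
     (\<forall>f\<in>cont. m (\<lambda>x. cnj (f x)) = cnj (m f)) \<and>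
     (\<forall>f\<in>cont. (\<forall>x\<in>carrier Y. 0 \<le> Re (f x)) \<longrightarrow> 0 \<le> Re (m f)) \<and>
     m (\<lambda>x. 1) = 1 \<and>
     (\<forall>b\<in>S. \<forall>f\<in>cont. m (\<lambda>x. f (b \<otimes> x)) = m f)"

lemma
  assumes "invariant_mean S m"
  shows invariant_mean_norm_le: "f \<in> cont \<Longrightarrow> norm (m f) \<le> sup_norm f"
    and invariant_mean_add: "f \<in> cont \<Longrightarrow> g \<in> cont \<Longrightarrow> m (\<lambda>x. f x + g x) = m f + m g"
    and invariant_mean_cmult: "f \<in> cont \<Longrightarrow> m (\<lambda>x. c * f x) = c * m f"
    and invariant_mean_cnj: "f \<in> cont \<Longrightarrow> m (\<lambda>x. cnj (f x)) = cnj (m f)"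
    and invariant_mean_nonneg: "f \<in> cont \<Longrightarrow> (\<And>x. x \<in> carrier Y \<Longrightarrow> 0 \<le> Re (f x)) \<Longrightarrow> 0 \<le> Re (m f)"
    and invariant_mean_one: "m (\<lambda>x. 1) = 1"
    and invariant_mean_translate: "b \<in> S \<Longrightarrow> f \<in> cont \<Longrightarrow> m (\<lambda>x. f (b \<otimes> x)) = m f"
  using assms by (simp_all add: invariant_mean_def)

lemma invariant_mean_diff:
  assumes "invariant_mean S m" "f \<in> cont" "g \<in> cont"
  shows "m (\<lambda>x. f x - g x) = m f - m g"
proof -
  have "(\<lambda>x. - 1 * g x) \<in> cont"
    by (intro cont_mult assms cont_const)
  then show ?thesis
    using invariant_mean_add[OF assms(1,2), of "\<lambda>x. - 1 * g x"] invariant_mean_cmult[OF assms(1,3), of "- 1"] by simp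
qed

lemma invariant_mean_cong:
  assumes "invariant_mean S m" "\<And>x. x \<in> carrier Y \<Longrightarrow> f x = g x"
  shows "m f = m g"
proof (cases "f \<in> cont")
  case True
  then have g: "g \<in> cont" using assms(2) by (rule cont_cong)
  have "norm (m (\<lambda>x. f x - g x)) \<le> sup_norm (\<lambda>x. f x - g x)"
    using True g by (intro invariant_mean_norm_le[OF assms(1)]) auto
  also have "\<dots> \<le> 0"
    by (rule sup_norm_le) (simp add: assms(2))
  finally show ?thesis
    using invariant_mean_diff[OF assms(1) True g] by simp
next
  case False
  moreover have "g \<notin> cont"
    using False cont_cong[of g f] assms(2) by metis
  ultimately show ?thesis
    using assms(1) by (simp add: invariant_mean_def)
qed

lemma compact_invariant_means: "compact {m. invariant_mean S m}"
proof -
  let ?B = "{m. \<forall>f. m f \<in> cball 0 (if f \<in> cont then sup_norm f else 0)}"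
  let ?C = "{m. (\<forall>f\<in>cont. \<forall>g\<in>cont. m (\<lambda>x. f x + g x) = m f + m g) \<and>
     (\<forall>f\<in>cont. \<forall>c. m (\<lambda>x. c * f x) = c * m f) \<and>
     (\<forall>f\<in>cont. m (\<lambda>x. cnj (f x)) = cnj (m f)) \<and>
     (\<forall>f\<in>cont. (\<forall>x\<in>carrier Y. 0 \<le> Re (f x)) \<longrightarrow> 0 \<le> Re (m f)) \<and>
     m (\<lambda>x. 1) = 1 \<and>
     (\<forall>b\<in>S. \<forall>f\<in>cont. m (\<lambda>x. f (b \<otimes> x)) = m f)}"
  have "closed ?C"
    unfolding Ball_def
    by (intro closed_pointwise_intros continuous_intros)
  then have "compact (?B \<inter> ?C)"
    by (intro compact_Int_closed compact_pointwise_Collect) auto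
  moreover have "?B \<inter> ?C = {m. invariant_mean S m}"
    by (auto simp: invariant_mean_def split: if_splits)
  ultimately show ?thesis
    by simp
qed

lemma cont_power_translate:
  assumes "f \<in> cont" "b \<in> carrier Y"
  shows "(\<lambda>x. f (b [^] (k::nat) \<otimes> x)) \<in> cont"
  using assms by (intro cont_translate) auto

text \<open>The averages \<open>(1/n) \<Sum>k<n. m \<circ> \<tau>^k\<close> of a mean over the powers of the translation \<open>\<tau>\<close> by \<open>b\<close> move
  under \<open>\<tau>\<close> by at most \<open>2 sup_norm f / n\<close>, by telescoping, so a limit point is invariant under \<open>\<tau>\<close>.
  Because translations commute, the invariance under \<open>S\<close> is not lost.\<close>

lemma invariant_mean_insert:
  assumes m: "invariant_mean S m" and S: "S \<subseteq> carrier Y" and b: "b \<in> carrier Y"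
  shows "\<exists>m'. invariant_mean (insert b S) m'"
proof -
  define tr where "tr f k = (\<lambda>x. f (b [^] (k::nat) \<otimes> x))" for f :: "'a \<Rightarrow> complex" and k
  define av where "av n f = (if f \<in> cont then (\<Sum>k<Suc n. m (tr f k)) / of_nat (Suc n) else 0)"
    for n f
  have tr: "tr f k \<in> cont" if "f \<in> cont" for f k
    unfolding tr_def using that b by (rule cont_power_translate)
  have m_norm: "norm (m (tr f k)) \<le> sup_norm f" if "f \<in> cont" for f k
  proof -
    have "sup_norm (tr f k) \<le> sup_norm f"
      using that b by (intro sup_norm_le) (auto simp: tr_def norm_le_sup_norm)
    then show ?thesis using invariant_mean_norm_le[OF m tr[OF that]] by (rule order_trans[rotated])
  qed
  have av: "invariant_mean S (av n)" for n
    unfolding invariant_mean_def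
  proof (intro conjI allI ballI impI)
    fix f assume f: "f \<in> cont"
    have "norm (\<Sum>k<Suc n. m (tr f k)) \<le> real (Suc n) * sup_norm f"
      using sum_norm_bound[of "{..<Suc n}" "\<lambda>k. m (tr f k)" "sup_norm f"] m_norm[OF f]
      by simp
    then show "norm (av n f) \<le> sup_norm f"
      using f by (simp add: av_def norm_divide divide_le_eq mult.commute
        del: of_nat_Suc sum.lessThan_Suc)
  next
    fix f g assume fg: "f \<in> cont" "g \<in> cont"
    have "m (tr (\<lambda>x. f x + g x) k) = m (tr f k) + m (tr g k)" for k
      using invariant_mean_add[OF m tr[OF fg(1)] tr[OF fg(2)]] by (simp add: tr_def)
    then show "av n (\<lambda>x. f x + g x) = av n f + av n g"
      using fg by (simp add: av_def cont_add sum.distrib add_divide_distrib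
          del: of_nat_Suc sum.lessThan_Suc)
  next
    fix f and c :: complex assume f: "f \<in> cont"
    have "m (tr (\<lambda>x. c * f x) k) = c * m (tr f k)" for k
      using invariant_mean_cmult[OF m tr[OF f]] by (simp add: tr_def)
    then show "av n (\<lambda>x. c * f x) = c * av n f"
      using f by (simp add: av_def cont_mult sum_distrib_left del: of_nat_Suc sum.lessThan_Suc)
  next
    fix f assume f: "f \<in> cont"
    have "m (tr (\<lambda>x. cnj (f x)) k) = cnj (m (tr f k))" for k
      using invariant_mean_cnj[OF m tr[OF f]] by (simp add: tr_def)
    then show "av n (\<lambda>x. cnj (f x)) = cnj (av n f)"
      using f by (simp add: av_def cont_cnj cnj_sum del: of_nat_Suc sum.lessThan_Suc)
  next
    fix f assume f: "f \<in> cont" and pos: "\<forall>x\<in>carrier Y. 0 \<le> Re (f x)"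
    have "0 \<le> Re (m (tr f k))" for k
      using pos b by (intro invariant_mean_nonneg[OF m tr[OF f]]) (simp add: tr_def)
    then have "0 \<le> Re (\<Sum>k<Suc n. m (tr f k))"
      unfolding Re_sum by (intro sum_nonneg)
    then show "0 \<le> Re (av n f)"
      using f by (simp add: av_def Re_divide_of_nat del: of_nat_Suc sum.lessThan_Suc)
  next
    have "m (tr (\<lambda>x. 1) k) = 1" for k
      using invariant_mean_one[OF m] by (simp add: tr_def)
    then show "av n (\<lambda>x. 1) = 1"
      by (simp add: av_def del: of_nat_Suc)
  next
    fix a f assume a: "a \<in> S" and f: "f \<in> cont"
    have ac: "a \<in> carrier Y" using a S by blast
    have "m (tr (\<lambda>x. f (a \<otimes> x)) k) = m (tr f k)" for k
    proof -
      have "m (tr (\<lambda>x. f (a \<otimes> x)) k) = m (\<lambda>x. tr f k (a \<otimes> x))"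
        using ac b by (intro invariant_mean_cong[OF m]) (simp add: tr_def m_lcomm)
      then show ?thesis
        using invariant_mean_translate[OF m a tr[OF f]] by simp
    qed
    then show "av n (\<lambda>x. f (a \<otimes> x)) = av n f"
      using f ac by (simp add: av_def cont_translate del: of_nat_Suc sum.lessThan_Suc)
  qed (simp add: av_def)
  have av_b: "norm (av n (\<lambda>x. f (b \<otimes> x)) - av n f) \<le> 2 * sup_norm f / Suc n"
    if f: "f \<in> cont" for f n
  proof -
    have "m (tr (\<lambda>x. f (b \<otimes> x)) k) = m (tr f (Suc k))" for k
      using b by (intro invariant_mean_cong[OF m]) (simp add: tr_def m_assoc m_comm m_lcomm)
    then have "av n (\<lambda>x. f (b \<otimes> x)) - av n f
        = (\<Sum>k<Suc n. m (tr f (Suc k)) - m (tr f k)) / of_nat (Suc n)"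
      using f b by (simp add: av_def cont_translate sum_subtractf diff_divide_distrib
          del: of_nat_Suc sum.lessThan_Suc)
    also have "\<dots> = (m (tr f (Suc n)) - m (tr f 0)) / of_nat (Suc n)"
      by (subst sum_lessThan_telescope) simp
    finally show ?thesis
      using norm_triangle_ineq4[of "m (tr f (Suc n))" "m (tr f 0)"] m_norm[OF f, of "Suc n"]
        m_norm[OF f, of 0]
      by (simp add: norm_divide divide_right_mono del: of_nat_Suc)
  qed
  define W where "W j = {m :: ('a \<Rightarrow> complex) \<Rightarrow> complex. \<forall>f\<in>cont. norm (m (\<lambda>x. f (b \<otimes> x)) - m f) \<le> 2 * sup_norm f / Suc j}"
    for j :: nat
  have "{m. invariant_mean S m} \<inter> (\<Inter>j\<in>UNIV. W j) \<noteq> {}"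
  proof (rule compact_imp_fip_image[OF compact_invariant_means])
    show "closed (W j)" for j
      unfolding W_def Ball_def
      by (intro closed_pointwise_intros continuous_intros)
    fix J :: "nat set" assume "finite J"
    then obtain n where n: "\<And>j. j \<in> J \<Longrightarrow> j \<le> n"
      unfolding finite_nat_set_iff_bounded_le by auto
    have "av n \<in> W j" if "j \<in> J" for j
      unfolding W_def
    proof (intro CollectI ballI)
      fix f assume f: "f \<in> cont"
      have "2 * sup_norm f / Suc n \<le> 2 * sup_norm f / Suc j"
        using n[OF that] sup_norm_nonneg[OF f] by (intro divide_left_mono) auto
      then show "norm (av n (\<lambda>x. f (b \<otimes> x)) - av n f) \<le> 2 * sup_norm f / Suc j"
        using av_b[OF f, of n] by linarith
    qed
    then show "{m. invariant_mean S m} \<inter> (\<Inter>j\<in>J. W j) \<noteq> {}"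
      using av[of n] by blast
  qed
  then obtain m' where m': "invariant_mean S m'" "\<And>j. m' \<in> W j"
    by auto
  have "m' (\<lambda>x. f (b \<otimes> x)) = m' f" if f: "f \<in> cont" for f
  proof -
    have "(\<lambda>j. 2 * sup_norm f / Suc j) \<longlonglongrightarrow> 0"
      by (rule LIMSEQ_Suc[OF lim_const_over_n])
    moreover have "norm (m' (\<lambda>x. f (b \<otimes> x)) - m' f) \<le> 2 * sup_norm f / Suc j" for j
      using m'(2)[of j] f by (auto simp: W_def)
    ultimately have "norm (m' (\<lambda>x. f (b \<otimes> x)) - m' f) \<le> 0"
      by (intro LIMSEQ_le_const) auto
    then show ?thesis by simp
  qed
  then have "invariant_mean (insert b S) m'"
    using m'(1) by (simp add: invariant_mean_def)
  then show ?thesis by blast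
qed

lemma invariant_mean_eval: "invariant_mean {} (\<lambda>f. if f \<in> cont then f \<one> else 0)"
  by (auto simp: invariant_mean_def cont_add cont_mult cont_cnj norm_le_sup_norm)

text \<open>Means invariant under finitely many translations exist, starting from evaluation at the
  identity, and compactness passes to all translations at once.\<close>

theorem invariant_mean_exists: "\<exists>m. invariant_mean (carrier Y) m"
proof -
  have fin: "\<exists>m. invariant_mean S m" if "finite S" "S \<subseteq> carrier Y" for S
    using that
  proof (induction S)
    case empty
    then show ?case using invariant_mean_eval by blast
  next
    case (insert b S)
    then show ?case using invariant_mean_insert[of S] by blast
  qed
  define Z where "Z b = {m. \<forall>f\<in>cont. m (\<lambda>x. f (b \<otimes> x)) = (m f :: complex)}" for b
  have "{m. invariant_mean {} m} \<inter> (\<Inter>b\<in>carrier Y. Z b) \<noteq> {}"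
  proof (rule compact_imp_fip_image[OF compact_invariant_means])
    show "closed (Z b)" for b
      unfolding Z_def Ball_def
      by (intro closed_pointwise_intros continuous_intros)
    fix S assume S: "finite S" "S \<subseteq> carrier Y"
    then obtain m where "invariant_mean S m" using fin by blast
    then have "invariant_mean {} m" "\<And>b. b \<in> S \<Longrightarrow> m \<in> Z b"
      by (simp_all add: invariant_mean_def Z_def)
    then show "{m. invariant_mean {} m} \<inter> (\<Inter>b\<in>S. Z b) \<noteq> {}"
      by blast
  qed
  then obtain m where m: "invariant_mean {} m" "\<And>b. b \<in> carrier Y \<Longrightarrow> m \<in> Z b"
    by auto
  then have "invariant_mean (carrier Y) m"
    by (simp add: invariant_mean_def Z_def)
  then show ?thesis by blast
qed

definition mean :: "('a \<Rightarrow> complex) \<Rightarrow> complex" where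
  "mean = (SOME m. invariant_mean (carrier Y) m)"

lemma invariant_mean_mean: "invariant_mean (carrier Y) mean"
  unfolding mean_def by (rule someI_ex[OF invariant_mean_exists])

lemmas mean_norm_le = invariant_mean_norm_le[OF invariant_mean_mean]
lemmas mean_add = invariant_mean_add[OF invariant_mean_mean]
lemmas mean_diff = invariant_mean_diff[OF invariant_mean_mean]
lemmas mean_cmult = invariant_mean_cmult[OF invariant_mean_mean]
lemmas mean_cnj = invariant_mean_cnj[OF invariant_mean_mean]
lemmas mean_nonneg = invariant_mean_nonneg[OF invariant_mean_mean]
lemmas mean_one = invariant_mean_one[OF invariant_mean_mean]
lemmas mean_translate = invariant_mean_translate[OF invariant_mean_mean]
lemmas mean_cong = invariant_mean_cong[OF invariant_mean_mean]

section \<open>The inner product defined by the mean\<close>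

lemma mean_sum:
  "(\<And>i. i \<in> I \<Longrightarrow> f i \<in> cont) \<Longrightarrow> mean (\<lambda>x. \<Sum>i\<in>I. f i x) = (\<Sum>i\<in>I. mean (f i))"
proof (induction I rule: infinite_finite_induct)
  case (insert i I)
  then have "mean (\<lambda>x. f i x + (\<Sum>i\<in>I. f i x)) = mean (f i) + mean (\<lambda>x. \<Sum>i\<in>I. f i x)"
    by (intro mean_add cont_sum) auto
  with insert show ?case by simp
qed (use mean_cmult[of "\<lambda>x. 1" 0] in auto)

lemma mean_const: "mean (\<lambda>x. c) = c"
  using mean_cmult[of "\<lambda>x. 1" c] mean_one by simp

lemma mean_dist_le:
  assumes "f \<in> cont" "g \<in> cont" "\<And>x. x \<in> carrier Y \<Longrightarrow> norm (f x - g x) \<le> e"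
  shows "norm (mean f - mean g) \<le> e"
proof -
  have "norm (mean (\<lambda>x. f x - g x)) \<le> sup_norm (\<lambda>x. f x - g x)"
    using assms by (intro mean_norm_le) auto
  also have "\<dots> \<le> e" using assms(3) by (rule sup_norm_le)
  finally show ?thesis using mean_diff[OF assms(1,2)] by simp
qed

lemma mean_norm_le_bound:
  assumes "f \<in> cont" "\<And>x. x \<in> carrier Y \<Longrightarrow> norm (f x) \<le> e"
  shows "norm (mean f) \<le> e"
  using mean_dist_le[OF assms(1) cont_const[of 0], of e] assms(2) mean_const[of 0] by simp

text \<open>Finitely many translates of the set where \<open>Re f > d\<close> cover the group, and all of these
  translates of \<open>f\<close> have the same mean. This faithfulness makes the form below definite.\<close>

lemma mean_pos:
  assumes f: "f \<in> cont" and nonneg: "\<And>x. x \<in> carrier Y \<Longrightarrow> 0 \<le> Re (f x)"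
    and z: "z \<in> carrier Y" "0 < Re (f z)"
  shows "0 < Re (mean f)"
proof -
  define d where "d = Re (f z) / 2"
  have d: "0 < d" "d < Re (f z)" using z(2) by (auto simp: d_def)
  have op: "openin T {x \<in> topspace T. f x \<in> {w. d < Re w}}"
    using f by (intro openin_continuous_map_preimage[where Y = euclidean])
      (auto simp: cont_def open_halfspace_Re_gt)
  have "z \<in> {x \<in> topspace T. f x \<in> {w. d < Re w}}"
    using z d by (simp add: topspace_eq_carrier)
  from finite_translates_cover[OF op this] obtain A where A: "finite A" "A \<subseteq> carrier Y"
      "\<And>x. x \<in> carrier Y \<Longrightarrow> \<exists>a\<in>A. a \<otimes> x \<in> {x \<in> topspace T. f x \<in> {w. d < Re w}}"
    by blast
  let ?s = "\<lambda>x. \<Sum>a\<in>A. f (a \<otimes> x)"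
  have s: "?s \<in> cont"
    using A(2) f by (intro cont_sum cont_translate) auto
  have "0 \<le> Re (?s x - of_real d)" if x: "x \<in> carrier Y" for x
  proof -
    obtain a where a: "a \<in> A" "d < Re (f (a \<otimes> x))" using A(3)[OF x] by auto
    have "Re (f (a \<otimes> x)) \<le> (\<Sum>a\<in>A. Re (f (a \<otimes> x)))"
      using A nonneg x a(1) by (intro member_le_sum) auto
    with a show ?thesis by simp
  qed
  then have "0 \<le> Re (mean (\<lambda>x. ?s x - of_real d))"
    using s by (intro mean_nonneg) auto
  also have "mean (\<lambda>x. ?s x - of_real d) = mean ?s - of_real d"
    using s mean_diff[OF s cont_const] by (simp add: mean_const)
  also have "mean ?s = (\<Sum>a\<in>A. mean (\<lambda>x. f (a \<otimes> x)))"
    using A(2) f by (intro mean_sum cont_translate) auto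
  also have "\<dots> = (\<Sum>a\<in>A. mean f)"
    using A(2) f by (intro sum.cong mean_translate) auto
  finally have "d \<le> real (card A) * Re (mean f)" by simp
  then have "0 < real (card A) * Re (mean f)" using d(1) by linarith
  then show ?thesis by (simp add: zero_less_mult_iff)
qed

definition ip :: "('a \<Rightarrow> complex) \<Rightarrow> ('a \<Rightarrow> complex) \<Rightarrow> complex" where
  "ip f g = mean (\<lambda>x. f x * cnj (g x))"

definition l2_norm :: "('a \<Rightarrow> complex) \<Rightarrow> real" where
  "l2_norm f = sqrt (Re (ip f f))"

lemma ip_cnj:
  assumes "f \<in> cont" "g \<in> cont"
  shows "cnj (ip f g) = ip g f"
  using mean_cnj[of "\<lambda>x. f x * cnj (g x)"] assms by (simp add: ip_def cont_mult cont_cnj mult.commute)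

lemma ip_diff_left:
  assumes "f \<in> cont" "g \<in> cont" "h \<in> cont"
  shows "ip (\<lambda>x. f x - g x) h = ip f h - ip g h"
  using mean_diff[of "\<lambda>x. f x * cnj (h x)" "\<lambda>x. g x * cnj (h x)"] assms
  by (simp add: ip_def cont_mult cont_cnj algebra_simps)

lemma ip_add_left:
  assumes "f \<in> cont" "g \<in> cont" "h \<in> cont"
  shows "ip (\<lambda>x. f x + g x) h = ip f h + ip g h"
  using mean_add[of "\<lambda>x. f x * cnj (h x)" "\<lambda>x. g x * cnj (h x)"] assms
  by (simp add: ip_def cont_mult cont_cnj algebra_simps)

lemma ip_cmult_left:
  assumes "f \<in> cont" "h \<in> cont"
  shows "ip (\<lambda>x. c * f x) h = c * ip f h"
  using mean_cmult[of "\<lambda>x. f x * cnj (h x)" c] assms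
  by (simp add: ip_def cont_mult cont_cnj algebra_simps)

lemma ip_add_right:
  assumes "f \<in> cont" "g \<in> cont" "h \<in> cont"
  shows "ip h (\<lambda>x. f x + g x) = ip h f + ip h g"
  unfolding ip_cnj[OF cont_add[OF assms(1,2)] assms(3), symmetric] ip_add_left[OF assms]
  by (simp add: ip_cnj assms)

lemma ip_diff_right:
  assumes "f \<in> cont" "g \<in> cont" "h \<in> cont"
  shows "ip h (\<lambda>x. f x - g x) = ip h f - ip h g"
  unfolding ip_cnj[OF cont_diff[OF assms(1,2)] assms(3), symmetric] ip_diff_left[OF assms]
  by (simp add: ip_cnj assms)

lemma ip_cmult_right:
  assumes "f \<in> cont" "h \<in> cont"
  shows "ip h (\<lambda>x. c * f x) = cnj c * ip h f"
  unfolding ip_cnj[OF cont_mult[OF cont_const assms(1)] assms(2), symmetric] ip_cmult_left[OF assms]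
  by (simp add: ip_cnj assms)

lemma ip_self_nonneg: "f \<in> cont \<Longrightarrow> 0 \<le> Re (ip f f)"
  unfolding ip_def by (intro mean_nonneg cont_mult cont_cnj) (auto simp: complex_mult_cnj)

lemma l2_norm_nonneg: "f \<in> cont \<Longrightarrow> 0 \<le> l2_norm f"
  by (simp add: l2_norm_def ip_self_nonneg)

lemma ip_self:
  assumes "f \<in> cont"
  shows "ip f f = of_real ((l2_norm f)\<^sup>2)"
proof -
  have "Im (ip f f) = 0"
    using ip_cnj[OF assms assms] by (metis complex_cnj_cancel_iff complex_eq_iff cnj.simps(2) neg_equal_zero)
  then show ?thesis
    by (simp add: l2_norm_def ip_self_nonneg assms complex_eq_iff)
qed

lemma l2_norm_eq_0:
  assumes "f \<in> cont" "l2_norm f = 0" "x \<in> carrier Y"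
  shows "f x = 0"
proof (rule ccontr)
  assume "f x \<noteq> 0"
  then have "0 < Re (f x * cnj (f x))"
    by (simp add: complex_mult_cnj complex_eq_iff sum_power2_gt_zero_iff)
  then have "0 < Re (ip f f)"
    unfolding ip_def using assms
    by (intro mean_pos[of _ x] cont_mult cont_cnj) (auto simp: complex_mult_cnj)
  then show False using assms(2) by (simp add: l2_norm_def)
qed

lemma l2_norm_cong: "(\<And>x. x \<in> carrier Y \<Longrightarrow> f x = g x) \<Longrightarrow> l2_norm f = l2_norm g"
  unfolding l2_norm_def ip_def by (subst mean_cong) auto

lemma l2_norm_cmult:
  assumes "f \<in> cont"
  shows "l2_norm (\<lambda>x. c * f x) = norm c * l2_norm f"
proof -
  have "ip (\<lambda>x. c * f x) (\<lambda>x. c * f x) = c * (cnj c * ip f f)"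
    by (simp add: ip_cmult_left ip_cmult_right cont_mult assms)
  also have "\<dots> = of_real ((norm c * l2_norm f)\<^sup>2)"
    unfolding ip_self[OF assms]
    by (simp add: mult.assoc[symmetric] complex_norm_square[symmetric] power_mult_distrib)
  finally show ?thesis
    using l2_norm_nonneg[OF assms] by (subst l2_norm_def) simp
qed

lemma l2_norm_diff_sq:
  assumes "f \<in> cont" "g \<in> cont"
  shows "(l2_norm (\<lambda>x. f x - c * g x))\<^sup>2 =
    (l2_norm f)\<^sup>2 - 2 * Re (cnj c * ip f g) + (norm c)\<^sup>2 * (l2_norm g)\<^sup>2"
proof -
  have cg: "(\<lambda>x. c * g x) \<in> cont" using assms by auto
  have d: "(\<lambda>x. f x - c * g x) \<in> cont" by (intro cont_diff cont_mult cont_const assms)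
  have "of_real ((l2_norm (\<lambda>x. f x - c * g x))\<^sup>2) = ip (\<lambda>x. f x - c * g x) (\<lambda>x. f x - c * g x)"
    using ip_self[OF d] by simp
  also have "\<dots> = ip f (\<lambda>x. f x - c * g x) - c * ip g (\<lambda>x. f x - c * g x)"
    using ip_diff_left[OF assms(1) cg d] ip_cmult_left[OF assms(2) d] by simp
  also have "ip f (\<lambda>x. f x - c * g x) = ip f f - cnj c * ip f g"
    by (simp add: ip_diff_right ip_cmult_right assms cg)
  also have "ip g (\<lambda>x. f x - c * g x) = cnj (ip f g) - cnj c * ip g g"
    by (simp add: ip_diff_right ip_cmult_right assms cg ip_cnj)
  finally have "(l2_norm (\<lambda>x. f x - c * g x))\<^sup>2 =
     Re (ip f f - cnj c * ip f g - c * (cnj (ip f g) - cnj c * ip g g))"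
    by (metis Re_complex_of_real)
  also have "c * cnj c = of_real ((norm c)\<^sup>2)"
    by (simp only: complex_norm_square)
  then have "c * (cnj (ip f g) - cnj c * ip g g) = cnj (cnj c * ip f g) - of_real ((norm c)\<^sup>2 * (l2_norm g)\<^sup>2)"
    by (simp add: algebra_simps ip_self[OF assms(2)])
  finally show ?thesis
    by (simp add: ip_self[OF assms(1)])
qed

text \<open>The usual argument: expand the square norm of \<open>f - c g\<close> for the optimal \<open>c\<close>.\<close>

lemma ip_Cauchy_Schwarz:
  assumes "f \<in> cont" "g \<in> cont"
  shows "norm (ip f g) \<le> l2_norm f * l2_norm g"
proof (cases "l2_norm g = 0")
  case True
  then have "f x * cnj (g x) = 0" if "x \<in> carrier Y" for x
    using l2_norm_eq_0[OF assms(2)] that by simp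
  then have "ip f g = mean (\<lambda>x. 0)"
    unfolding ip_def by (rule mean_cong)
  then show ?thesis using True by (simp add: mean_const)
next
  case False
  define n where "n = (l2_norm g)\<^sup>2"
  have n: "n > 0" using False by (simp add: n_def)
  define c where "c = ip f g / of_real n"
  have "0 \<le> (l2_norm f)\<^sup>2 - 2 * Re (cnj c * ip f g) + (norm c)\<^sup>2 * n"
    using l2_norm_diff_sq[OF assms, of c] by (metis n_def zero_le_power2)
  also have "cnj c * ip f g = of_real ((norm (ip f g))\<^sup>2 / n)"
    using complex_norm_square[of "ip f g"] by (simp add: c_def mult.commute)
  also have "(norm c)\<^sup>2 * n = (norm (ip f g))\<^sup>2 / n"
    using n by (simp add: c_def norm_divide power_divide power2_eq_square)
  finally have "(norm (ip f g))\<^sup>2 \<le> (l2_norm f)\<^sup>2 * n"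
    using n by (simp add: divide_le_eq)
  then have "(norm (ip f g))\<^sup>2 \<le> (l2_norm f * l2_norm g)\<^sup>2"
    by (simp add: n_def power_mult_distrib)
  then show ?thesis
    using l2_norm_nonneg[OF assms(1)] l2_norm_nonneg[OF assms(2)]
    by (meson power2_le_imp_le mult_nonneg_nonneg)
qed

lemma l2_norm_le:
  assumes "f \<in> cont" "0 \<le> B" "\<And>x. x \<in> carrier Y \<Longrightarrow> norm (f x) \<le> B"
  shows "l2_norm f \<le> B"
proof -
  have "Re (ip f f) \<le> norm (ip f f)" by (rule complex_Re_le_cmod)
  also have "\<dots> \<le> B * B"
    unfolding ip_def by (intro mean_norm_le_bound cont_mult cont_cnj)
      (simp_all add: norm_mult mult_mono assms)
  finally show ?thesis
    unfolding l2_norm_def using assms(2) by (intro real_le_lsqrt) (simp_all add: power2_eq_square)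
qed

lemma mean_mult_le:
  assumes "f \<in> cont" "g \<in> cont" "0 \<le> B" "\<And>x. x \<in> carrier Y \<Longrightarrow> norm (f x) \<le> B"
  shows "norm (mean (\<lambda>x. f x * g x)) \<le> B * l2_norm g"
proof -
  let ?f = "\<lambda>x. cnj (f x)"
  have "norm (ip g ?f) \<le> l2_norm g * l2_norm ?f"
    by (intro ip_Cauchy_Schwarz cont_cnj assms)
  moreover have "l2_norm g * l2_norm ?f \<le> l2_norm g * B"
    using assms by (intro mult_left_mono l2_norm_le l2_norm_nonneg cont_cnj) simp_all
  ultimately show ?thesis
    by (simp add: ip_def mult.commute)
qed

section \<open>Convolution operators\<close>

lemma cont_translate_inv_left:
  assumes "k \<in> cont" "a \<in> carrier Y"
  shows "(\<lambda>y. k (inv a \<otimes> y)) \<in> cont"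
  using assms by (intro cont_translate) auto

lemma cont_translate_inv_right:
  assumes "k \<in> cont" "y \<in> carrier Y"
  shows "(\<lambda>x. k (inv x \<otimes> y)) \<in> cont"
proof (rule cont_cong)
  show "(\<lambda>x. k (y \<otimes> inv x)) \<in> cont"
    by (rule cont_inv[OF cont_translate[OF assms]])
qed (use assms in \<open>simp add: m_comm\<close>)

lemma inv_mult_translate:
  assumes "v \<in> carrier Y" "x \<in> carrier Y" "y \<in> carrier Y"
  shows "inv (v \<otimes> x) \<otimes> y = inv v \<otimes> (inv x \<otimes> y)"
  using assms by (simp add: inv_mult m_assoc)

lemma uniform_continuity_inv:
  assumes "f \<in> cont" "e > 0"
  obtains V where "openin T V" "\<one> \<in> V"
    "\<And>v x. v \<in> V \<Longrightarrow> x \<in> carrier Y \<Longrightarrow> norm (f (inv v \<otimes> x) - f x) < e"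
proof -
  obtain V where V: "openin T V" "\<one> \<in> V"
      "\<And>v x. v \<in> V \<Longrightarrow> x \<in> carrier Y \<Longrightarrow> norm (f (v \<otimes> x) - f x) < e"
    using uniform_continuity[OF assms] by blast
  have op: "openin T {v \<in> topspace T. inv v \<in> V}"
    by (rule openin_continuous_map_preimage[OF continuous_inv V(1)])
  show ?thesis
    by (rule that[OF op]) (use V in \<open>auto simp: topspace_eq_carrier\<close>)
qed

lemma open_subset_carrier: "openin T V \<Longrightarrow> V \<subseteq> carrier Y"
  using openin_subset topspace_eq_carrier by blast

lemma normal: "normal_space T"
  using compact Hausdorff compact_Hausdorff_or_regular_imp_normal_space by blast

lemma bump_function:
  assumes V: "openin T V" "\<one> \<in> V"
  obtains b :: "'a \<Rightarrow> real" where "continuous_map T euclideanreal b" "b \<one> = 1"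
    "\<And>x. x \<in> carrier Y \<Longrightarrow> 0 \<le> b x" "\<And>x. x \<in> carrier Y \<Longrightarrow> x \<notin> V \<Longrightarrow> b x = 0"
proof -
  have 1: "closedin T {\<one>}"
    using Hausdorff by (simp add: closedin_Hausdorff_sing_eq topspace_eq_carrier)
  have 2: "closedin T (topspace T - V)"
    using V(1) by (simp add: closedin_def openin_subset Diff_Diff_Int inf.absorb2)
  obtain b :: "'a \<Rightarrow> real" where b: "continuous_map T (top_of_set {0..1}) b" "b ` (topspace T - V) \<subseteq> {0}"
      "b ` {\<one>} \<subseteq> {1}"
    using Urysohn_lemma[OF normal 2 1, of 0 1] V(2) by (auto simp: disjnt_def)
  show ?thesis
  proof (rule that)
    show "continuous_map T euclideanreal b"
      using b(1) continuous_map_in_subtopology by blast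
    show "0 \<le> b x" if "x \<in> carrier Y" for x
    proof -
      have "b x \<in> {0..1}"
        using b(1) that by (auto simp: continuous_map_in_subtopology topspace_eq_carrier)
      then show ?thesis by simp
    qed
    show "b x = 0" if "x \<in> carrier Y" "x \<notin> V" for x
      using that b(2) by (auto simp: topspace_eq_carrier)
  qed (use b(3) in auto)
qed

text \<open>A translation kernel is uniformly close to a finite sum of products of a function of \<open>x\<close>
  and a function of \<open>y\<close>. The functions \<open>e a\<close> form a partition of unity made of translates of one bump
  function: where \<open>e a x\<close> is nonzero, \<open>inv x\<close> and \<open>inv a\<close> differ by an element of \<open>V\<close>.\<close>

lemma kernel_approximation:
  assumes k: "k \<in> cont" and d: "d > 0"
  obtains A e where "finite A" "A \<subseteq> carrier Y" "\<And>a. a \<in> A \<Longrightarrow> e a \<in> cont"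
    "\<And>x y. x \<in> carrier Y \<Longrightarrow> y \<in> carrier Y \<Longrightarrow>
      norm (k (inv x \<otimes> y) - (\<Sum>a\<in>A. e a x * k (inv a \<otimes> y))) \<le> d"
proof -
  obtain V where V: "openin T V" "\<one> \<in> V"
      "\<And>v x. v \<in> V \<Longrightarrow> x \<in> carrier Y \<Longrightarrow> norm (k (v \<otimes> x) - k x) < d"
    using uniform_continuity[OF assms] by blast
  obtain b :: "'a \<Rightarrow> real" where b: "continuous_map T euclideanreal b" "b \<one> = 1"
      "\<And>x. x \<in> carrier Y \<Longrightarrow> 0 \<le> b x" "\<And>x. x \<in> carrier Y \<Longrightarrow> x \<notin> V \<Longrightarrow> b x = 0"
    using bump_function[OF V(1,2)] by blast
  have op: "openin T {x \<in> topspace T. b x \<in> {0<..}}"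
    by (rule openin_continuous_map_preimage[OF b(1)]) auto
  have "\<one> \<in> {x \<in> topspace T. b x \<in> {0<..}}"
    using b(2) by (simp add: topspace_eq_carrier)
  from finite_translates_cover[OF op this]
  obtain A where A: "finite A" "A \<subseteq> carrier Y"
      "\<And>x. x \<in> carrier Y \<Longrightarrow> \<exists>a\<in>A. a \<otimes> x \<in> {x \<in> topspace T. b x \<in> {0<..}}"
    by blast
  define N where "N x = (\<Sum>a\<in>A. b (a \<otimes> inv x))" for x
  have N: "0 < N x" if x: "x \<in> carrier Y" for x
  proof -
    obtain a where a: "a \<in> A" "0 < b (a \<otimes> inv x)" using A(3)[of "inv x"] x by auto
    have "b (a \<otimes> inv x) \<le> N x"
      unfolding N_def using A b(3) x a(1) by (intro member_le_sum) auto
    with a show ?thesis by simp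
  qed
  have Nne: "(\<Sum>a\<in>A. b (a \<otimes> inv x)) \<noteq> 0" if "x \<in> topspace T" for x
    using N[unfolded N_def, of x] that by (simp add: topspace_eq_carrier)
  have ba: "continuous_map T euclideanreal (\<lambda>x. b (a \<otimes> inv x))" if "a \<in> A" for a
    using continuous_map_compose[OF continuous_map_compose[OF continuous_inv continuous_map_translate] b(1), of a]
      that A(2) by (auto simp: o_def)
  define e where "e a x = b (a \<otimes> inv x) / N x" for a x
  have e_cont: "(\<lambda>x. complex_of_real (e a x)) \<in> cont" if "a \<in> A" for a
  proof -
    have "continuous_map T euclideanreal (e a)"
      unfolding e_def N_def
      by (intro continuous_map_real_divide ba that continuous_map_sum A(1))
        (simp_all add: Nne)
    from continuous_map_compose[OF this, of euclidean complex_of_real] show ?thesis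
      by (simp add: cont_def o_def continuous_intros)
  qed
  have e_sum: "(\<Sum>a\<in>A. e a x) = 1" if "x \<in> carrier Y" for x
    using N[OF that] by (simp add: e_def sum_divide_distrib[symmetric] N_def[symmetric])
  show ?thesis
  proof (rule that[OF A(1,2) e_cont])
    fix x y assume xy: "x \<in> carrier Y" "y \<in> carrier Y"
    have term_le: "norm (of_real (e a x) * (k (inv x \<otimes> y) - k (inv a \<otimes> y))) \<le> e a x * d"
      if a: "a \<in> A" for a
    proof -
      have ac: "a \<in> carrier Y" using a A by blast
      have e0: "0 \<le> e a x" using N[OF xy(1)] b(3) ac xy by (simp add: e_def)
      show ?thesis
      proof (cases "a \<otimes> inv x \<in> V")
        case True
        have "norm (k ((a \<otimes> inv x) \<otimes> (inv a \<otimes> y)) - k (inv a \<otimes> y)) < d"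
          using True ac xy by (intro V(3)) auto
        moreover have "(a \<otimes> inv x) \<otimes> (inv a \<otimes> y) = inv x \<otimes> y"
        proof -
          have "(a \<otimes> inv x) \<otimes> (inv a \<otimes> y) = (inv x \<otimes> a) \<otimes> (inv a \<otimes> y)"
            using ac xy by (simp add: m_comm)
          also have "\<dots> = inv x \<otimes> ((a \<otimes> inv a) \<otimes> y)"
            using ac xy by (simp only: m_assoc m_closed inv_closed)
          finally show ?thesis using ac xy by simp
        qed
        ultimately show ?thesis
          using e0 by (simp add: norm_mult mult_left_mono)
      next
        case False
        then have "e a x = 0" using b(4)[of "a \<otimes> inv x"] ac xy by (simp add: e_def)
        then show ?thesis by simp
      qed
    qed
    have "k (inv x \<otimes> y) - (\<Sum>a\<in>A. of_real (e a x) * k (inv a \<otimes> y))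
        = (\<Sum>a\<in>A. of_real (e a x)) * k (inv x \<otimes> y) - (\<Sum>a\<in>A. of_real (e a x) * k (inv a \<otimes> y))"
      using e_sum[OF xy(1)] by (simp flip: of_real_sum)
    also have "\<dots> = (\<Sum>a\<in>A. of_real (e a x) * (k (inv x \<otimes> y) - k (inv a \<otimes> y)))"
      by (simp add: sum_distrib_right sum_subtractf right_diff_distrib)
    also have "norm \<dots> \<le> (\<Sum>a\<in>A. e a x * d)"
      by (intro sum_norm_le term_le)
    also have "\<dots> = d"
      using e_sum[OF xy(1)] by (simp flip: sum_distrib_right)
    finally show "norm (k (inv x \<otimes> y) - (\<Sum>a\<in>A. of_real (e a x) * k (inv a \<otimes> y))) \<le> d" .
  qed
qed

text \<open>Convolution of \<open>g\<close> with the reflection of \<open>k\<close>. In this form it commutes with translations, and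
  it maps a character \<open>f\<close> to \<open>mean (\<lambda>x. k x * f x)\<close> times \<open>f\<close>.\<close>

definition conv :: "('a \<Rightarrow> complex) \<Rightarrow> ('a \<Rightarrow> complex) \<Rightarrow> 'a \<Rightarrow> complex" where
  "conv k g x = mean (\<lambda>y. k (inv x \<otimes> y) * g y)"

lemma conv_diff_le:
  assumes "k \<in> cont" "g \<in> cont" "0 \<le> e" "v \<in> carrier Y" "x \<in> carrier Y"
    and "\<And>z. z \<in> carrier Y \<Longrightarrow> norm (k (inv v \<otimes> z) - k z) \<le> e"
  shows "norm (conv k g (v \<otimes> x) - conv k g x) \<le> e * l2_norm g"
proof -
  let ?f = "\<lambda>y. k (inv (v \<otimes> x) \<otimes> y) - k (inv x \<otimes> y)"
  have c: "(\<lambda>y. k (inv (v \<otimes> x) \<otimes> y)) \<in> cont" "(\<lambda>y. k (inv x \<otimes> y)) \<in> cont"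
    using assms by (intro cont_translate_inv_left; simp)+
  have "conv k g (v \<otimes> x) - conv k g x = mean (\<lambda>y. ?f y * g y)"
    unfolding conv_def left_diff_distrib
    by (rule mean_diff[symmetric]; intro cont_mult c assms)
  also have "norm \<dots> \<le> e * l2_norm g"
    using assms(3-) by (intro mean_mult_le cont_diff c assms(2)) (simp_all add: inv_mult_translate)
  finally show ?thesis .
qed

lemma conv_cont:
  assumes "k \<in> cont" "g \<in> cont"
  shows "conv k g \<in> cont"
proof (rule cont_if_uniform)
  fix e :: real assume e: "e > 0"
  have l: "0 < l2_norm g + 1" using l2_norm_nonneg[OF assms(2)] by simp
  then have "0 < e / (l2_norm g + 1)" using e by simp
  from uniform_continuity_inv[OF assms(1) this] obtain V where V: "openin T V" "\<one> \<in> V"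
      "\<And>v x. v \<in> V \<Longrightarrow> x \<in> carrier Y \<Longrightarrow> norm (k (inv v \<otimes> x) - k x) < e / (l2_norm g + 1)"
    by blast
  have "norm (conv k g (v \<otimes> x) - conv k g x) \<le> e" if "v \<in> V" "x \<in> carrier Y" for v x
  proof -
    have "norm (conv k g (v \<otimes> x) - conv k g x) \<le> e / (l2_norm g + 1) * l2_norm g"
      using V(3) that e l open_subset_carrier[OF V(1)]
      by (intro conv_diff_le assms) (auto intro: less_imp_le)
    also have "\<dots> \<le> e"
      using e l by (simp add: divide_simps)
    finally show ?thesis .
  qed
  with V show "\<exists>V. openin T V \<and> \<one> \<in> V \<and>
      (\<forall>v\<in>V. \<forall>x\<in>carrier Y. norm (conv k g (v \<otimes> x) - conv k g x) \<le> e)"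
    by blast
qed

lemma conv_le:
  assumes "k \<in> cont" "g \<in> cont" "x \<in> carrier Y"
  shows "norm (conv k g x) \<le> sup_norm k * l2_norm g"
  unfolding conv_def
  using assms by (intro mean_mult_le cont_translate_inv_left)
    (simp_all add: norm_le_sup_norm sup_norm_nonneg)

lemma conv_reflect:
  assumes "k \<in> cont" "y \<in> carrier Y"
  shows "conv (\<lambda>z. k (inv z)) h y = mean (\<lambda>x. k (inv x \<otimes> y) * h x)"
  unfolding conv_def using assms
  by (intro mean_cong) (simp add: inv_mult m_comm)

lemma mean_swap_approx:
  assumes k: "k \<in> cont" and g: "g \<in> cont" and h: "h \<in> cont" and d: "d > 0"
  shows "norm (mean (\<lambda>x. conv k g x * h x) - mean (\<lambda>y. conv (\<lambda>z. k (inv z)) h y * g y))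
     \<le> 2 * d * l2_norm g * l2_norm h"
proof -
  obtain A e where A: "finite A" "A \<subseteq> carrier Y" and e: "\<And>a. a \<in> A \<Longrightarrow> e a \<in> cont"
    and approx: "\<And>x y. x \<in> carrier Y \<Longrightarrow> y \<in> carrier Y \<Longrightarrow>
      norm (k (inv x \<otimes> y) - (\<Sum>a\<in>A. e a x * k (inv a \<otimes> y))) \<le> d"
    using kernel_approximation[OF k d] by blast
  have k': "(\<lambda>z. k (inv z)) \<in> cont" using k by (rule cont_inv)
  have kA: "(\<lambda>y. k (inv a \<otimes> y)) \<in> cont" if "a \<in> A" for a
    using that A k by (intro cont_translate_inv_left) auto
  define c where "c a = mean (\<lambda>y. k (inv a \<otimes> y) * g y)" for a
  define c' where "c' a = mean (\<lambda>x. e a x * h x)" for a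
  have "norm (conv k g x - (\<Sum>a\<in>A. e a x * c a)) \<le> d * l2_norm g" if x: "x \<in> carrier Y" for x
  proof -
    have cx: "(\<lambda>y. k (inv x \<otimes> y)) \<in> cont"
      using x k by (intro cont_translate_inv_left)
    have cs: "(\<lambda>y. \<Sum>a\<in>A. e a x * k (inv a \<otimes> y)) \<in> cont"
      by (intro cont_sum cont_mult cont_const kA)
    have "(\<Sum>a\<in>A. e a x * c a) = (\<Sum>a\<in>A. mean (\<lambda>y. e a x * (k (inv a \<otimes> y) * g y)))"
      unfolding c_def by (intro sum.cong refl mean_cmult[symmetric] cont_mult kA g)
    also have "\<dots> = mean (\<lambda>y. \<Sum>a\<in>A. e a x * (k (inv a \<otimes> y) * g y))"
      by (intro mean_sum[symmetric] cont_mult cont_const kA g)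
    also have "\<dots> = mean (\<lambda>y. (\<Sum>a\<in>A. e a x * k (inv a \<otimes> y)) * g y)"
      by (simp add: sum_distrib_right mult.assoc)
    finally have "conv k g x - (\<Sum>a\<in>A. e a x * c a)
        = mean (\<lambda>y. (k (inv x \<otimes> y) - (\<Sum>a\<in>A. e a x * k (inv a \<otimes> y))) * g y)"
      unfolding conv_def left_diff_distrib using mean_diff[OF cont_mult[OF cx g] cont_mult[OF cs g]]
      by simp
    also have "norm \<dots> \<le> d * l2_norm g"
      using d x by (intro mean_mult_le cont_diff cx cs g) (simp_all add: approx)
    finally show ?thesis .
  qed
  then have 1: "norm (mean (\<lambda>x. (conv k g x - (\<Sum>a\<in>A. e a x * c a)) * h x)) \<le> d * l2_norm g * l2_norm h"
    using d l2_norm_nonneg[OF g]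
    by (intro mean_mult_le cont_diff conv_cont cont_sum cont_mult cont_const e k g h) auto
  have "norm (conv (\<lambda>z. k (inv z)) h y - (\<Sum>a\<in>A. k (inv a \<otimes> y) * c' a)) \<le> d * l2_norm h"
    if y: "y \<in> carrier Y" for y
  proof -
    have cx: "(\<lambda>x. k (inv x \<otimes> y)) \<in> cont"
      using y k by (intro cont_translate_inv_right)
    have cs: "(\<lambda>x. \<Sum>a\<in>A. e a x * k (inv a \<otimes> y)) \<in> cont"
      by (intro cont_sum cont_mult cont_const e)
    have "(\<Sum>a\<in>A. k (inv a \<otimes> y) * c' a) = (\<Sum>a\<in>A. mean (\<lambda>x. k (inv a \<otimes> y) * (e a x * h x)))"
      unfolding c'_def by (intro sum.cong refl mean_cmult[symmetric] cont_mult e h)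
    also have "\<dots> = mean (\<lambda>x. \<Sum>a\<in>A. k (inv a \<otimes> y) * (e a x * h x))"
      by (intro mean_sum[symmetric] cont_mult cont_const e h)
    also have "\<dots> = mean (\<lambda>x. (\<Sum>a\<in>A. e a x * k (inv a \<otimes> y)) * h x)"
      by (simp add: sum_distrib_left mult_ac)
    finally have "conv (\<lambda>z. k (inv z)) h y - (\<Sum>a\<in>A. k (inv a \<otimes> y) * c' a)
        = mean (\<lambda>x. (k (inv x \<otimes> y) - (\<Sum>a\<in>A. e a x * k (inv a \<otimes> y))) * h x)"
      unfolding conv_reflect[OF k y] left_diff_distrib
      using mean_diff[OF cont_mult[OF cx h] cont_mult[OF cs h]] by simp
    also have "norm \<dots> \<le> d * l2_norm h"
      using d y by (intro mean_mult_le cont_diff cx cs h) (simp_all add: approx)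
    finally show ?thesis .
  qed
  then have 2: "norm (mean (\<lambda>y. (conv (\<lambda>z. k (inv z)) h y - (\<Sum>a\<in>A. k (inv a \<otimes> y) * c' a)) * g y))
      \<le> d * l2_norm h * l2_norm g"
    using d l2_norm_nonneg[OF h]
    by (intro mean_mult_le cont_diff conv_cont cont_sum cont_mult cont_const kA k' g h) auto
  have sl: "(\<lambda>x. (\<Sum>a\<in>A. e a x * c a) * h x) \<in> cont"
    by (intro cont_sum cont_mult cont_const e h)
  have sr: "(\<lambda>y. (\<Sum>a\<in>A. k (inv a \<otimes> y) * c' a) * g y) \<in> cont"
    by (intro cont_sum cont_mult cont_const kA g)
  have "mean (\<lambda>x. (\<Sum>a\<in>A. e a x * c a) * h x) = (\<Sum>a\<in>A. mean (\<lambda>x. c a * (e a x * h x)))"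
    using mean_sum[of A "\<lambda>a x. c a * (e a x * h x)"] e h
    by (simp add: sum_distrib_left mult_ac cont_mult)
  also have "\<dots> = (\<Sum>a\<in>A. c a * c' a)"
    unfolding c'_def by (intro sum.cong refl mean_cmult cont_mult e h)
  also have "\<dots> = (\<Sum>a\<in>A. mean (\<lambda>y. c' a * (k (inv a \<otimes> y) * g y)))"
    unfolding c_def mult.commute[of _ "c' _"] by (intro sum.cong refl mean_cmult[symmetric] cont_mult kA g)
  also have "\<dots> = mean (\<lambda>y. (\<Sum>a\<in>A. k (inv a \<otimes> y) * c' a) * g y)"
    using mean_sum[of A "\<lambda>a y. c' a * (k (inv a \<otimes> y) * g y)"] kA g
    by (simp add: sum_distrib_left mult_ac cont_mult)
  finally have eq: "mean (\<lambda>x. (\<Sum>a\<in>A. e a x * c a) * h x) =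
      mean (\<lambda>y. (\<Sum>a\<in>A. k (inv a \<otimes> y) * c' a) * g y)" .
  have 3: "norm (mean (\<lambda>x. conv k g x * h x) - mean (\<lambda>x. (\<Sum>a\<in>A. e a x * c a) * h x))
      \<le> d * l2_norm g * l2_norm h"
    using 1 mean_diff[OF cont_mult[OF conv_cont[OF k g] h] sl] by (simp add: left_diff_distrib)
  have 4: "norm (mean (\<lambda>y. conv (\<lambda>z. k (inv z)) h y * g y) - mean (\<lambda>y. (\<Sum>a\<in>A. k (inv a \<otimes> y) * c' a) * g y))
      \<le> d * l2_norm h * l2_norm g"
    using 2 mean_diff[OF cont_mult[OF conv_cont[OF k' h] g] sr] by (simp add: left_diff_distrib)
  show ?thesis
    using 3 4 norm_triangle_ineq4[of "mean (\<lambda>x. conv k g x * h x) - mean (\<lambda>x. (\<Sum>a\<in>A. e a x * c a) * h x)"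
        "mean (\<lambda>y. conv (\<lambda>z. k (inv z)) h y * g y) - mean (\<lambda>y. (\<Sum>a\<in>A. k (inv a \<otimes> y) * c' a) * g y)"]
    unfolding eq by (simp add: mult_ac)
qed

text \<open>Fubini's theorem for translation kernels. Both iterated means agree exactly for
  sums of products, hence in the limit.\<close>

lemma mean_swap:
  assumes "k \<in> cont" "g \<in> cont" "h \<in> cont"
  shows "mean (\<lambda>x. conv k g x * h x) = mean (\<lambda>y. conv (\<lambda>z. k (inv z)) h y * g y)"
proof -
  let ?D = "norm (mean (\<lambda>x. conv k g x * h x) - mean (\<lambda>y. conv (\<lambda>z. k (inv z)) h y * g y))"
  define C where "C = 2 * l2_norm g * l2_norm h + 1"
  have C: "C > 0"
    using l2_norm_nonneg[OF assms(2)] l2_norm_nonneg[OF assms(3)] by (simp add: C_def add_nonneg_pos)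
  have "?D \<le> 0 + e" if e: "e > 0" for e
  proof -
    have "?D \<le> 2 * (e / C) * l2_norm g * l2_norm h"
      using e C by (intro mean_swap_approx assms) simp
    also have "\<dots> = (e / C) * (C - 1)" by (simp add: C_def)
    also have "\<dots> \<le> e" using e C by (simp add: divide_simps)
    finally show ?thesis by simp
  qed
  then have "?D \<le> 0" by (rule field_le_epsilon)
  then show ?thesis by simp
qed

lemma conv_self_adjoint:
  assumes "k \<in> cont" "g \<in> cont" "h \<in> cont"
    and herm: "\<And>z. z \<in> carrier Y \<Longrightarrow> k (inv z) = cnj (k z)"
  shows "ip (conv k g) h = ip g (conv k h)"
proof -
  have "conv (\<lambda>z. k (inv z)) (\<lambda>x. cnj (h x)) y = cnj (conv k h y)" if y: "y \<in> carrier Y" for y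
  proof -
    have "conv (\<lambda>z. k (inv z)) (\<lambda>x. cnj (h x)) y = mean (\<lambda>x. cnj (k (inv y \<otimes> x) * h x))"
      unfolding conv_def using y herm by (intro mean_cong) simp
    also have "\<dots> = cnj (conv k h y)"
      unfolding conv_def using y assms by (intro mean_cnj cont_mult cont_translate_inv_left)
    finally show ?thesis .
  qed
  then have "mean (\<lambda>y. conv (\<lambda>z. k (inv z)) (\<lambda>x. cnj (h x)) y * g y) = ip g (conv k h)"
    unfolding ip_def by (intro mean_cong) (simp add: mult.commute)
  then show ?thesis
    using mean_swap[OF assms(1,2) cont_cnj[OF assms(3)]] by (simp add: ip_def)
qed

end

section \<open>Equicontinuous families and the spectral lemma\<close>

lemma closure_pointwise_approx:
  fixes h :: "'i \<Rightarrow> complex"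
  assumes "h \<in> closure S" "finite A" "e > 0"
  obtains f where "f \<in> S" "\<And>a. a \<in> A \<Longrightarrow> norm (f a - h a) < e"
proof -
  let ?U = "{f :: 'i \<Rightarrow> complex. \<forall>a\<in>A. norm (f a - h a) < e}"
  have "?U = (\<Inter>a\<in>A. {f. norm (f a - h a) < e})" by auto
  moreover have "open {f :: 'i \<Rightarrow> complex. norm (f a - h a) < e}" for a
    by (intro open_Collect_less continuous_intros continuous_on_product_coordinates)
  ultimately have "open ?U"
    using assms(2) by (simp add: open_INT)
  moreover have "h \<in> ?U" using assms(3) by simp
  ultimately have "?U \<inter> S \<noteq> {}"
    using assms(1) by (meson closure_iff_nhds_not_empty inf_commute disjoint_iff equalityD1)
  then show ?thesis using that by blast
qed

context compact_abelian_group
begin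

text \<open>Continuity is measured by the displacement \<open>v\<close> in the group: a modulus becomes small near the
  identity.\<close>

definition modulus :: "('a \<Rightarrow> real) \<Rightarrow> bool" where
  "modulus w \<longleftrightarrow> (\<forall>v\<in>carrier Y. 0 \<le> w v) \<and>
     (\<forall>e>0. \<exists>V. openin T V \<and> \<one> \<in> V \<and> (\<forall>v\<in>V. w v \<le> e))"

definition equi :: "('a \<Rightarrow> real) \<Rightarrow> ('a \<Rightarrow> complex) set" where
  "equi w = {f. \<forall>v\<in>carrier Y. \<forall>x\<in>carrier Y. norm (f (v \<otimes> x) - f x) \<le> w v}"

lemma modulus_cmult:
  assumes "modulus w" "0 \<le> c"
  shows "modulus (\<lambda>v. c * w v)"
  unfolding modulus_def
proof (intro conjI ballI allI impI)
  fix e :: real assume "e > 0"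
  then have "e / (c + 1) > 0" using assms(2) by simp
  then obtain V where V: "openin T V" "\<one> \<in> V" "\<And>v. v \<in> V \<Longrightarrow> w v \<le> e / (c + 1)"
    using assms(1) unfolding modulus_def by blast
  have "c * w v \<le> e" if "v \<in> V" for v
  proof -
    have "c * w v \<le> c * (e / (c + 1))" using V(3)[OF that] assms(2) by (rule mult_left_mono)
    also have "\<dots> \<le> e" using assms(2) \<open>e > 0\<close> by (simp add: divide_simps)
    finally show ?thesis .
  qed
  with V show "\<exists>V. openin T V \<and> \<one> \<in> V \<and> (\<forall>v\<in>V. c * w v \<le> e)" by blast
qed (use assms in \<open>auto simp: modulus_def\<close>)

text \<open>On a family with a common modulus, pointwise closeness on one finite set implies
  uniform closeness. This turns Tychonoff compactness into the Arzela-Ascoli theorem.\<close>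

lemma equi_finite_net:
  assumes "modulus w" "e > 0"
  obtains A where "finite A" "A \<subseteq> carrier Y"
    "\<And>f g x. f \<in> equi w \<Longrightarrow> g \<in> equi w \<Longrightarrow> (\<And>a. a \<in> A \<Longrightarrow> norm (f a - g a) \<le> e) \<Longrightarrow>
       x \<in> carrier Y \<Longrightarrow> norm (f x - g x) \<le> 3 * e"
proof -
  obtain V where V: "openin T V" "\<one> \<in> V" "\<And>v. v \<in> V \<Longrightarrow> w v \<le> e"
    using assms unfolding modulus_def by blast
  obtain A where A: "finite A" "A \<subseteq> carrier Y" "\<And>x. x \<in> carrier Y \<Longrightarrow> \<exists>a\<in>A. a \<otimes> x \<in> V"
    using finite_translates_cover[OF V(1,2)] by blast
  show ?thesis
  proof (rule that)
    show "finite ((\<lambda>a. inv a) ` A)" "(\<lambda>a. inv a) ` A \<subseteq> carrier Y" using A by auto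
    fix f g x assume f: "f \<in> equi w" and g: "g \<in> equi w" and x: "x \<in> carrier Y"
      and le: "\<And>a. a \<in> (\<lambda>a. inv a) ` A \<Longrightarrow> norm (f a - g a) \<le> e"
    obtain a where a: "a \<in> A" "a \<otimes> x \<in> V" using A(3)[OF x] by blast
    have ac: "a \<in> carrier Y" using a A by blast
    have eq: "(a \<otimes> x) \<otimes> inv a = x"
      using ac x by (simp add: m_comm[of a x] m_assoc)
    have "norm (q x - q (inv a)) \<le> e" if "q \<in> equi w" for q
    proof -
      have "norm (q ((a \<otimes> x) \<otimes> inv a) - q (inv a)) \<le> w (a \<otimes> x)"
        using that ac x unfolding equi_def by blast
      then show ?thesis using V(3)[OF a(2)] unfolding eq by linarith
    qed
    from this[OF f] this[OF g] le[of "inv a"] a(1)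
    show "norm (f x - g x) \<le> 3 * e"
      using norm_triangle_ineq4[of "f x - f (inv a)" "g x - g (inv a)"]
        norm_triangle_ineq[of "(f x - f (inv a)) - (g x - g (inv a))" "f (inv a) - g (inv a)"]
      by auto
  qed
qed

definition equi_ball :: "('a \<Rightarrow> real) \<Rightarrow> real \<Rightarrow> ('a \<Rightarrow> complex) set" where
  "equi_ball w B = {f. \<forall>x. f x \<in> (if x \<in> carrier Y then cball 0 B else {0})} \<inter> equi w"

lemma compact_equi_ball: "compact (equi_ball w B)"
  unfolding equi_ball_def
proof (intro compact_Int_closed compact_pointwise_Collect)
  show "closed (equi w)"
    unfolding equi_def Ball_def
    by (intro closed_pointwise_intros continuous_intros)
qed auto

lemma closed_equi_ball: "closed (equi_ball w B)"
proof -
  have "closed {f :: 'a \<Rightarrow> complex. f x \<in> (if x \<in> carrier Y then cball 0 B else {0})}" for x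
    by (cases "x \<in> carrier Y")
      (simp_all add: closed_Collect_le closed_Collect_eq continuous_intros)
  then show ?thesis
    unfolding equi_ball_def equi_def Ball_def
    by (intro closed_Int closed_pointwise_intros continuous_intros)
qed

lemma equi_closure_uniform:
  assumes w: "modulus w" and S: "S \<subseteq> equi w" and h: "h \<in> closure S" "h \<in> equi w" and e: "e > 0"
  obtains f where "f \<in> S" "\<And>x. x \<in> carrier Y \<Longrightarrow> norm (f x - h x) \<le> e"
proof -
  have "e / 3 > 0" using e by simp
  from equi_finite_net[OF w this] obtain A where A: "finite A"
    "\<And>f g x. f \<in> equi w \<Longrightarrow> g \<in> equi w \<Longrightarrow> (\<And>a. a \<in> A \<Longrightarrow> norm (f a - g a) \<le> e / 3) \<Longrightarrow>
       x \<in> carrier Y \<Longrightarrow> norm (f x - g x) \<le> 3 * (e / 3)"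
    by metis
  obtain f where f: "f \<in> S" "\<And>a. a \<in> A \<Longrightarrow> norm (f a - h a) < e / 3"
    using closure_pointwise_approx[OF h(1) A(1) \<open>e / 3 > 0\<close>] by blast
  show ?thesis
  proof (rule that[OF f(1)])
    fix x assume "x \<in> carrier Y"
    then have "norm (f x - h x) \<le> 3 * (e / 3)"
      using f S h(2) by (intro A(2)) (auto intro: less_imp_le)
    then show "norm (f x - h x) \<le> e" by simp
  qed
qed

text \<open>The pointwise topology on functions on an arbitrary set need not be sequential, so the
  conclusion is phrased as a uniform cluster point and not as a convergent subsequence.\<close>

lemma equi_ball_cluster_point:
  assumes w: "modulus w" and f: "\<And>n::nat. f n \<in> equi_ball w B"
  obtains h where "h \<in> equi_ball w B"
    "\<And>e N. e > 0 \<Longrightarrow> \<exists>n\<ge>N. \<forall>x\<in>carrier Y. norm (f n x - h x) \<le> e"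
proof -
  define C where "C N = closure (f ` {N..})" for N :: nat
  have "equi_ball w B \<inter> (\<Inter>N\<in>UNIV. C N) \<noteq> {}"
  proof (rule compact_imp_fip_image[OF compact_equi_ball])
    fix I :: "nat set" assume "finite I"
    then obtain n where n: "\<And>j. j \<in> I \<Longrightarrow> j \<le> n"
      unfolding finite_nat_set_iff_bounded_le by auto
    then have "f n \<in> C j" if "j \<in> I" for j
      unfolding C_def using that closure_subset by (meson atLeast_iff imageI subsetD)
    then show "equi_ball w B \<inter> (\<Inter>N\<in>I. C N) \<noteq> {}"
      using f[of n] by blast
  qed (simp add: C_def)
  then obtain h where h: "h \<in> equi_ball w B" "\<And>N. h \<in> C N" by auto
  show ?thesis
  proof (rule that[OF h(1)])
    fix e :: real and N :: nat assume "e > 0"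
    moreover have "f ` {N..} \<subseteq> equi w" "h \<in> equi w"
      using f h(1) by (auto simp: equi_ball_def)
    ultimately obtain q where "q \<in> f ` {N..}" "\<And>x. x \<in> carrier Y \<Longrightarrow> norm (q x - h x) \<le> e"
      using equi_closure_uniform[OF w _ h(2)[of N, unfolded C_def]] by metis
    then show "\<exists>n\<ge>N. \<forall>x\<in>carrier Y. norm (f n x - h x) \<le> e" by auto
  qed
qed

text \<open>Closed under uniform convergence on the carrier; in particular membership does not depend
  on values off the carrier.\<close>

definition closed_subspace :: "('a \<Rightarrow> complex) set \<Rightarrow> bool" where
  "closed_subspace F \<longleftrightarrow> F \<subseteq> cont \<and>
     (\<forall>f\<in>F. \<forall>g\<in>F. (\<lambda>x. f x + g x) \<in> F) \<and> (\<forall>c. \<forall>f\<in>F. (\<lambda>x. c * f x) \<in> F) \<and>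
     (\<forall>h. (\<forall>e>0. \<exists>f\<in>F. \<forall>x\<in>carrier Y. norm (f x - h x) \<le> e) \<longrightarrow> h \<in> F)"

lemma closed_subspaceD:
  assumes "closed_subspace F"
  shows "f \<in> F \<Longrightarrow> f \<in> cont"
    and "f \<in> F \<Longrightarrow> g \<in> F \<Longrightarrow> (\<lambda>x. f x + g x) \<in> F"
    and "f \<in> F \<Longrightarrow> (\<lambda>x. c * f x) \<in> F"
    and "(\<And>e. e > 0 \<Longrightarrow> \<exists>f\<in>F. \<forall>x\<in>carrier Y. norm (f x - h x) \<le> e) \<Longrightarrow> h \<in> F"
  using assms by (auto simp: closed_subspace_def)

lemma closed_subspace_diff:
  assumes "closed_subspace F" "f \<in> F" "g \<in> F"
  shows "(\<lambda>x. f x - c * g x) \<in> F"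
  using closed_subspaceD(2)[OF assms(1,2) closed_subspaceD(3)[OF assms(1,3), of "- c"]] by simp

lemma closed_subspace_cong:
  assumes "closed_subspace F" "f \<in> F" "\<And>x. x \<in> carrier Y \<Longrightarrow> f x = g x"
  shows "g \<in> F"
  using assms by (intro closed_subspaceD(4)[OF assms(1)]) (auto intro!: bexI[of _ f])

definition linear_on :: "('a \<Rightarrow> complex) set \<Rightarrow> (('a \<Rightarrow> complex) \<Rightarrow> 'a \<Rightarrow> complex) \<Rightarrow> bool" where
  "linear_on F U \<longleftrightarrow> (\<forall>f\<in>F. U f \<in> F) \<and>
     (\<forall>f\<in>F. \<forall>g\<in>F. \<forall>c. \<forall>x\<in>carrier Y. U (\<lambda>x. f x - c * g x) x = U f x - c * U g x)"

text \<open>Let \<open>l\<close> be the supremum of \<open>(l2_norm (U g))\<^sup>2\<close> over the unit ball and let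
  \<open>g n\<close> approach it. Then \<open>U (U (g n)) - l g n\<close> tends to 0 in the \<open>l2_norm\<close>, while \<open>U (g n)\<close>
  has a uniform cluster point \<open>h\<close>; applying \<open>U\<close> gives \<open>U (U h) = l h\<close>. Working with the square of
  the operator avoids a case distinction on the sign of an eigenvalue. The limits are uniform, so they
  stay within \<open>F\<close>.\<close>

lemma spectral_lemma:
  assumes F: "closed_subspace F" and U: "linear_on F U"
    and adj: "\<And>f g. f \<in> F \<Longrightarrow> g \<in> F \<Longrightarrow> ip (U f) g = ip f (U g)"
    and w: "modulus w" and C: "0 \<le> C"
    and U_equi: "\<And>f v x. f \<in> F \<Longrightarrow> v \<in> carrier Y \<Longrightarrow> x \<in> carrier Y \<Longrightarrow>
        norm (U f (v \<otimes> x) - U f x) \<le> w v * l2_norm f"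
    and U_le: "\<And>f x. f \<in> F \<Longrightarrow> x \<in> carrier Y \<Longrightarrow> norm (U f x) \<le> C * l2_norm f"
    and g0: "g0 \<in> F" "x0 \<in> carrier Y" "U g0 x0 \<noteq> 0"
  shows "\<exists>h\<in>F. \<exists>c>0. (\<exists>x\<in>carrier Y. h x \<noteq> 0) \<and>
           (\<forall>x\<in>carrier Y. U (U h) x = complex_of_real c * h x)"
proof -
  have Fc: "f \<in> cont" if "f \<in> F" for f using closed_subspaceD(1)[OF F that] .
  have UF: "U f \<in> F" if "f \<in> F" for f using U that by (simp add: linear_on_def)
  have U_diff: "U (\<lambda>x. f x - c * g x) x = U f x - c * U g x"
    if "f \<in> F" "g \<in> F" "x \<in> carrier Y" for f g c x
    using U that by (simp add: linear_on_def)
  have F_diff: "(\<lambda>x. f x - c * g x) \<in> F" if "f \<in> F" "g \<in> F" for f g c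
    using closed_subspace_diff[OF F that] .
  have U_l2: "l2_norm (U f) \<le> C * l2_norm f" if "f \<in> F" for f
    using C U_le[OF that] l2_norm_nonneg[OF Fc[OF that]] Fc[OF UF[OF that]] by (intro l2_norm_le) auto
  have U_scale: "U (\<lambda>x. c * f x) x = c * U f x" if f: "f \<in> F" and x: "x \<in> carrier Y" for f c x
  proof -
    have "U (\<lambda>x. f x - (1 - c) * f x) x = U f x - (1 - c) * U f x"
      by (rule U_diff[OF f f x])
    then show ?thesis by (simp add: algebra_simps)
  qed
  define S where "S = {(l2_norm (U g))\<^sup>2 |g. g \<in> F \<and> l2_norm g \<le> 1}"
  define l where "l = Sup S"
  have S_bdd: "bdd_above S"
  proof (rule bdd_aboveI)
    fix s assume "s \<in> S"
    then obtain g where g: "g \<in> F" "l2_norm g \<le> 1" "s = (l2_norm (U g))\<^sup>2" by (auto simp: S_def)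
    have "l2_norm (U g) \<le> C"
      using U_l2[OF g(1)] mult_left_le[OF g(2) C] by linarith
    then show "s \<le> C\<^sup>2" using g Fc UF by (simp add: l2_norm_nonneg power_mono)
  qed
  have scaled: "(l2_norm (U g))\<^sup>2 / (l2_norm g)\<^sup>2 \<in> S" if g: "g \<in> F" "l2_norm g > 0" for g
  proof -
    let ?c = "complex_of_real (1 / l2_norm g)"
    have gF: "(\<lambda>x. ?c * g x) \<in> F" using closed_subspaceD(3)[OF F g(1)] .
    have "l2_norm (\<lambda>x. ?c * g x) \<le> 1"
      unfolding l2_norm_cmult[OF Fc[OF g(1)]] using g(2) by (simp add: norm_divide)
    moreover have "l2_norm (U (\<lambda>x. ?c * g x)) = l2_norm (\<lambda>x. ?c * U g x)"
      by (rule l2_norm_cong) (rule U_scale[OF g(1)])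
    then have "(l2_norm (U (\<lambda>x. ?c * g x)))\<^sup>2 = (l2_norm (U g))\<^sup>2 / (l2_norm g)\<^sup>2"
      unfolding l2_norm_cmult[OF Fc[OF UF[OF g(1)]]] using g(2)
      by (simp add: norm_divide power_divide)
    ultimately show ?thesis using gF unfolding S_def by force
  qed
  have l2_pos: "l2_norm g > 0" if "g \<in> F" "U g x \<noteq> 0" "x \<in> carrier Y" for g x
    using U_le[OF that(1,3)] that(2) l2_norm_nonneg[OF Fc[OF that(1)]]
    by (cases "l2_norm g = 0") auto
  have g0_pos: "l2_norm g0 > 0" using l2_pos g0 by blast
  have "l2_norm (U g0) \<noteq> 0"
    using l2_norm_eq_0[OF Fc[OF UF[OF g0(1)]] _ g0(2)] g0(3) by blast
  then have "0 < (l2_norm (U g0))\<^sup>2 / (l2_norm g0)\<^sup>2" using g0_pos by simp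
  also have "\<dots> \<le> l"
    unfolding l_def by (rule cSup_upper[OF scaled[OF g0(1) g0_pos] S_bdd])
  finally have l: "0 < l" .
  have l_le: "(l2_norm (U g))\<^sup>2 \<le> l * (l2_norm g)\<^sup>2" if g: "g \<in> F" for g
  proof (cases "l2_norm g = 0")
    case True
    then have "l2_norm (U g) \<le> 0" using U_l2[OF g] by simp
    then show ?thesis using True l2_norm_nonneg[OF Fc[OF UF[OF g]]] by simp
  next
    case False
    then have p: "l2_norm g > 0" using l2_norm_nonneg[OF Fc[OF g]] by simp
    have "(l2_norm (U g))\<^sup>2 / (l2_norm g)\<^sup>2 \<le> l"
      unfolding l_def by (rule cSup_upper[OF scaled[OF g p] S_bdd])
    then show ?thesis using p by (simp add: divide_le_eq)
  qed
  have "\<exists>g. g \<in> F \<and> l2_norm g \<le> 1 \<and> l - 1 / Suc n < (l2_norm (U g))\<^sup>2" for n :: nat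
  proof -
    have "l - 1 / Suc n < Sup S" by (simp add: l_def)
    moreover have "S \<noteq> {}" using scaled[OF g0(1) g0_pos] by blast
    ultimately obtain s where "s \<in> S" "l - 1 / Suc n < s"
      using less_cSup_iff[OF _ S_bdd] by blast
    then show ?thesis by (auto simp: S_def)
  qed
  then obtain g where g: "\<And>n. g n \<in> F" "\<And>n. l2_norm (g n) \<le> 1"
      "\<And>n::nat. l - 1 / Suc n < (l2_norm (U (g n)))\<^sup>2"
    by metis
  \<comment> \<open>Compactness holds for functions that vanish off the carrier.\<close>
  define f where "f n = (\<lambda>x. if x \<in> carrier Y then U (g n) x else 0)" for n
  have f_eq: "f n x = U (g n) x" if "x \<in> carrier Y" for n x using that by (simp add: f_def)
  have fF: "f n \<in> F" for n
    using closed_subspace_cong[OF F UF[OF g(1)]] f_eq by metis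
  have f_ball: "f n \<in> equi_ball w C" for n
  proof -
    have "norm (U (g n) x) \<le> C" if "x \<in> carrier Y" for x
      using U_le[OF g(1) that, of n] mult_left_le[OF g(2) C, of n] by linarith
    moreover have "norm (U (g n) (v \<otimes> x) - U (g n) x) \<le> w v"
      if "v \<in> carrier Y" "x \<in> carrier Y" for v x
    proof -
      have "0 \<le> w v" using w that(1) by (simp add: modulus_def)
      then show ?thesis
        using U_equi[OF g(1) that, of n] mult_left_le[OF g(2), of "w v" n] by linarith
    qed
    ultimately show ?thesis by (auto simp: equi_ball_def equi_def f_def)
  qed
  obtain h where "h \<in> equi_ball w C" and
    h: "\<And>e N. e > 0 \<Longrightarrow> \<exists>n\<ge>N. \<forall>x\<in>carrier Y. norm (f n x - h x) \<le> e"
    by (rule equi_ball_cluster_point[of w f C, OF w f_ball]) auto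
  have hF: "h \<in> F"
    by (rule closed_subspaceD(4)[OF F]) (use h fF in blast)
  have "\<exists>x\<in>carrier Y. h x \<noteq> 0"
  proof (rule ccontr)
    assume "\<not> (\<exists>x\<in>carrier Y. h x \<noteq> 0)"
    then have h0: "h x = 0" if "x \<in> carrier Y" for x using that by blast
    obtain N :: nat where N: "1 / Suc N < l / 2"
      using l nat_approx_posE[of "l / 2"] by auto
    have "sqrt (l / 4) > 0" using l by simp
    then obtain n where n: "n \<ge> N" "\<And>x. x \<in> carrier Y \<Longrightarrow> norm (f n x - h x) \<le> sqrt (l / 4)"
      using h by blast
    have "norm (U (g n) x) \<le> sqrt (l / 4)" if "x \<in> carrier Y" for x
      using n(2)[OF that] h0[OF that] f_eq[OF that] by simp
    then have "l2_norm (U (g n)) \<le> sqrt (l / 4)"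
      using l by (intro l2_norm_le Fc UF g) auto
    then have "(l2_norm (U (g n)))\<^sup>2 \<le> (sqrt (l / 4))\<^sup>2"
      by (intro power_mono l2_norm_nonneg Fc UF g)
    then have "(l2_norm (U (g n)))\<^sup>2 \<le> l / 4" using l by simp
    moreover have "1 / Suc n \<le> 1 / Suc N" using n(1) by (intro divide_left_mono) auto
    ultimately show False using g(3)[of n] N l by linarith
  qed
  moreover have "U (U h) x = complex_of_real l * h x" if x: "x \<in> carrier Y" for x
  proof -
    have "norm (U (U h) x - of_real l * h x) \<le> 0 + d" if d: "d > 0" for d
    proof -
      \<comment> \<open>The three summands bound the errors from replacing \<open>h\<close> by \<open>U (g n)\<close> under \<open>U\<^sup>2\<close>, from the
  approximate eigenvector equation, and from replacing \<open>U (g n)\<close> by \<open>h\<close> on the right-hand side.\<close>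
      define e where "e = d / (C * C + C + l)"
      have K: "0 < C * C + C + l" using C l by (simp add: add_nonneg_pos)
      have e: "e > 0" using d K by (simp add: e_def)
      have "e\<^sup>2 / l > 0" using e l by simp
      then obtain N :: nat where N: "1 / Suc N < e\<^sup>2 / l" using nat_approx_posE by blast
      obtain n where n: "n \<ge> N" "\<And>x. x \<in> carrier Y \<Longrightarrow> norm (f n x - h x) \<le> e"
        using h[OF e] by blast
      have Ug: "U (g n) \<in> F" and UUg: "U (U (g n)) \<in> F" using UF g by auto
      define D where "D = (\<lambda>x. U (U (g n)) x - of_real l * g n x)"
      have DF: "D \<in> F" unfolding D_def by (rule F_diff[OF UUg g(1)])
      have "(l2_norm D)\<^sup>2 = (l2_norm (U (U (g n))))\<^sup>2 - 2 * Re (cnj (of_real l) * ip (U (U (g n))) (g n))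
          + (norm (complex_of_real l))\<^sup>2 * (l2_norm (g n))\<^sup>2"
        unfolding D_def by (rule l2_norm_diff_sq[OF Fc[OF UUg] Fc[OF g(1)]])
      also have "ip (U (U (g n))) (g n) = of_real ((l2_norm (U (g n)))\<^sup>2)"
        using adj[OF Ug g(1)] ip_self[OF Fc[OF Ug]] by simp
      finally have "(l2_norm D)\<^sup>2 = (l2_norm (U (U (g n))))\<^sup>2 - 2 * l * (l2_norm (U (g n)))\<^sup>2
          + l\<^sup>2 * (l2_norm (g n))\<^sup>2"
        by simp
      moreover have "(l2_norm (g n))\<^sup>2 \<le> 1"
        using g(2)[of n] l2_norm_nonneg[OF Fc[OF g(1)], of n] by (simp add: power_le_one)
      then have "l\<^sup>2 * (l2_norm (g n))\<^sup>2 \<le> l\<^sup>2" by (simp add: mult_left_le)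
      ultimately have "(l2_norm D)\<^sup>2 \<le> l * (l - (l2_norm (U (g n)))\<^sup>2)"
        using l_le[OF Ug] by (simp add: algebra_simps power2_eq_square)
      also have "\<dots> \<le> l * (1 / Suc n)"
        using g(3)[of n] l by (intro mult_left_mono) auto
      also have "\<dots> \<le> l * (1 / Suc N)"
        using n(1) l by (intro mult_left_mono divide_left_mono) auto
      also have "\<dots> \<le> l * (e\<^sup>2 / l)" using N l by (intro mult_left_mono) auto
      also have "\<dots> = e\<^sup>2" using l by simp
      finally have "l2_norm D \<le> e" using e by (meson power2_le_imp_le less_imp_le)
      then have 1: "norm (U D x) \<le> C * e"
        using U_le[OF DF x] C by (meson mult_left_mono order_trans)
      define G where "G = (\<lambda>x. h x - 1 * U (g n) x)"
      have GF: "G \<in> F" unfolding G_def by (rule F_diff[OF hF Ug])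
      have "norm (G x) \<le> e" if "x \<in> carrier Y" for x
        using n(2)[OF that] f_eq[OF that] by (simp add: G_def norm_minus_commute)
      then have G_l2: "l2_norm G \<le> e" using e by (intro l2_norm_le Fc GF) auto
      have "norm (U (U G) x) \<le> C * l2_norm (U G)" by (rule U_le[OF UF[OF GF] x])
      also have "\<dots> \<le> C * (C * e)"
        using U_l2[OF GF] G_l2 C by (meson mult_left_mono order_trans)
      finally have 2: "norm (U (U G) x) \<le> C * (C * e)" .
      have UG: "U G z = U h z - U (U (g n)) z" if "z \<in> carrier Y" for z
        using U_diff[OF hF Ug that, of 1] by (simp add: G_def)
      have "U (U G) x = U (\<lambda>z. U h z - 1 * U (U (g n)) z) x"
      proof -
        let ?P = "\<lambda>z. U h z - 1 * U (U (g n)) z"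
        have PF: "?P \<in> F" by (rule F_diff[OF UF[OF hF] UUg])
        have "l2_norm (\<lambda>z. U G z - 1 * ?P z) \<le> 0"
          using UG by (intro l2_norm_le Fc F_diff UF GF PF) auto
        then have "norm (U (\<lambda>z. U G z - 1 * ?P z) x) \<le> C * 0"
          using U_le[OF F_diff[OF UF[OF GF] PF, of 1] x] C by (meson mult_left_mono order_trans)
        then show ?thesis using U_diff[OF UF[OF GF] PF x, of 1] by simp
      qed
      also have "\<dots> = U (U h) x - 1 * U (U (U (g n))) x" by (rule U_diff[OF UF[OF hF] UUg x])
      finally have 3: "U (U G) x = U (U h) x - U (U (U (g n))) x" by simp
      have 4: "U D x = U (U (U (g n))) x - of_real l * U (g n) x"
        unfolding D_def by (rule U_diff[OF UUg g(1) x])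
      have "norm (of_real l * (U (g n) x - h x)) \<le> l * e"
        using n(2)[OF x] f_eq[OF x] l by (simp add: norm_mult)
      moreover have "U (U h) x - of_real l * h x = U (U G) x + U D x + of_real l * (U (g n) x - h x)"
        by (simp add: 3 4 algebra_simps)
      ultimately have "norm (U (U h) x - of_real l * h x) \<le> C * (C * e) + C * e + l * e"
        using 1 2 by (smt (verit) norm_triangle_ineq)
      also have "\<dots> = (C * C + C + l) * e" by (simp add: algebra_simps)
      also have "\<dots> = d" using K by (simp add: e_def)
      finally show ?thesis by simp
    qed
    then have "norm (U (U h) x - of_real l * h x) \<le> 0" by (rule field_le_epsilon)
    then show ?thesis by simp
  qed
  ultimately show ?thesis using hF l by blast
qed

section \<open>Common eigenvectors of translations\<close>

definition translation_invariant :: "('a \<Rightarrow> complex) set \<Rightarrow> bool" where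
  "translation_invariant F \<longleftrightarrow> (\<forall>b\<in>carrier Y. \<forall>f\<in>F. (\<lambda>x. f (b \<otimes> x)) \<in> F)"

definition nontrivial :: "('a \<Rightarrow> complex) set \<Rightarrow> bool" where
  "nontrivial F \<longleftrightarrow> (\<exists>f\<in>F. \<exists>x\<in>carrier Y. f x \<noteq> 0)"

lemma closed_subspace_cont: "closed_subspace cont"
  unfolding closed_subspace_def
proof (intro conjI ballI allI impI cont_intros subset_refl)
  fix h assume h: "\<forall>e>0. \<exists>f\<in>cont. \<forall>x\<in>carrier Y. norm (f x - h x) \<le> e"
  show "h \<in> cont"
  proof (rule cont_if_uniform)
    fix e :: real assume e: "e > 0"
    then have e3: "e / 3 > 0" by simp
    obtain f where f: "f \<in> cont" "\<And>x. x \<in> carrier Y \<Longrightarrow> norm (f x - h x) \<le> e / 3"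
      using h e3 by blast
    obtain V where V: "openin T V" "\<one> \<in> V"
        "\<And>v x. v \<in> V \<Longrightarrow> x \<in> carrier Y \<Longrightarrow> norm (f (v \<otimes> x) - f x) < e / 3"
      by (rule uniform_continuity[OF f(1) e3]) auto
    have "norm (h (v \<otimes> x) - h x) \<le> e" if "v \<in> V" "x \<in> carrier Y" for v x
    proof -
      have "v \<otimes> x \<in> carrier Y" using that open_subset_carrier[OF V(1)] by auto
      then have "norm (f (v \<otimes> x) - h (v \<otimes> x)) \<le> e / 3" by (rule f(2))
      then show ?thesis
        using f(2)[OF that(2)] V(3)[OF that]
          norm_triangle_ineq4[of "f (v \<otimes> x) - f x" "f (v \<otimes> x) - h (v \<otimes> x)"]
          norm_triangle_ineq[of "(f (v \<otimes> x) - f x) - (f (v \<otimes> x) - h (v \<otimes> x))" "f x - h x"]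
        by simp
    qed
    with V show "\<exists>V. openin T V \<and> \<one> \<in> V \<and> (\<forall>v\<in>V. \<forall>x\<in>carrier Y. norm (h (v \<otimes> x) - h x) \<le> e)"
      by blast
  qed
qed

lemma ip_translate:
  assumes "f \<in> cont" "g \<in> cont" "b \<in> carrier Y"
  shows "ip (\<lambda>x. f (b \<otimes> x)) g = ip f (\<lambda>x. g (inv b \<otimes> x))"
proof -
  have "(\<lambda>x. f x * cnj (g (inv b \<otimes> x))) \<in> cont"
    by (intro cont_mult cont_cnj cont_translate_inv_left assms)
  from mean_translate[OF assms(3) this]
  have "ip f (\<lambda>x. g (inv b \<otimes> x)) = mean (\<lambda>x. f (b \<otimes> x) * cnj (g (inv b \<otimes> (b \<otimes> x))))"
    by (simp add: ip_def)
  also have "\<dots> = ip (\<lambda>x. f (b \<otimes> x)) g"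
    unfolding ip_def using assms by (intro mean_cong)
      (simp add: m_assoc[symmetric])
  finally show ?thesis ..
qed

text \<open>If a product of factors \<open>\<tau> - r\<close>, where \<open>\<tau>\<close> is the translation by \<open>b\<close>, annihilates a nonzero vector,
  then one of the factors does: stop just before the partial product vanishes.\<close>

lemma factor_has_kernel:
  fixes b :: 'a
  defines "D r f \<equiv> (\<lambda>x. f (b \<otimes> x) - r * f x)"
  assumes F: "closed_subspace F" "translation_invariant F" and b: "b \<in> carrier Y"
  shows "h \<in> F \<Longrightarrow> \<exists>x\<in>carrier Y. h x \<noteq> 0 \<Longrightarrow> \<forall>x\<in>carrier Y. fold D rs h x = 0 \<Longrightarrow>
    \<exists>r. \<exists>f\<in>F. (\<exists>x\<in>carrier Y. f x \<noteq> 0) \<and> (\<forall>x\<in>carrier Y. f (b \<otimes> x) = r * f x)"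
proof (induction rs arbitrary: h)
  case Nil
  then show ?case by simp
next
  case (Cons r rs)
  show ?case
  proof (cases "\<exists>x\<in>carrier Y. D r h x \<noteq> 0")
    case True
    have "(\<lambda>x. h (b \<otimes> x)) \<in> F"
      using F(2) b Cons.prems(1) by (simp add: translation_invariant_def)
    then have "D r h \<in> F"
      unfolding D_def using closed_subspace_diff[OF F(1) _ Cons.prems(1)] by simp
    then show ?thesis using Cons.IH[of "D r h"] True Cons.prems(3) by simp
  next
    case False
    then show ?thesis
      using Cons.prems(1,2) unfolding D_def by (intro exI[of _ r] bexI[of _ h]) auto
  qed
qed

text \<open>The translation \<open>\<tau>\<close> by \<open>b\<close> is not self-adjoint, but \<open>U = \<tau> + \<tau>\<^sup>-\<^sup>1\<close> is. An equation \<open>U\<^sup>2 h = d h\<close> is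
  a polynomial equation of degree 4 for \<open>\<tau>\<close>, and it splits into linear factors over the complex
  numbers. The hypotheses on \<open>w\<close> and \<open>C\<close> say that the unit ball of \<open>F\<close> itself is equicontinuous and
  bounded, as it is for eigenspaces of convolution operators.\<close>

lemma translation_eigenvector:
  assumes F: "closed_subspace F" "translation_invariant F" "nontrivial F" and b: "b \<in> carrier Y"
    and w: "modulus w" and C: "0 \<le> C"
    and F_equi: "\<And>f v x. f \<in> F \<Longrightarrow> v \<in> carrier Y \<Longrightarrow> x \<in> carrier Y \<Longrightarrow>
        norm (f (v \<otimes> x) - f x) \<le> w v * l2_norm f"
    and F_le: "\<And>f x. f \<in> F \<Longrightarrow> x \<in> carrier Y \<Longrightarrow> norm (f x) \<le> C * l2_norm f"
  shows "\<exists>r. \<exists>f\<in>F. (\<exists>x\<in>carrier Y. f x \<noteq> 0) \<and> (\<forall>x\<in>carrier Y. f (b \<otimes> x) = r * f x)"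
proof -
  define U where "U f = (\<lambda>x. f (b \<otimes> x) + f (inv b \<otimes> x))" for f :: "'a \<Rightarrow> complex"
  have Fc: "f \<in> cont" if "f \<in> F" for f using closed_subspaceD(1)[OF F(1) that] .
  have tr: "(\<lambda>x. f (a \<otimes> x)) \<in> F" if "f \<in> F" "a \<in> carrier Y" for f a
    using F(2) that by (simp add: translation_invariant_def)
  have ib: "inv b \<in> carrier Y" using b by simp
  have U_lin: "linear_on F U"
    unfolding linear_on_def
  proof (intro conjI ballI allI)
    show "U f \<in> F" if "f \<in> F" for f
      unfolding U_def by (intro closed_subspaceD(2)[OF F(1)] tr that b ib)
  qed (simp add: U_def algebra_simps)
  have adj: "ip (U f) g = ip f (U g)" if f: "f \<in> F" and g: "g \<in> F" for f g
  proof -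
    have c: "(\<lambda>x. q (a \<otimes> x)) \<in> cont" if "q \<in> F" "a \<in> carrier Y" for q a using Fc tr that by blast
    have "ip (U f) g = ip (\<lambda>x. f (b \<otimes> x)) g + ip (\<lambda>x. f (inv b \<otimes> x)) g"
      unfolding U_def by (intro ip_add_left c Fc f g b ib)
    also have "ip (\<lambda>x. f (b \<otimes> x)) g = ip f (\<lambda>x. g (inv b \<otimes> x))"
      by (intro ip_translate Fc f g b)
    also have "ip (\<lambda>x. f (inv b \<otimes> x)) g = ip f (\<lambda>x. g (b \<otimes> x))"
      using ip_translate[OF Fc[OF f] Fc[OF g] ib] b by simp
    also have "ip f (\<lambda>x. g (inv b \<otimes> x)) + ip f (\<lambda>x. g (b \<otimes> x)) = ip f (U g)"
      unfolding U_def by (subst add.commute) (intro ip_add_right[symmetric] c Fc f g b ib)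
    finally show ?thesis .
  qed
  have U_equi: "norm (U f (v \<otimes> x) - U f x) \<le> 2 * w v * l2_norm f"
    if f: "f \<in> F" and v: "v \<in> carrier Y" and x: "x \<in> carrier Y" for f v x
  proof -
    have "norm (f (a \<otimes> (v \<otimes> x)) - f (a \<otimes> x)) \<le> w v * l2_norm f" if a: "a \<in> carrier Y" for a
      using F_equi[OF f v, of "a \<otimes> x"] a v x by (simp add: m_lcomm)
    from this[OF b] this[OF ib] show ?thesis
      unfolding U_def using norm_triangle_ineq[of "f (b \<otimes> (v \<otimes> x)) - f (b \<otimes> x)"
          "f (inv b \<otimes> (v \<otimes> x)) - f (inv b \<otimes> x)"]
      by (simp add: algebra_simps)
  qed
  have U_le: "norm (U f x) \<le> 2 * C * l2_norm f" if f: "f \<in> F" and x: "x \<in> carrier Y" for f x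
    unfolding U_def using F_le[OF f, of "b \<otimes> x"] F_le[OF f, of "inv b \<otimes> x"] b ib x
      norm_triangle_ineq[of "f (b \<otimes> x)" "f (inv b \<otimes> x)"] by simp
  have "\<exists>d. \<exists>h\<in>F. (\<exists>x\<in>carrier Y. h x \<noteq> 0) \<and> (\<forall>x\<in>carrier Y. U (U h) x = d * h x)"
  proof (cases "\<exists>g\<in>F. \<exists>x\<in>carrier Y. U g x \<noteq> 0")
    case True
    then obtain g x where g: "g \<in> F" "x \<in> carrier Y" "U g x \<noteq> 0" by blast
    have w2: "modulus (\<lambda>v. 2 * w v)" and C2: "0 \<le> 2 * C"
      using modulus_cmult[OF w, of 2] C by simp_all
    show ?thesis
      using spectral_lemma[OF F(1) U_lin adj w2 C2 U_equi U_le g] by blast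
  next
    case False
    obtain h where h: "h \<in> F" "\<exists>x\<in>carrier Y. h x \<noteq> 0" using F(3) by (auto simp: nontrivial_def)
    have "U h \<in> F" using U_lin h(1) by (simp add: linear_on_def)
    then have "\<forall>x\<in>carrier Y. U (U h) x = 0 * h x" using False by simp
    with h show ?thesis by blast
  qed
  then obtain d h where h: "h \<in> F" "\<exists>x\<in>carrier Y. h x \<noteq> 0"
      "\<And>x. x \<in> carrier Y \<Longrightarrow> U (U h) x = d * h x" by blast
  define D where "D r f = (\<lambda>x. f (b \<otimes> x) - r * f x)" for r and f :: "'a \<Rightarrow> complex"
  define s where "s = csqrt ((d - 2)\<^sup>2 - 4)"
  \<comment> \<open>With \<open>w = \<tau>\<^sup>2\<close>, the equation \<open>U\<^sup>2 h = d h\<close> becomes \<open>w\<^sup>2 - (d - 2) w + 1 = 0\<close>, with roots \<open>w1\<close> and \<open>w2\<close>.\<close>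
  define w1 where "w1 = ((d - 2) + s) / 2"
  define w2 where "w2 = ((d - 2) - s) / 2"
  have s2: "s * s = (d - 2)\<^sup>2 - 4" by (simp add: s_def flip: power2_eq_square)
  have w12: "w1 + w2 = d - 2" "w1 * w2 = 1"
    using s2 by (simp_all add: w1_def w2_def field_simps power2_eq_square)
  define r1 where "r1 = csqrt w1"
  define r2 where "r2 = csqrt w2"
  have r: "r1 * r1 = w1" "r2 * r2 = w2"
    by (simp_all add: r1_def r2_def flip: power2_eq_square)
  have "fold D [r1, - r1, r2, - r2] h x = 0" if x: "x \<in> carrier Y" for x
  proof -
    define hh where "hh n = h (b [^] (n::nat) \<otimes> x)" for n
    have bb: "b \<otimes> (b [^] n \<otimes> x) = b [^] (Suc n) \<otimes> x" for n :: nat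
      using b x by (simp add: m_assoc[symmetric] m_comm)
    have step: "h (b \<otimes> x) = hh 1" "h (b \<otimes> (b \<otimes> x)) = hh 2" "h (b \<otimes> (b \<otimes> (b \<otimes> x))) = hh 3"
      "h (b \<otimes> (b \<otimes> (b \<otimes> (b \<otimes> x)))) = hh 4" "h x = hh 0"
      using b x bb[of 1] bb[of 2] bb[of 3] by (simp_all add: hh_def numeral_eq_Suc m_assoc)
    have "fold D [r1, - r1, r2, - r2] h x
        = hh 4 - (r1 * r1 + r2 * r2) * hh 2 + (r1 * r1) * (r2 * r2) * hh 0"
      unfolding D_def by (simp add: step algebra_simps)
    also have "\<dots> = hh 4 - (d - 2) * hh 2 + hh 0"
      unfolding r w12 by simp
    also have "\<dots> = 0"
    proof -
      have c: "inv b \<otimes> (b \<otimes> z) = z" "b \<otimes> (inv b \<otimes> z) = z" if "z \<in> carrier Y" for z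
        using b that by (simp_all add: m_assoc[symmetric])
      have "U (U h) (b \<otimes> (b \<otimes> x)) = hh 4 + 2 * hh 2 + hh 0"
        unfolding U_def using b x by (simp add: c step)
      then show ?thesis
        using h(3)[of "b \<otimes> (b \<otimes> x)"] b x by (simp add: step algebra_simps)
    qed
    finally show ?thesis .
  qed
  then show ?thesis
    using factor_has_kernel[OF F(1,2) b h(1,2), of "[r1, - r1, r2, - r2]"] unfolding D_def by blast
qed

section \<open>Characters from eigenspaces of a convolution operator\<close>

lemma conv_diff_right:
  assumes "k \<in> cont" "f \<in> cont" "g \<in> cont" "x \<in> carrier Y"
  shows "conv k (\<lambda>x. f x - c * g x) x = conv k f x - c * conv k g x"
proof -
  have k: "(\<lambda>y. k (inv x \<otimes> y)) \<in> cont" using assms by (intro cont_translate_inv_left)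
  have "conv k (\<lambda>x. f x - c * g x) x = mean (\<lambda>y. k (inv x \<otimes> y) * f y - c * (k (inv x \<otimes> y) * g y))"
    by (simp add: conv_def algebra_simps)
  also have "\<dots> = conv k f x - mean (\<lambda>y. c * (k (inv x \<otimes> y) * g y))"
    unfolding conv_def by (intro mean_diff cont_mult cont_const k assms)
  also have "mean (\<lambda>y. c * (k (inv x \<otimes> y) * g y)) = c * conv k g x"
    unfolding conv_def by (intro mean_cmult cont_mult cont_const k assms)
  finally show ?thesis .
qed

lemma conv_translate:
  assumes "k \<in> cont" "f \<in> cont" "b \<in> carrier Y" "x \<in> carrier Y"
  shows "conv k (\<lambda>x. f (b \<otimes> x)) x = conv k f (b \<otimes> x)"
proof -
  have c: "(\<lambda>y. k (inv (b \<otimes> x) \<otimes> y) * f y) \<in> cont"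
    using assms by (intro cont_mult cont_translate_inv_left) auto
  have eq: "inv (b \<otimes> x) \<otimes> (b \<otimes> y) = inv x \<otimes> y" if "y \<in> carrier Y" for y
  proof -
    have "inv (b \<otimes> x) \<otimes> (b \<otimes> y) = inv b \<otimes> (inv x \<otimes> (b \<otimes> y))"
      using assms that by (intro inv_mult_translate) auto
    also have "\<dots> = inv b \<otimes> (b \<otimes> (inv x \<otimes> y))" using assms that by (simp add: m_lcomm)
    also have "\<dots> = inv x \<otimes> y" using assms that by (simp add: m_assoc[symmetric])
    finally show ?thesis .
  qed
  have "conv k f (b \<otimes> x) = mean (\<lambda>y. k (inv (b \<otimes> x) \<otimes> (b \<otimes> y)) * f (b \<otimes> y))"
    unfolding conv_def by (rule mean_translate[OF assms(3) c, symmetric])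
  also have "\<dots> = conv k (\<lambda>x. f (b \<otimes> x)) x"
    unfolding conv_def by (intro mean_cong) (simp add: eq)
  finally show ?thesis ..
qed

lemma conv_cong: "(\<And>y. y \<in> carrier Y \<Longrightarrow> f y = g y) \<Longrightarrow> conv k f x = conv k g x"
  unfolding conv_def by (intro mean_cong) simp

text \<open>Eigenspace of the square of the convolution operator, as delivered by the spectral lemma.\<close>

definition eigenspace :: "('a \<Rightarrow> complex) \<Rightarrow> complex \<Rightarrow> ('a \<Rightarrow> complex) set" where
  "eigenspace k c = {h \<in> cont. \<forall>x\<in>carrier Y. conv k (conv k h) x = c * h x}"

lemma eigenspace_closed_subspace:
  assumes k: "k \<in> cont"
  shows "closed_subspace (eigenspace k c)"
  unfolding closed_subspace_def
proof (intro conjI ballI allI impI)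
  have minus: "(\<lambda>x. f x - a * g x) \<in> eigenspace k c"
    if f: "f \<in> eigenspace k c" and g: "g \<in> eigenspace k c" for f g a
  proof -
    have fc: "f \<in> cont" and gc: "g \<in> cont" using f g by (auto simp: eigenspace_def)
    have "conv k (conv k (\<lambda>x. f x - a * g x)) x = c * (f x - a * g x)" if x: "x \<in> carrier Y" for x
    proof -
      have "conv k (conv k (\<lambda>x. f x - a * g x)) x = conv k (\<lambda>x. conv k f x - a * conv k g x) x"
        by (intro conv_cong conv_diff_right k fc gc)
      also have "\<dots> = conv k (conv k f) x - a * conv k (conv k g) x"
        by (intro conv_diff_right conv_cont k fc gc x)
      finally show ?thesis using f g x by (simp add: eigenspace_def algebra_simps)
    qed
    moreover have "(\<lambda>x. f x - a * g x) \<in> cont" by (intro cont_intros fc gc)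
    ultimately show ?thesis by (simp add: eigenspace_def)
  qed
  show "(\<lambda>x. f x + g x) \<in> eigenspace k c" if "f \<in> eigenspace k c" "g \<in> eigenspace k c" for f g
    using minus[OF that, of "- 1"] by simp
  show "(\<lambda>x. a * f x) \<in> eigenspace k c" if "f \<in> eigenspace k c" for f a
    using minus[OF that that, of "1 - a"] by (simp add: algebra_simps)
  show "eigenspace k c \<subseteq> cont" by (auto simp: eigenspace_def)
  fix h assume h: "\<forall>e>0. \<exists>f\<in>eigenspace k c. \<forall>x\<in>carrier Y. norm (f x - h x) \<le> e"
  have hc: "h \<in> cont"
    by (rule closed_subspaceD(4)[OF closed_subspace_cont]) (use h in \<open>unfold eigenspace_def, blast\<close>)
  have "conv k (conv k h) x = c * h x" if x: "x \<in> carrier Y" for x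
  proof -
    let ?B = "sup_norm k"
    have B: "0 \<le> ?B" by (rule sup_norm_nonneg[OF k])
    have "norm (conv k (conv k h) x - c * h x) \<le> 0 + d" if d: "d > 0" for d
    proof -
      define e where "e = d / (?B * ?B + norm c + 1)"
      have K: "0 < ?B * ?B + norm c + 1" using B by (simp add: add_nonneg_pos)
      have e: "e > 0" using d K by (simp add: e_def)
      then obtain f where f: "f \<in> eigenspace k c" "\<And>x. x \<in> carrier Y \<Longrightarrow> norm (f x - h x) \<le> e"
        using h by blast
      have fc: "f \<in> cont" using f by (simp add: eigenspace_def)
      let ?g = "\<lambda>x. f x - 1 * h x"
      have gc: "?g \<in> cont" by (intro cont_intros fc hc)
      have l2g: "l2_norm ?g \<le> e" using f(2) e by (intro l2_norm_le gc) auto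
      have "norm (conv k ?g y) \<le> ?B * e" if "y \<in> carrier Y" for y
        using conv_le[OF k gc that] mult_left_mono[OF l2g B] by linarith
      then have "l2_norm (conv k ?g) \<le> ?B * e"
        using B e by (intro l2_norm_le conv_cont k gc) auto
      then have 1: "norm (conv k (conv k ?g) x) \<le> ?B * (?B * e)"
        using conv_le[OF k conv_cont[OF k gc] x] mult_left_mono[of "l2_norm (conv k ?g)" "?B * e" ?B] B
        by linarith
      have "conv k (conv k ?g) x = conv k (\<lambda>x. conv k f x - 1 * conv k h x) x"
        by (intro conv_cong conv_diff_right k fc hc)
      also have "\<dots> = conv k (conv k f) x - 1 * conv k (conv k h) x"
        by (intro conv_diff_right conv_cont k fc hc x)
      finally have "conv k (conv k h) x - c * h x = c * (f x - h x) - conv k (conv k ?g) x"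
        using f(1) x by (simp add: eigenspace_def algebra_simps)
      also have "norm \<dots> \<le> norm (c * (f x - h x)) + norm (conv k (conv k ?g) x)"
        by (rule norm_triangle_ineq4)
      also have "\<dots> \<le> norm c * e + ?B * (?B * e)"
        using 1 f(2)[OF x] by (intro add_mono) (simp_all add: norm_mult mult_left_mono)
      also have "\<dots> \<le> (?B * ?B + norm c + 1) * e" using e by (simp add: algebra_simps)
      also have "\<dots> = d" using K by (simp add: e_def)
      finally show ?thesis by simp
    qed
    then have "norm (conv k (conv k h) x - c * h x) \<le> 0" by (rule field_le_epsilon)
    then show ?thesis by simp
  qed
  then show "h \<in> eigenspace k c" using hc by (simp add: eigenspace_def)
qed

lemma eigenspace_translation_invariant:
  assumes k: "k \<in> cont"
  shows "translation_invariant (eigenspace k c)"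
  unfolding translation_invariant_def
proof (intro ballI)
  fix b h assume b: "b \<in> carrier Y" and h: "h \<in> eigenspace k c"
  have hc: "h \<in> cont" using h by (simp add: eigenspace_def)
  have "conv k (conv k (\<lambda>x. h (b \<otimes> x))) x = c * h (b \<otimes> x)" if x: "x \<in> carrier Y" for x
  proof -
    have "conv k (conv k (\<lambda>x. h (b \<otimes> x))) x = conv k (\<lambda>x. conv k h (b \<otimes> x)) x"
      by (intro conv_cong conv_translate k hc b)
    also have "\<dots> = conv k (conv k h) (b \<otimes> x)"
      by (intro conv_translate k conv_cont hc b x)
    finally show ?thesis using h b x by (simp add: eigenspace_def)
  qed
  then show "(\<lambda>x. h (b \<otimes> x)) \<in> eigenspace k c"
    using cont_translate[OF hc b] by (simp add: eigenspace_def)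
qed

definition oscillation :: "('a \<Rightarrow> complex) \<Rightarrow> 'a \<Rightarrow> real" where
  "oscillation k v = sup_norm (\<lambda>z. k (inv v \<otimes> z) - k z)"

lemma modulus_oscillation:
  assumes "k \<in> cont"
  shows "modulus (oscillation k)"
  unfolding modulus_def
proof (intro conjI ballI allI impI)
  show "0 \<le> oscillation k v" if "v \<in> carrier Y" for v
    unfolding oscillation_def
    by (intro sup_norm_nonneg cont_diff cont_translate_inv_left that assms)
  fix e :: real assume "e > 0"
  from uniform_continuity_inv[OF assms this] obtain V where V: "openin T V" "\<one> \<in> V"
    "\<And>v x. v \<in> V \<Longrightarrow> x \<in> carrier Y \<Longrightarrow> norm (k (inv v \<otimes> x) - k x) < e" by blast
  then have "oscillation k v \<le> e" if "v \<in> V" for v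
    unfolding oscillation_def using that by (intro sup_norm_le) (auto intro: less_imp_le)
  with V(1,2) show "\<exists>V. openin T V \<and> \<one> \<in> V \<and> (\<forall>v\<in>V. oscillation k v \<le> e)" by blast
qed

lemma conv_equi:
  assumes "k \<in> cont" "g \<in> cont" "v \<in> carrier Y" "x \<in> carrier Y"
  shows "norm (conv k g (v \<otimes> x) - conv k g x) \<le> oscillation k v * l2_norm g"
proof (intro conv_diff_le assms)
  have c: "(\<lambda>z. k (inv v \<otimes> z) - k z) \<in> cont"
    by (intro cont_diff cont_translate_inv_left assms)
  show "0 \<le> oscillation k v" unfolding oscillation_def by (rule sup_norm_nonneg[OF c])
  show "norm (k (inv v \<otimes> z) - k z) \<le> oscillation k v" if "z \<in> carrier Y" for z
    unfolding oscillation_def using norm_le_sup_norm[OF c that] by simp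
qed

text \<open>An eigenfunction with eigenvalue \<open>c\<close> is \<open>1/c\<close> times an image under convolution, so it inherits
  the smoothing estimates of convolution.\<close>

lemma eigenspace_bounds:
  assumes k: "k \<in> cont" and c: "c > 0" and h: "h \<in> eigenspace k (complex_of_real c)"
  shows "v \<in> carrier Y \<Longrightarrow> x \<in> carrier Y \<Longrightarrow>
      norm (h (v \<otimes> x) - h x) \<le> sup_norm k / c * oscillation k v * l2_norm h" (is "_ \<Longrightarrow> _ \<Longrightarrow> ?A")
    and "x \<in> carrier Y \<Longrightarrow> norm (h x) \<le> sup_norm k * sup_norm k / c * l2_norm h"
proof -
  have hc: "h \<in> cont" using h by (simp add: eigenspace_def)
  have kh: "conv k h \<in> cont" by (intro conv_cont k hc)
  have B: "0 \<le> sup_norm k" by (rule sup_norm_nonneg[OF k])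
  have l2: "l2_norm (conv k h) \<le> sup_norm k * l2_norm h"
    using B l2_norm_nonneg[OF hc] by (intro l2_norm_le kh conv_le k hc) auto
  have eq: "h x = conv k (conv k h) x / c" if "x \<in> carrier Y" for x
    using h that c by (simp add: eigenspace_def)
  show ?A if v: "v \<in> carrier Y" and x: "x \<in> carrier Y"
  proof -
    have o: "0 \<le> oscillation k v" using modulus_oscillation[OF k] v by (simp add: modulus_def)
    have "norm (h (v \<otimes> x) - h x) = norm (conv k (conv k h) (v \<otimes> x) - conv k (conv k h) x) / c"
      using c v x by (simp add: eq norm_divide flip: diff_divide_distrib)
    also have "\<dots> \<le> oscillation k v * (sup_norm k * l2_norm h) / c"
      using conv_equi[OF k kh v x] mult_left_mono[OF l2 o] c by (intro divide_right_mono) auto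
    finally show ?thesis by (simp add: mult_ac)
  qed
  show "norm (h x) \<le> sup_norm k * sup_norm k / c * l2_norm h" if x: "x \<in> carrier Y"
  proof -
    have "norm (h x) = norm (conv k (conv k h) x) / c"
      using c x by (simp add: eq norm_divide)
    also have "\<dots> \<le> sup_norm k * (sup_norm k * l2_norm h) / c"
      using conv_le[OF k kh x] mult_left_mono[OF l2 B] c by (intro divide_right_mono) auto
    finally show ?thesis by (simp add: mult_ac)
  qed
qed

text \<open>Joint eigenspaces of finitely many translations are again closed and translation-invariant,
  because the translations commute, so one translation can be added at a time.\<close>

lemma common_eigenvector:
  assumes k: "k \<in> cont" and c: "c > 0" and nt: "nontrivial (eigenspace k (complex_of_real c))"
    and A: "finite A" "A \<subseteq> carrier Y"
  shows "\<exists>r. nontrivial {h \<in> eigenspace k (complex_of_real c).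
            \<forall>a\<in>A. \<forall>x\<in>carrier Y. h (a \<otimes> x) = r a * h x}"
  using A
proof (induction A)
  case empty
  then show ?case using nt by simp
next
  case (insert b A)
  let ?E = "eigenspace k (complex_of_real c)"
  let ?F = "\<lambda>r A. {h \<in> ?E. \<forall>a\<in>A. \<forall>x\<in>carrier Y. h (a \<otimes> x) = r a * h x}"
  have A: "A \<subseteq> carrier Y" and b: "b \<in> carrier Y" using insert.prems by auto
  obtain r where r: "nontrivial (?F r A)" using insert.IH[OF A] by blast
  note E = eigenspace_closed_subspace[OF k, of "complex_of_real c"]
  have sub: "closed_subspace (?F r A)"
    unfolding closed_subspace_def
  proof (intro conjI ballI allI impI)
    show "?F r A \<subseteq> cont" using closed_subspaceD(1)[OF E] by blast
    show "(\<lambda>x. f x + g x) \<in> ?F r A" if "f \<in> ?F r A" "g \<in> ?F r A" for f g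
      using that closed_subspaceD(2)[OF E] by (simp add: algebra_simps)
    show "(\<lambda>x. a * f x) \<in> ?F r A" if "f \<in> ?F r A" for f a
      using that closed_subspaceD(3)[OF E] by simp
    fix h assume h: "\<forall>e>0. \<exists>f\<in>?F r A. \<forall>x\<in>carrier Y. norm (f x - h x) \<le> e"
    have hE: "h \<in> ?E"
      by (rule closed_subspaceD(4)[OF E]) (use h in blast)
    have "h (a \<otimes> x) = r a * h x" if a: "a \<in> A" and x: "x \<in> carrier Y" for a x
    proof -
      have "norm (h (a \<otimes> x) - r a * h x) \<le> 0 + d" if d: "d > 0" for d
      proof -
        define e where "e = d / (1 + norm (r a))"
        have K: "0 < 1 + norm (r a)" by (simp add: add_pos_nonneg)
        have "e > 0" using d K by (simp add: e_def)
        then obtain f where f: "f \<in> ?F r A" "\<And>x. x \<in> carrier Y \<Longrightarrow> norm (f x - h x) \<le> e"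
          using h by blast
        have "h (a \<otimes> x) - r a * h x = r a * (f x - h x) - (f (a \<otimes> x) - h (a \<otimes> x))"
          using f(1) a x by (simp add: algebra_simps)
        also have "norm \<dots> \<le> norm (r a * (f x - h x)) + norm (f (a \<otimes> x) - h (a \<otimes> x))"
          by (rule norm_triangle_ineq4)
        also have "\<dots> \<le> norm (r a) * e + e"
          using f(2)[OF x] f(2)[of "a \<otimes> x"] a A x
          by (intro add_mono) (auto simp: norm_mult mult_left_mono)
        also have "\<dots> = (1 + norm (r a)) * e" by (simp add: algebra_simps)
        also have "\<dots> = d" using K by (simp add: e_def)
        finally show ?thesis by simp
      qed
      then have "norm (h (a \<otimes> x) - r a * h x) \<le> 0" by (rule field_le_epsilon)
      then show ?thesis by simp
    qed
    with hE show "h \<in> ?F r A" by blast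
  qed
  have ti: "translation_invariant (?F r A)"
    unfolding translation_invariant_def
  proof (intro ballI)
    fix a h assume a: "a \<in> carrier Y" and h: "h \<in> ?F r A"
    have "(\<lambda>x. h (a \<otimes> x)) \<in> ?E"
      using eigenspace_translation_invariant[OF k] a h by (auto simp: translation_invariant_def)
    moreover have "h (a \<otimes> (a' \<otimes> x)) = r a' * h (a \<otimes> x)" if "a' \<in> A" "x \<in> carrier Y" for a' x
    proof -
      have "a' \<in> carrier Y" using that A by blast
      then have "a \<otimes> (a' \<otimes> x) = a' \<otimes> (a \<otimes> x)" using a that by (simp add: m_lcomm)
      then show ?thesis using h that a by simp
    qed
    ultimately show "(\<lambda>x. h (a \<otimes> x)) \<in> ?F r A" by simp
  qed
  have B: "0 \<le> sup_norm k" by (rule sup_norm_nonneg[OF k])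
  have w: "modulus (\<lambda>v. sup_norm k / c * oscillation k v)"
    using B c by (intro modulus_cmult modulus_oscillation k) simp
  have C: "0 \<le> sup_norm k * sup_norm k / c" using B c by simp
  obtain s f where f: "f \<in> ?F r A" "\<exists>x\<in>carrier Y. f x \<noteq> 0"
      "\<forall>x\<in>carrier Y. f (b \<otimes> x) = s * f x"
    using translation_eigenvector[OF sub ti r b w C] eigenspace_bounds[OF k c] by blast
  have "f \<in> ?F (r(b := s)) (insert b A)"
    using f insert.hyps(2) by auto
  with f(2) show ?case unfolding nontrivial_def by blast
qed

lemma normalize_at_maximum:
  assumes "f \<in> cont" "x \<in> carrier Y" "f x \<noteq> 0"
  obtains z where "z \<in> carrier Y" "f z \<noteq> 0" "\<And>y. y \<in> carrier Y \<Longrightarrow> norm (f y) \<le> norm (f z)"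
proof -
  have "compact (f ` carrier Y)"
    using image_compactin[of T "topspace T" euclidean f] assms compact
    by (auto simp: cont_def compact_space_def topspace_eq_carrier)
  then have "compact (norm ` (f ` carrier Y))"
    by (intro compact_continuous_image continuous_intros)
  moreover have "norm ` (f ` carrier Y) \<noteq> {}" using assms by blast
  ultimately obtain m where m: "m \<in> norm ` (f ` carrier Y)" "\<And>t. t \<in> norm ` (f ` carrier Y) \<Longrightarrow> t \<le> m"
    using compact_attains_sup by metis
  then obtain z where z: "z \<in> carrier Y" "m = norm (f z)" by blast
  show ?thesis
  proof (rule that[OF z(1)])
    show le: "norm (f y) \<le> norm (f z)" if "y \<in> carrier Y" for y using m(2) z(2) that by blast
    show "f z \<noteq> 0" using le[OF assms(2)] assms(3) by auto
  qed
qed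

lemma eigenspace_nontrivial:
  assumes k: "k \<in> cont" and herm: "\<And>z. z \<in> carrier Y \<Longrightarrow> k (inv z) = cnj (k z)"
    and x: "x \<in> carrier Y" "k x \<noteq> 0"
  shows "\<exists>c>0. nontrivial (eigenspace k (complex_of_real c))"
proof -
  have lin: "linear_on cont (conv k)"
    unfolding linear_on_def by (intro conjI ballI allI conv_cont conv_diff_right k)
  let ?g = "\<lambda>y. cnj (k y)"
  have g: "?g \<in> cont" by (intro cont_intros k)
  have "conv k ?g \<one> = ip k k"
    unfolding conv_def ip_def by (intro mean_cong) simp
  moreover have "l2_norm k \<noteq> 0" using l2_norm_eq_0[OF k _ x(1)] x(2) by blast
  ultimately have "conv k ?g \<one> \<noteq> 0" using ip_self[OF k] by simp
  then obtain h c where "h \<in> cont" "c > 0" "\<exists>x\<in>carrier Y. h x \<noteq> 0"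
      "\<forall>x\<in>carrier Y. conv k (conv k h) x = complex_of_real c * h x"
    using spectral_lemma[OF closed_subspace_cont lin conv_self_adjoint[OF k _ _ herm]
        modulus_oscillation[OF k] sup_norm_nonneg[OF k] conv_equi[OF k] conv_le[OF k] g one_closed]
    by blast
  then show ?thesis by (auto simp: nontrivial_def eigenspace_def)
qed

text \<open>For finitely many translations, take a common eigenvector in an eigenspace of the convolution
  operator and normalize it by \<open>h \<one> = 1\<close> and \<open>norm (h x) \<le> 1\<close>, which is possible after translating
  a point of maximum to the identity. The normalized functions form a set that is compact for
  pointwise convergence, so there is one, \<open>h\<close>, that is an eigenvector of every translation. It satisfies
  \<open>h (x \<otimes> y) = h x * h y\<close>. As \<open>h\<close> lies in an eigenspace with nonzero eigenvalue, its
  coefficient \<open>mean (\<lambda>x. k x * h x)\<close>, which is the factor by which convolution acts on \<open>h\<close>, is nonzero.\<close>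

theorem character_with_nonzero_coefficient:
  assumes k: "k \<in> cont" and herm: "\<And>z. z \<in> carrier Y \<Longrightarrow> k (inv z) = cnj (k z)"
    and x: "x \<in> carrier Y" "k x \<noteq> 0"
  shows "\<exists>\<phi>\<in>cont. (\<forall>x\<in>carrier Y. \<forall>y\<in>carrier Y. \<phi> (x \<otimes> y) = \<phi> x * \<phi> y) \<and>
     (\<forall>x\<in>carrier Y. norm (\<phi> x) = 1) \<and> mean (\<lambda>x. k x * \<phi> x) \<noteq> 0"
proof -
  obtain c where c: "c > 0" and nt: "nontrivial (eigenspace k (complex_of_real c))"
    using eigenspace_nontrivial[OF assms] by blast
  let ?E = "eigenspace k (complex_of_real c)"
  note E = eigenspace_closed_subspace[OF k, of "complex_of_real c"]
  define w where "w v = sup_norm k / c * oscillation k v" for v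
  have B: "0 \<le> sup_norm k" by (rule sup_norm_nonneg[OF k])
  have w: "modulus w"
    unfolding w_def using B c by (intro modulus_cmult modulus_oscillation k) simp
  define K where "K = equi_ball w 1 \<inter> {h. h \<one> = 1}"
  have "compact K"
    unfolding K_def by (intro compact_Int_closed compact_equi_ball closed_pointwise_intros continuous_intros)
  have K_equi: "K \<subseteq> equi w" by (auto simp: K_def equi_ball_def)
  have "closed K"
    unfolding K_def by (intro closed_Int closed_equi_ball closed_pointwise_intros continuous_intros)
  have "closed (K \<inter> ?E)"
  proof -
    have "h \<in> K \<inter> ?E" if h: "h \<in> closure (K \<inter> ?E)" for h
    proof -
      have "closure (K \<inter> ?E) \<subseteq> K"
        using \<open>closed K\<close> by (intro closure_minimal) auto
      then have hK: "h \<in> K" using h by blast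
      have "\<exists>f\<in>?E. \<forall>x\<in>carrier Y. norm (f x - h x) \<le> e" if e: "e > 0" for e
      proof -
        have "K \<inter> ?E \<subseteq> equi w" "h \<in> equi w" using K_equi hK by auto
        then obtain f where "f \<in> K \<inter> ?E" "\<And>x. x \<in> carrier Y \<Longrightarrow> norm (f x - h x) \<le> e"
          by (rule equi_closure_uniform[OF w _ h _ e]) auto
        then show ?thesis by (intro bexI[of _ f]) auto
      qed
      then have "h \<in> ?E" by (rule closed_subspaceD(4)[OF E])
      with hK show ?thesis by blast
    qed
    then show ?thesis using closure_subset_eq by (metis subsetI)
  qed
  then have cpt: "compact (K \<inter> ?E)"
    using \<open>compact K\<close> by (metis compact_Int_closed inf.left_idem)
  \<comment> \<open>Being an eigenvector of the translation by \<open>b\<close>, stated without naming the eigenvalue so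
  that the condition is closed under pointwise limits.\<close>
  define Z where "Z b = {h :: 'a \<Rightarrow> complex. \<forall>x\<in>carrier Y. \<forall>y\<in>carrier Y.
      h (b \<otimes> x) * h y = h (b \<otimes> y) * h x}" for b
  have "(K \<inter> ?E) \<inter> (\<Inter>b\<in>carrier Y. Z b) \<noteq> {}"
  proof (rule compact_imp_fip_image[OF cpt])
    show "closed (Z b)" for b
      unfolding Z_def Ball_def
      by (intro closed_pointwise_intros continuous_intros)
    fix A assume A: "finite A" "A \<subseteq> carrier Y"
    obtain r f x where f: "f \<in> ?E" "\<And>a x. a \<in> A \<Longrightarrow> x \<in> carrier Y \<Longrightarrow> f (a \<otimes> x) = r a * f x"
        and x: "x \<in> carrier Y" "f x \<noteq> 0"
      using common_eigenvector[OF k c nt A] unfolding nontrivial_def by blast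
    have fc: "f \<in> cont" using f(1) closed_subspaceD(1)[OF E] by blast
    obtain z where z: "z \<in> carrier Y" "f z \<noteq> 0" "\<And>y. y \<in> carrier Y \<Longrightarrow> norm (f y) \<le> norm (f z)"
      using normalize_at_maximum[OF fc x] by blast
    define h where "h y = (if y \<in> carrier Y then 1 / f z * f (z \<otimes> y) else 0)" for y
    have h_eq: "h y = 1 / f z * f (z \<otimes> y)" if "y \<in> carrier Y" for y using that by (simp add: h_def)
    have "(\<lambda>y. 1 / f z * f (z \<otimes> y)) \<in> ?E"
      using eigenspace_translation_invariant[OF k] z(1) f(1)
      by (intro closed_subspaceD(3)[OF E]) (simp add: translation_invariant_def)
    then have hE: "h \<in> ?E"
      by (rule closed_subspace_cong[OF E]) (simp add: h_eq)
    have h_le: "norm (h y) \<le> 1" if "y \<in> carrier Y" for y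
      using z that by (simp add: h_eq norm_divide divide_le_eq)
    have h_l2: "l2_norm h \<le> 1"
      using h_le closed_subspaceD(1)[OF E hE] by (intro l2_norm_le) auto
    have "norm (h (v \<otimes> x) - h x) \<le> w v" if "v \<in> carrier Y" "x \<in> carrier Y" for v x
    proof -
      have "0 \<le> w v" using w that by (simp add: modulus_def)
      then have "w v * l2_norm h \<le> w v" using h_l2 by (rule mult_left_le[rotated])
      then show ?thesis using eigenspace_bounds(1)[OF k c hE that] unfolding w_def by linarith
    qed
    then have "h \<in> K"
      using h_le z by (auto simp: K_def equi_ball_def equi_def) (simp_all add: h_def)
    moreover have "h \<in> Z a" if a: "a \<in> A" for a
    proof -
      have ac: "a \<in> carrier Y" using a A by blast
      have "h (a \<otimes> x) = r a * h x" if x: "x \<in> carrier Y" for x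
      proof -
        have "z \<otimes> (a \<otimes> x) = a \<otimes> (z \<otimes> x)" using ac x z by (simp add: m_lcomm)
        then show ?thesis using f(2)[OF a, of "z \<otimes> x"] ac x z by (simp add: h_eq)
      qed
      then show ?thesis by (simp add: Z_def)
    qed
    ultimately show "(K \<inter> ?E) \<inter> (\<Inter>a\<in>A. Z a) \<noteq> {}" using hE by blast
  qed
  then obtain h where h: "h \<in> K" "h \<in> ?E" "\<And>b. b \<in> carrier Y \<Longrightarrow> h \<in> Z b" by auto
  have hc: "h \<in> cont" using closed_subspaceD(1)[OF E h(2)] .
  have h1: "h \<one> = 1" using h(1) by (simp add: K_def)
  have hom: "h (x \<otimes> y) = h x * h y" if "x \<in> carrier Y" "y \<in> carrier Y" for x y
  proof -
    have "h (x \<otimes> y) * h \<one> = h (x \<otimes> \<one>) * h y" using h(3)[OF that(1)] that(2) one_closed unfolding Z_def by blast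
    then show ?thesis using h1 that by simp
  qed
  have le: "norm (h x) \<le> 1" if "x \<in> carrier Y" for x
    using h(1) that by (auto simp: K_def equi_ball_def split: if_splits)
  have norm: "norm (h x) = 1" if x: "x \<in> carrier Y" for x
  proof -
    have "norm (h x) * norm (h (inv x)) = 1"
      using hom[of x "inv x"] x h1 by (simp flip: norm_mult)
    moreover have "norm (h x) * norm (h (inv x)) \<le> norm (h x) * 1"
      using le x by (intro mult_left_mono) auto
    ultimately show ?thesis using le[OF x] by simp
  qed
  have conv_h: "conv k h x = mean (\<lambda>x. k x * h x) * h x" if x: "x \<in> carrier Y" for x
  proof -
    have "(\<lambda>y. k (inv x \<otimes> y) * h y) \<in> cont"
      by (intro cont_mult cont_translate_inv_left k hc x)
    from mean_translate[OF x this] have "conv k h x = mean (\<lambda>y. k (inv x \<otimes> (x \<otimes> y)) * h (x \<otimes> y))"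
      by (simp add: conv_def)
    also have "\<dots> = mean (\<lambda>y. h x * (k y * h y))"
      using x by (intro mean_cong) (simp add: m_assoc[symmetric] hom)
    also have "\<dots> = h x * mean (\<lambda>y. k y * h y)" by (intro mean_cmult cont_mult k hc)
    finally show ?thesis by simp
  qed
  have "mean (\<lambda>x. k x * h x) \<noteq> 0"
  proof
    assume "mean (\<lambda>x. k x * h x) = 0"
    then have "conv k h y = (\<lambda>y. 0) y" if "y \<in> carrier Y" for y using conv_h[OF that] by simp
    then have "conv k (conv k h) \<one> = conv k (\<lambda>y. 0) \<one>" by (intro conv_cong)
    also have "\<dots> = 0" by (simp add: conv_def mean_const)
    finally show False using h(2) h1 c by (simp add: eigenspace_def)
  qed
  with hc hom norm show ?thesis by blast
qed

end

section \<open>Extending and separating characters\<close>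

lemma LIMSEQ_even_odd:
  fixes f :: "nat \<Rightarrow> 'a :: metric_space"
  assumes "(\<lambda>n. f (2 * n)) \<longlonglongrightarrow> l" "(\<lambda>n. f (2 * n + 1)) \<longlonglongrightarrow> l"
  shows "f \<longlonglongrightarrow> l"
proof (rule metric_LIMSEQ_I)
  fix e :: real assume e: "e > 0"
  obtain M N where M: "\<And>n. n \<ge> M \<Longrightarrow> dist (f (2 * n)) l < e"
    and N: "\<And>n. n \<ge> N \<Longrightarrow> dist (f (2 * n + 1)) l < e"
    using metric_LIMSEQ_D[OF assms(1) e] metric_LIMSEQ_D[OF assms(2) e] by blast
  have "dist (f n) l < e" if n: "n \<ge> 2 * (M + N) + 1" for n
  proof (cases "even n")
    case True
    then obtain m where "n = 2 * m" by (rule evenE)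
    then show ?thesis using M[of m] n by simp
  next
    case False
    then obtain m where "n = 2 * m + 1" by (rule oddE)
    then show ?thesis using N[of m] n by simp
  qed
  then show "\<exists>no. \<forall>n\<ge>no. dist (f n) l < e" by blast
qed

context compact_abelian_group
begin

lemma characters_iff:
  "f \<in> characters Y T \<longleftrightarrow> f \<in> cont \<and>
     (\<forall>x\<in>carrier Y. \<forall>y\<in>carrier Y. f (x \<otimes> y) = f x * f y) \<and> (\<forall>x\<in>carrier Y. norm (f x) = 1)"
  by (auto simp: characters_def hom_def circle_group_def cont_def continuous_map_in_subtopology
      topspace_eq_carrier image_subset_iff Pi_iff)

lemma closed_subgroup_compact_abelian_group:
  assumes "subgroup K Y" "closedin T K"
  shows "compact_abelian_group (Y\<lparr>carrier := K\<rparr>) (subtopology T K)"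
proof -
  interpret K: subgroup K Y by fact
  interpret KG: group "Y\<lparr>carrier := K\<rparr>" by (rule K.subgroup_is_group[OF is_group])
  interpret KG: comm_group "Y\<lparr>carrier := K\<rparr>"
    by (rule KG.group_comm_groupI) (use K.subset m_comm in auto)
  have top: "topspace (subtopology T K) = K"
    unfolding topspace_subtopology by (rule Int_absorb1[OF closedin_subset[OF assms(2)]])
  show ?thesis
  proof
    show "topspace (subtopology T K) = carrier (Y\<lparr>carrier := K\<rparr>)" using top by simp
    have "continuous_map (subtopology (prod_topology T T) (K \<times> K)) (subtopology T K) (\<lambda>(x, y). x \<otimes> y)"
      using continuous_mult K.m_closed
      by (auto simp: continuous_map_in_subtopology continuous_map_from_subtopology image_subset_iff Pi_iff)
    then show "continuous_map (prod_topology (subtopology T K) (subtopology T K)) (subtopology T K)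
        (\<lambda>(x, y). x \<otimes>\<^bsub>Y\<lparr>carrier := K\<rparr>\<^esub> y)"
      by (simp add: subtopology_Times)
    have "continuous_map (subtopology T K) (subtopology T K) (\<lambda>x. inv x)"
      using continuous_inv K.m_inv_closed
      by (auto simp: continuous_map_in_subtopology continuous_map_from_subtopology image_subset_iff Pi_iff)
    then show "continuous_map (subtopology T K) (subtopology T K) (\<lambda>x. inv\<^bsub>Y\<lparr>carrier := K\<rparr>\<^esub> x)"
      by (rule continuous_map_eq) (use m_inv_consistent[OF assms(1)] in auto)
    show "compact_space (subtopology T K)"
      using assms(2) compact by (simp add: closedin_compact_space compact_space_subtopology)
    show "Hausdorff_space (subtopology T K)"
      using Hausdorff by (rule Hausdorff_space_subtopology)
  qed
qed

lemma closure_of_subgroup: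
  assumes "subgroup G Y"
  shows "subgroup (T closure_of G) Y"
proof -
  interpret G: subgroup G Y by fact
  have sub: "G \<subseteq> T closure_of G"
    using G.subset by (intro closure_of_subset) (simp add: topspace_eq_carrier)
  show ?thesis
  proof
    show "T closure_of G \<subseteq> carrier Y"
      using closure_of_subset_topspace[of T G] by (simp add: topspace_eq_carrier)
    show "\<one> \<in> T closure_of G" using sub by auto
    show "x \<otimes> y \<in> T closure_of G" if "x \<in> T closure_of G" "y \<in> T closure_of G" for x y
    proof -
      have "(\<lambda>(x, y). x \<otimes> y) ` (prod_topology T T closure_of (G \<times> G)) \<subseteq> T closure_of ((\<lambda>(x, y). x \<otimes> y) ` (G \<times> G))"
        by (rule continuous_map_image_closure_subset[OF continuous_mult])
      also have "\<dots> \<subseteq> T closure_of G"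
        by (rule closure_of_mono) (use G.m_closed in auto)
      finally show ?thesis using that by (auto simp: closure_of_Times)
    qed
    show "inv x \<in> T closure_of G" if "x \<in> T closure_of G" for x
    proof -
      have "(\<lambda>x. inv x) ` (T closure_of G) \<subseteq> T closure_of ((\<lambda>x. inv x) ` G)"
        by (rule continuous_map_image_closure_subset[OF continuous_inv])
      also have "\<dots> \<subseteq> T closure_of G"
        by (rule closure_of_mono) (use G.m_inv_closed in auto)
      finally show ?thesis using that by auto
    qed
  qed
qed

text \<open>The function \<open>F x = mean over y in K of cnj (u y) * f (x \<otimes> y)\<close> projects \<open>f\<close> to the functions that
  transform under \<open>K\<close> by \<open>u\<close>. The last clause evaluates it at points \<open>x\<close> over whose coset the
  averaged function is constant.\<close>

lemma twisted_average:
  assumes K: "subgroup K Y" "closedin T K"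
    and u: "u \<in> characters (Y\<lparr>carrier := K\<rparr>) (subtopology T K)" and f: "f \<in> cont"
  shows "\<exists>F\<in>cont. (\<forall>x\<in>carrier Y. \<forall>y\<in>K. F (x \<otimes> y) = u y * F x) \<and>
     (\<forall>x\<in>carrier Y. \<forall>c. (\<forall>y\<in>K. cnj (u y) * f (x \<otimes> y) = c) \<longrightarrow> F x = c)"
proof -
  interpret K: compact_abelian_group "Y\<lparr>carrier := K\<rparr>" "subtopology T K"
    by (rule closed_subgroup_compact_abelian_group[OF K])
  have Kc: "K \<subseteq> carrier Y" using K(1) by (rule subgroup.subset)
  have u_cont: "u \<in> K.cont" and u_hom: "\<And>x y. x \<in> K \<Longrightarrow> y \<in> K \<Longrightarrow> u (x \<otimes> y) = u x * u y"
    and u_norm: "\<And>x. x \<in> K \<Longrightarrow> norm (u x) = 1"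
    using u by (simp_all add: K.characters_iff)
  have fx: "(\<lambda>y. f (x \<otimes> y)) \<in> K.cont" if "x \<in> carrier Y" for x
    using cont_translate[OF f that] by (simp add: K.cont_def cont_def continuous_map_from_subtopology)
  have ufx: "(\<lambda>y. cnj (u y) * f (x \<otimes> y)) \<in> K.cont" if "x \<in> carrier Y" for x
    by (intro K.cont_mult K.cont_cnj u_cont fx that)
  define F where "F x = K.mean (\<lambda>y. cnj (u y) * f (x \<otimes> y))" for x
  have "F \<in> cont"
  proof (rule cont_if_uniform)
    fix e :: real assume "e > 0"
    from uniform_continuity[OF f this] obtain V where V: "openin T V" "\<one> \<in> V"
      "\<And>v x. v \<in> V \<Longrightarrow> x \<in> carrier Y \<Longrightarrow> norm (f (v \<otimes> x) - f x) < e" by blast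
    have "norm (F (v \<otimes> x) - F x) \<le> e" if v: "v \<in> V" and x: "x \<in> carrier Y" for v x
      unfolding F_def
    proof (rule K.mean_dist_le)
      have vc: "v \<in> carrier Y" using v open_subset_carrier[OF V(1)] by blast
      show "(\<lambda>y. cnj (u y) * f (v \<otimes> x \<otimes> y)) \<in> K.cont" "(\<lambda>y. cnj (u y) * f (x \<otimes> y)) \<in> K.cont"
        using vc x by (intro ufx; simp)+
      fix y assume "y \<in> carrier (Y\<lparr>carrier := K\<rparr>)"
      then have y: "y \<in> K" "y \<in> carrier Y" using Kc by auto
      have "norm (cnj (u y) * f (v \<otimes> x \<otimes> y) - cnj (u y) * f (x \<otimes> y))
          = norm (f (v \<otimes> (x \<otimes> y)) - f (x \<otimes> y))"
        using u_norm[OF y(1)] vc x y by (simp add: norm_mult m_assoc flip: right_diff_distrib)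
      also have "\<dots> \<le> e" using V(3)[OF v, of "x \<otimes> y"] x y by simp
      finally show "norm (cnj (u y) * f (v \<otimes> x \<otimes> y) - cnj (u y) * f (x \<otimes> y)) \<le> e" .
    qed
    with V show "\<exists>V. openin T V \<and> \<one> \<in> V \<and> (\<forall>v\<in>V. \<forall>x\<in>carrier Y. norm (F (v \<otimes> x) - F x) \<le> e)"
      by blast
  qed
  moreover have "F (x \<otimes> y) = u y * F x" if x: "x \<in> carrier Y" and y: "y \<in> K" for x y
  proof -
    have yc: "y \<in> carrier Y" using y Kc by blast
    have "F x = K.mean (\<lambda>z. cnj (u (y \<otimes> z)) * f (x \<otimes> (y \<otimes> z)))"
      using K.mean_translate[OF _ ufx[OF x], of y] y by (simp add: F_def)
    also have "\<dots> = K.mean (\<lambda>z. cnj (u y) * (cnj (u z) * f (x \<otimes> y \<otimes> z)))"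
      using x yc y Kc u_hom by (intro K.mean_cong) (auto simp: m_assoc subset_iff)
    also have "\<dots> = cnj (u y) * F (x \<otimes> y)"
      unfolding F_def using x yc by (intro K.mean_cmult ufx) simp
    finally show ?thesis
      using u_norm[OF y] complex_norm_square[of "u y"] by (simp flip: mult.assoc)
  qed
  moreover have "F x = c" if "x \<in> carrier Y" "\<forall>y\<in>K. cnj (u y) * f (x \<otimes> y) = c" for x c
    unfolding F_def using that by (subst K.mean_cong[of _ "\<lambda>y. c"])
      (auto simp: K.mean_const)
  ultimately show ?thesis by blast
qed

text \<open>Translating the Fourier coefficient of \<open>k\<close> at a character \<open>f\<close> by \<open>y \<in> K\<close> multiplies it by
  \<open>u y * cnj (f y)\<close>. Where the coefficient is nonzero, \<open>f\<close> must therefore agree with \<open>u\<close> on \<open>K\<close>.\<close>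

lemma character_matching_kernel:
  assumes k: "k \<in> cont" and herm: "\<And>z. z \<in> carrier Y \<Longrightarrow> k (inv z) = cnj (k z)"
    and one: "k \<one> \<noteq> 0" and K: "K \<subseteq> carrier Y"
    and twist: "\<And>x y. x \<in> carrier Y \<Longrightarrow> y \<in> K \<Longrightarrow> k (x \<otimes> y) = u y * k x"
  shows "\<exists>f\<in>characters Y T. (\<forall>y\<in>K. f y = u y) \<and> mean (\<lambda>x. k x * cnj (f x)) \<noteq> 0"
proof -
  obtain g where g: "g \<in> cont" "\<And>x y. x \<in> carrier Y \<Longrightarrow> y \<in> carrier Y \<Longrightarrow> g (x \<otimes> y) = g x * g y"
      "\<And>x. x \<in> carrier Y \<Longrightarrow> norm (g x) = 1" "mean (\<lambda>x. k x * g x) \<noteq> 0"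
    using character_with_nonzero_coefficient[OF k herm one_closed one] by blast
  let ?f = "\<lambda>x. cnj (g x)"
  have "?f \<in> characters Y T"
    using g by (simp add: characters_iff cont_cnj)
  moreover have "?f y = u y" if y: "y \<in> K" for y
  proof -
    have yc: "y \<in> carrier Y" using y K by blast
    have "mean (\<lambda>x. k x * g x) = mean (\<lambda>x. k (y \<otimes> x) * g (y \<otimes> x))"
      by (rule mean_translate[OF yc cont_mult[OF k g(1)], symmetric])
    also have "\<dots> = mean (\<lambda>x. (u y * g y) * (k x * g x))"
      using yc twist[OF _ y] g(2) by (intro mean_cong) (simp add: m_comm[of y])
    also have "\<dots> = (u y * g y) * mean (\<lambda>x. k x * g x)" by (intro mean_cmult cont_mult k g(1))
    finally have "u y * g y = 1" using g(4) by simp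
    moreover have "g y * cnj (g y) = 1" using g(3)[OF yc] complex_norm_square[of "g y"] by simp
    ultimately show ?thesis by (metis mult.assoc mult.commute mult_1)
  qed
  ultimately show ?thesis using g(4) by (intro bexI[of _ ?f]) auto
qed

text \<open>Extend \<open>u\<close> to a continuous function by Tietze's theorem, average it over \<open>K\<close> so that it
  transforms by \<open>u\<close>, and make it Hermitian; its value at the identity remains nonzero.\<close>

theorem character_extension:
  assumes K: "subgroup K Y" "closedin T K"
    and u: "u \<in> characters (Y\<lparr>carrier := K\<rparr>) (subtopology T K)"
  shows "\<exists>f\<in>characters Y T. \<forall>y\<in>K. f y = u y"
proof -
  interpret K: compact_abelian_group "Y\<lparr>carrier := K\<rparr>" "subtopology T K"
    by (rule closed_subgroup_compact_abelian_group[OF K])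
  have Kc: "K \<subseteq> carrier Y" using K(1) by (rule subgroup.subset)
  have one_K: "\<one> \<in> K" using K(1) by (rule subgroup.one_closed)
  have u_cont: "u \<in> K.cont" and u_hom: "\<And>x y. x \<in> K \<Longrightarrow> y \<in> K \<Longrightarrow> u (x \<otimes> y) = u x * u y"
    and u_norm: "\<And>x. x \<in> K \<Longrightarrow> norm (u x) = 1"
    using u by (simp_all add: K.characters_iff)
  have u_unit: "cnj (u y) * u y = 1" if "y \<in> K" for y
    using u_norm[OF that] complex_norm_square[of "u y"] by (simp add: mult.commute)
  have "continuous_map (subtopology T K) euclideanreal (\<lambda>x. Re (u x))"
       "continuous_map (subtopology T K) euclideanreal (\<lambda>x. Im (u x))"
    using continuous_map_compose[of "subtopology T K" euclidean u euclidean Re]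
      continuous_map_compose[of "subtopology T K" euclidean u euclidean Im] u_cont
    by (simp_all add: K.cont_def o_def continuous_intros)
  then obtain re im where re: "continuous_map T euclideanreal re" "\<And>x. x \<in> K \<Longrightarrow> re x = Re (u x)"
    and im: "continuous_map T euclideanreal im" "\<And>x. x \<in> K \<Longrightarrow> im x = Im (u x)"
    using Tietze_extension_realinterval[OF normal K(2), of UNIV] by (metis is_interval_univ UNIV_not_empty subset_UNIV)
  have "(\<lambda>x. complex_of_real (re x)) \<in> cont" "(\<lambda>x. complex_of_real (im x)) \<in> cont"
    using continuous_map_compose[OF re(1), of euclidean complex_of_real]
      continuous_map_compose[OF im(1), of euclidean complex_of_real]
    by (simp_all add: cont_def o_def continuous_intros)
  then have ext_cont: "(\<lambda>x. complex_of_real (re x) + \<i> * complex_of_real (im x)) \<in> cont"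
    by (intro cont_intros)
  obtain F where F: "F \<in> cont" "\<forall>x\<in>carrier Y. \<forall>y\<in>K. F (x \<otimes> y) = u y * F x"
      "\<forall>x\<in>carrier Y. \<forall>c. (\<forall>y\<in>K. cnj (u y) * (complex_of_real (re (x \<otimes> y)) + \<i> * complex_of_real (im (x \<otimes> y))) = c)
        \<longrightarrow> F x = c"
    using twisted_average[OF K u ext_cont] by (elim bexE conjE)
  have ext: "complex_of_real (re y) + \<i> * complex_of_real (im y) = u y" if "y \<in> K" for y
    using re(2)[OF that] im(2)[OF that] by (simp add: complex_eq_iff)
  have F1: "F \<one> = 1"
    using Kc ext u_unit by (intro F(3)[rule_format]) (auto simp: subset_iff)
  define k where "k z = F z + cnj (F (inv z))" for z
  have "\<exists>f\<in>characters Y T. (\<forall>y\<in>K. f y = u y) \<and> mean (\<lambda>x. k x * cnj (f x)) \<noteq> 0"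
  proof (rule character_matching_kernel)
    show "k \<in> cont" unfolding k_def by (intro cont_intros cont_inv F(1))
    show "k (inv z) = cnj (k z)" if "z \<in> carrier Y" for z using that by (simp add: k_def)
    show "k \<one> \<noteq> 0" using F1 by (simp add: k_def)
    show "k (x \<otimes> y) = u y * k x" if x: "x \<in> carrier Y" and y: "y \<in> K" for x y
    proof -
      have yc: "y \<in> carrier Y" and iy: "inv y \<in> K" using y Kc subgroup.m_inv_closed[OF K(1)] by auto
      have "u (inv y) * u y = 1"
        using u_hom[OF iy y] yc u_hom[OF one_K one_K] u_unit[OF one_K] by auto
      then have "u (inv y) = cnj (u y)"
        using u_unit[OF y] by (metis mult.commute mult.left_commute mult_1_right)
      then have "F (inv (x \<otimes> y)) = cnj (u y) * F (inv x)"
        using F(2) iy x yc by (simp add: inv_mult)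
      then show ?thesis using F(2) x y by (simp add: k_def algebra_simps)
    qed
  qed (rule Kc)
  then show ?thesis by blast
qed

text \<open>Let \<open>g\<close> be a Hermitian \<open>K\<close>-invariant function that vanishes at \<open>a\<close> but not at the identity.
  The second difference \<open>k z = 2 g z - g (a z) - g (a\<^sup>-\<^sup>1 z)\<close> has zero Fourier coefficient at every
  character \<open>f\<close> with \<open>f a = 1\<close>, so a character with nonzero coefficient separates \<open>a\<close> from \<open>K\<close>.\<close>

theorem character_separating_subgroup:
  assumes K: "subgroup K Y" "closedin T K" and a: "a \<in> carrier Y" "a \<notin> K"
  shows "\<exists>f\<in>characters Y T. (\<forall>y\<in>K. f y = 1) \<and> f a \<noteq> 1"
proof -
  interpret K: compact_abelian_group "Y\<lparr>carrier := K\<rparr>" "subtopology T K"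
    by (rule closed_subgroup_compact_abelian_group[OF K])
  have Kc: "K \<subseteq> carrier Y" using K(1) by (rule subgroup.subset)
  have ia: "inv a \<in> carrier Y" using a by simp
  define L where "L b = {x \<in> topspace T. b \<otimes> x \<in> K}" for b
  have "closedin T (L b)" if "b \<in> carrier Y" for b
    unfolding L_def by (rule closedin_continuous_map_preimage[OF continuous_map_translate[OF that] K(2)])
  then have cl: "closedin T (L a \<union> L (inv a))" using a ia by (intro closedin_Un)
  have dis: "disjnt K (L a \<union> L (inv a))"
  proof -
    have *: "b \<in> K" if "y \<in> K" "y \<in> L b" "b \<in> carrier Y" for b y
    proof -
      have "b \<otimes> y \<in> K" using that(2) by (simp add: L_def)
      then have "(b \<otimes> y) \<otimes> inv y \<in> K" using that K(1) by (simp add: subgroup.m_closed subgroup.m_inv_closed)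
      then show ?thesis using that Kc by (simp add: m_assoc subset_iff)
    qed
    have "inv a \<notin> K" using subgroup.m_inv_closed[OF K(1), of "inv a"] a by auto
    then have "y \<notin> L a \<union> L (inv a)" if "y \<in> K" for y
      using *[OF that _ a(1)] *[OF that _ ia] a(2) by blast
    then show ?thesis unfolding disjnt_iff by blast
  qed
  obtain f :: "'a \<Rightarrow> real" where f: "continuous_map T euclideanreal f" "f ` K \<subseteq> {1}"
      "f ` (L a \<union> L (inv a)) \<subseteq> {0}"
    by (rule Urysohn_lemma_alt[OF normal K(2) cl dis])
  have fc: "(\<lambda>x. complex_of_real (f x)) \<in> cont"
    using continuous_map_compose[OF f(1), of euclidean complex_of_real]
    by (simp add: cont_def o_def continuous_intros)
  have one: "(\<lambda>y. 1) \<in> characters (Y\<lparr>carrier := K\<rparr>) (subtopology T K)"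
    by (simp add: K.characters_iff)
  obtain F where F: "F \<in> cont" "\<forall>x\<in>carrier Y. \<forall>y\<in>K. F (x \<otimes> y) = 1 * F x"
      "\<forall>x\<in>carrier Y. \<forall>c. (\<forall>y\<in>K. cnj 1 * complex_of_real (f (x \<otimes> y)) = c) \<longrightarrow> F x = c"
    using twisted_average[OF K one fc] by (elim bexE conjE)
  have F1: "F \<one> = 1" using Kc f(2) by (intro F(3)[rule_format]) (auto simp: subset_iff)
  have F0: "F a = 0" "F (inv a) = 0"
  proof -
    have "b \<otimes> y \<in> L (inv b)" if "b \<in> carrier Y" "y \<in> K" for b y
      using that Kc by (auto simp: L_def topspace_eq_carrier m_assoc[symmetric])
    then have "a \<otimes> y \<in> L (inv a)" "inv a \<otimes> y \<in> L a" if "y \<in> K" for y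
      using that a(1) ia by (metis inv_inv)+
    then have "f (a \<otimes> y) = 0" "f (inv a \<otimes> y) = 0" if "y \<in> K" for y
      using f(3) that by (meson Un_iff image_subset_iff singletonD)+
    then show "F a = 0" "F (inv a) = 0" using a ia by (simp_all add: F(3)[rule_format])
  qed
  define g where "g z = F z + cnj (F (inv z))" for z
  have gc: "g \<in> cont" unfolding g_def by (intro cont_intros cont_inv F(1))
  have g_herm: "g (inv z) = cnj (g z)" if "z \<in> carrier Y" for z using that by (simp add: g_def)
  have g_K: "g (x \<otimes> y) = g x" if x: "x \<in> carrier Y" and y: "y \<in> K" for x y
  proof -
    have yc: "y \<in> carrier Y" and iy: "inv y \<in> K" using y Kc subgroup.m_inv_closed[OF K(1)] by auto
    show ?thesis using F(2) x y iy yc by (simp add: g_def inv_mult)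
  qed
  define k where "k z = 2 * g z - (g (a \<otimes> z) + g (inv a \<otimes> z))" for z
  have "\<exists>f\<in>characters Y T. (\<forall>y\<in>K. f y = 1) \<and> mean (\<lambda>x. k x * cnj (f x)) \<noteq> 0"
  proof (rule character_matching_kernel)
    show "k \<in> cont" unfolding k_def by (intro cont_intros cont_translate gc a ia)
    show "k (inv z) = cnj (k z)" if z: "z \<in> carrier Y" for z
    proof -
      have "g (a \<otimes> inv z) = cnj (g (inv a \<otimes> z))"
        using g_herm[of "inv a \<otimes> z"] a z by (simp add: inv_mult)
      moreover have "g (inv a \<otimes> inv z) = cnj (g (a \<otimes> z))"
        using g_herm[of "a \<otimes> z"] a z by (simp add: inv_mult)
      ultimately show ?thesis using g_herm[OF z] by (simp add: k_def)
    qed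
    show "k \<one> \<noteq> 0" using F1 F0 a by (simp add: k_def g_def)
    show "k (x \<otimes> y) = 1 * k x" if x: "x \<in> carrier Y" and y: "y \<in> K" for x y
    proof -
      have yc: "y \<in> carrier Y" using y Kc by blast
      have "g (b \<otimes> (x \<otimes> y)) = g (b \<otimes> x)" if "b \<in> carrier Y" for b
        using g_K[of "b \<otimes> x" y] that x y yc by (simp add: m_assoc)
      then show ?thesis using g_K[OF x y] a ia by (simp add: k_def)
    qed
  qed (rule Kc)
  then obtain q where q: "q \<in> characters Y T" "\<And>y. y \<in> K \<Longrightarrow> q y = 1"
      "mean (\<lambda>x. k x * cnj (q x)) \<noteq> 0" by blast
  have "q a \<noteq> 1"
  proof
    assume qa: "q a = 1"
    have qc: "q \<in> cont" and q_hom: "\<And>x y. x \<in> carrier Y \<Longrightarrow> y \<in> carrier Y \<Longrightarrow> q (x \<otimes> y) = q x * q y"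
      using q(1) by (simp_all add: characters_iff)
    have "q \<one> = 1" using q(2) subgroup.one_closed[OF K(1)] by blast
    then have qia: "q (inv a) = 1" using q_hom[of a "inv a"] a qa by simp
    have tr: "mean (\<lambda>x. g (b \<otimes> x) * cnj (q x)) = mean (\<lambda>x. g x * cnj (q x))"
      if b: "b \<in> carrier Y" "q b = 1" for b
    proof -
      have "mean (\<lambda>x. g (b \<otimes> x) * cnj (q x)) = mean (\<lambda>x. g (b \<otimes> x) * cnj (q (b \<otimes> x)))"
        using b q_hom by (intro mean_cong) simp
      also have "\<dots> = mean (\<lambda>x. g x * cnj (q x))"
        by (rule mean_translate[OF b(1)]) (intro cont_intros gc qc)
      finally show ?thesis .
    qed
    have c: "(\<lambda>x. g (b \<otimes> x) * cnj (q x)) \<in> cont" if "b \<in> carrier Y" for b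
      by (intro cont_intros cont_translate gc qc that)
    have c0: "(\<lambda>x. g x * cnj (q x)) \<in> cont" by (intro cont_intros gc qc)
    have "mean (\<lambda>x. k x * cnj (q x)) = mean (\<lambda>x. 2 * (g x * cnj (q x)) -
        (g (a \<otimes> x) * cnj (q x) + g (inv a \<otimes> x) * cnj (q x)))"
      by (simp add: k_def algebra_simps)
    also have "\<dots> = mean (\<lambda>x. 2 * (g x * cnj (q x))) -
        mean (\<lambda>x. g (a \<otimes> x) * cnj (q x) + g (inv a \<otimes> x) * cnj (q x))"
      by (intro mean_diff cont_mult[OF cont_const c0] cont_add[OF c[OF a(1)] c[OF ia]])
    also have "\<dots> = 2 * mean (\<lambda>x. g x * cnj (q x)) -
        (mean (\<lambda>x. g (a \<otimes> x) * cnj (q x)) + mean (\<lambda>x. g (inv a \<otimes> x) * cnj (q x)))"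
      unfolding mean_cmult[OF c0] mean_add[OF c[OF a(1)] c[OF ia]] ..
    also have "\<dots> = 0" using tr[OF a(1) qa] tr[OF ia qia] by simp
    finally show False using q(3) by simp
  qed
  with q show ?thesis by blast
qed

text \<open>Metrizability enters here: the complement of \<open>K\<close> is a countable union of compact sets, and
  finitely many characters suffice on each of them.\<close>

lemma separating_sequence:
  assumes met: "metrizable_space T" and K: "subgroup K Y" "closedin T K"
  shows "\<exists>v :: nat \<Rightarrow> 'a \<Rightarrow> complex. (\<forall>n. v n \<in> characters Y T) \<and> (\<forall>n. \<forall>y\<in>K. v n y = 1) \<and>
    (\<forall>x\<in>carrier Y - K. \<exists>n. v n x \<noteq> 1)"
proof -
  define A where "A = {f \<in> characters Y T. \<forall>y\<in>K. f y = 1}"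
  have one: "(\<lambda>x. 1) \<in> A" by (simp add: A_def characters_iff)
  define W where "W f = {x \<in> topspace T. f x \<in> - {1}}" for f :: "'a \<Rightarrow> complex"
  have W: "openin T (W f)" if "f \<in> A" for f
    unfolding W_def using that
    by (intro openin_continuous_map_preimage[where Y = euclidean]) (auto simp: A_def characters_iff cont_def)
  have "fsigma_in T (topspace T - K)"
    using K(2) by (intro open_imp_fsigma_in met) auto
  then obtain C :: "nat \<Rightarrow> 'a set" where C: "\<And>n. closedin T (C n)" "\<Union>(range C) = topspace T - K"
    unfolding fsigma_in_ascending by blast
  have "\<exists>B. finite B \<and> B \<subseteq> A \<and> C n \<subseteq> \<Union>(W ` B)" for n
  proof -
    have "compactin T (C n)" using closedin_compact_space[OF compact C(1)] .
    moreover have "C n \<subseteq> \<Union>(W ` A)"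
    proof
      fix x assume "x \<in> C n"
      then have "x \<in> topspace T - K" using C(2) by blast
      then have x: "x \<in> carrier Y" "x \<notin> K" by (auto simp: topspace_eq_carrier)
      obtain f where "f \<in> characters Y T" "\<forall>y\<in>K. f y = 1" "f x \<noteq> 1"
        using character_separating_subgroup[OF K x] by blast
      then have "f \<in> A" "x \<in> W f" using x by (auto simp: A_def W_def topspace_eq_carrier)
      then show "x \<in> \<Union>(W ` A)" by blast
    qed
    ultimately obtain \<F> where "finite \<F>" "\<F> \<subseteq> W ` A" "C n \<subseteq> \<Union>\<F>"
      using compactinD[of T "C n" "W ` A"] W by auto
    then show ?thesis by (metis finite_subset_image)
  qed
  then obtain B where B: "\<And>n. finite (B n)" "\<And>n. B n \<subseteq> A" "\<And>n. C n \<subseteq> \<Union>(W ` B n)" by metis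
  define D where "D = insert (\<lambda>x. 1) (\<Union>n. B n)"
  have D: "countable D" "D \<noteq> {}" "D \<subseteq> A"
    using B(1,2) one by (auto simp: D_def intro: countable_finite)
  define v where "v = from_nat_into D"
  have "v n \<in> A" for n using D from_nat_into[of D n] by (auto simp: v_def)
  moreover have "\<exists>n. v n x \<noteq> 1" if x: "x \<in> carrier Y - K" for x
  proof -
    have "x \<in> \<Union>(range C)" unfolding C(2) using x by (simp add: topspace_eq_carrier)
    then obtain n f where "f \<in> B n" "x \<in> W f" using B(3) by blast
    then have "f \<in> D" "f x \<noteq> 1" by (auto simp: D_def W_def)
    then show ?thesis using from_nat_into_surj[OF D(1)] v_def by metis
  qed
  ultimately show ?thesis by (intro exI[of _ v]) (auto simp: A_def)
qed

text \<open>Passing from \<open>K\<close> to the whole group, the extended characters occupy the even positions. The odd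
  positions hold characters that are trivial on \<open>K\<close> and separate it from its complement, each of them infinitely
  often, as arranged by the pairing function.\<close>

theorem characterized_in_closed_subgroup:
  assumes met: "metrizable_space T" and K: "subgroup K Y" "closedin T K" and G: "G \<subseteq> K"
  shows "characterized_in Y T G \<longleftrightarrow> characterized_in (Y\<lparr>carrier := K\<rparr>) (subtopology T K) G"
proof
  interpret K: compact_abelian_group "Y\<lparr>carrier := K\<rparr>" "subtopology T K"
    by (rule closed_subgroup_compact_abelian_group[OF K])
  have Kc: "K \<subseteq> carrier Y" using K(1) by (rule subgroup.subset)
  {
    assume "characterized_in Y T G"
    then obtain u where u: "\<And>n::nat. u n \<in> characters Y T" "G = s_set Y u"
      by (auto simp: characterized_in_def characterized_by_def)
    have "u n \<in> characters (Y\<lparr>carrier := K\<rparr>) (subtopology T K)" for n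
      using u(1)[of n] Kc
      by (auto simp: characters_iff K.characters_iff cont_def K.cont_def continuous_map_from_subtopology)
    moreover have "G = s_set (Y\<lparr>carrier := K\<rparr>) u"
      using u(2) G Kc by (auto simp: s_set_def)
    ultimately show "characterized_in (Y\<lparr>carrier := K\<rparr>) (subtopology T K) G"
      by (auto simp: characterized_in_def characterized_by_def)
  next
    assume "characterized_in (Y\<lparr>carrier := K\<rparr>) (subtopology T K) G"
    then obtain u where u: "\<And>n::nat. u n \<in> characters (Y\<lparr>carrier := K\<rparr>) (subtopology T K)"
        "G = s_set (Y\<lparr>carrier := K\<rparr>) u"
      by (auto simp: characterized_in_def characterized_by_def)
    obtain u' where u': "\<And>n. u' n \<in> characters Y T" "\<And>n y. y \<in> K \<Longrightarrow> u' n y = u n y"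
      using character_extension[OF K u(1)] by metis
    obtain v :: "nat \<Rightarrow> 'a \<Rightarrow> complex" where v: "\<And>n. v n \<in> characters Y T" "\<And>n y. y \<in> K \<Longrightarrow> v n y = 1"
        "\<And>x. x \<in> carrier Y - K \<Longrightarrow> \<exists>n. v n x \<noteq> 1"
      using separating_sequence[OF met K] by metis
    define w where "w n = (if even n then u' (n div 2) else v (fst (prod_decode (n div 2))))" for n :: nat
    have w_even: "w (2 * n) = u' n" and w_odd: "w (2 * n + 1) = v (fst (prod_decode n))" for n
      by (simp_all add: w_def)
    have "G = s_set Y w"
    proof
      show "G \<subseteq> s_set Y w"
      proof
        fix x assume x: "x \<in> G"
        then have xK: "x \<in> K" using G by blast
        have "(\<lambda>n. w (2 * n) x) \<longlonglongrightarrow> 1"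
          using x u(2) u'(2)[OF xK] by (simp add: w_even s_set_def)
        moreover have "(\<lambda>n. w (2 * n + 1) x) \<longlonglongrightarrow> 1"
          unfolding w_odd using v(2)[OF xK] by simp
        ultimately have "(\<lambda>n. w n x) \<longlonglongrightarrow> 1" by (rule LIMSEQ_even_odd)
        then show "x \<in> s_set Y w" using xK Kc by (auto simp: s_set_def)
      qed
      show "s_set Y w \<subseteq> G"
      proof
        fix x assume "x \<in> s_set Y w"
        then have x: "x \<in> carrier Y" and lim: "(\<lambda>n. w n x) \<longlonglongrightarrow> 1" by (auto simp: s_set_def)
        have "v i x = 1" for i
        proof -
          have "j \<le> 2 * prod_encode (i, j) + 1" for j
            using le_prod_encode_2[of j i] by linarith
          then have "filterlim (\<lambda>j. 2 * prod_encode (i, j) + 1) sequentially sequentially"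
            by (intro filterlim_at_top_mono[OF filterlim_ident] always_eventually allI)
          from filterlim_compose[OF lim this] have "(\<lambda>j::nat. v i x) \<longlonglongrightarrow> 1"
            unfolding w_odd by simp
          then show ?thesis by (simp add: LIMSEQ_const_iff)
        qed
        then have xK: "x \<in> K" using v(3) x by blast
        have "filterlim (\<lambda>n::nat. 2 * n) sequentially sequentially"
          by (rule filterlim_at_top_mono[OF filterlim_ident]) (auto intro!: eventuallyI)
        from filterlim_compose[OF lim this] have "(\<lambda>n. u n x) \<longlonglongrightarrow> 1"
          unfolding w_even using u'(2)[OF xK] by simp
        then show "x \<in> G" using u(2) xK by (simp add: s_set_def)
      qed
    qed
    moreover have "w n \<in> characters Y T" for n using u'(1) v(1) by (simp add: w_def)
    ultimately show "characterized_in Y T G"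
      by (auto simp: characterized_in_def characterized_by_def)
  }
qed

end

section \<open>Characters of the group of unimodular sequences tending to 1\<close>

lemma TH0_simps:
  "z \<in> carrier TH0 \<longleftrightarrow> (\<forall>n. norm (z n) = 1) \<and> z \<longlonglongrightarrow> 1"
  "z \<otimes>\<^bsub>TH0\<^esub> w = (\<lambda>n. z n * w n)"
  "\<one>\<^bsub>TH0\<^esub> = (\<lambda>n. 1)"
  by (auto simp: TH0_def)

text \<open>Unlike \<open>characters_iff\<close>, this form covers groups that are not compact, such as \<open>TH0\<close>.\<close>

lemma characters_iff_pointwise:
  "f \<in> characters Y T \<longleftrightarrow> continuous_map T euclidean f \<and> f \<in> topspace T \<rightarrow> sphere 0 1 \<and>
     (\<forall>x\<in>carrier Y. \<forall>y\<in>carrier Y. f (x \<otimes>\<^bsub>Y\<^esub> y) = f x * f y) \<and> (\<forall>x\<in>carrier Y. norm (f x) = 1)"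
  by (auto simp: characters_def hom_def circle_group_def continuous_map_in_subtopology image_subset_iff Pi_iff)

lemma eventually_one_in_TH0:
  assumes "\<And>n. norm (z n) = 1" "\<And>i. i \<ge> (k::nat) \<Longrightarrow> z i = 1"
  shows "z \<in> carrier TH0"
proof -
  have "z \<longlonglongrightarrow> 1"
    by (rule tendsto_eventually) (use assms(2) in \<open>auto simp: eventually_sequentially\<close>)
  then show ?thesis using assms(1) by (simp add: TH0_simps)
qed

lemma d0_le:
  assumes "z \<in> carrier TH0" "w \<in> carrier TH0" "\<And>i. dist (z i) (w i) \<le> e"
  shows "d0 z w \<le> e"
  using assms by (simp add: d0_def cSUP_least)

text \<open>Balls are described by a non-strict coordinatewise bound, so that membership of a product with
  disjoint supports can be checked coordinate by coordinate.\<close>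

lemma openin_TH0_ball:
  assumes "openin TH0_topology U" "z \<in> U"
  obtains e where "e > 0" "\<And>w. w \<in> carrier TH0 \<Longrightarrow> (\<And>i. dist (z i) (w i) \<le> e) \<Longrightarrow> w \<in> U"
proof -
  interpret M: Metric_space "carrier TH0" d0 by (rule Metric_space_TH0)
  obtain r where r: "r > 0" "M.mball z r \<subseteq> U" and U: "U \<subseteq> carrier TH0"
    using assms by (auto simp: TH0_topology_def M.openin_mtopology)
  show ?thesis
  proof (rule that[of "r / 2"])
    fix w assume w: "w \<in> carrier TH0" "\<And>i. dist (z i) (w i) \<le> r / 2"
    have "d0 z w \<le> r / 2" using assms(2) U w by (intro d0_le) auto
    then have "w \<in> M.mball z r" using r(1) w(1) assms(2) U by (auto simp: M.in_mball)
    then show "w \<in> U" using r(2) by blast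
  qed (use r in auto)
qed

lemma topspace_TH0: "topspace TH0_topology = carrier TH0"
  by (simp add: TH0_topology_def Metric_space.topspace_mtopology Metric_space_TH0)

lemma norm_1_cis_Arg: "norm z = 1 \<Longrightarrow> cis (Arg z) = z"
  by (metis cis_Arg complex_sgn_def divide_numeral_1 norm_zero scaleR_one inverse_1 sgn_div_norm zero_neq_one)

lemma cos_nonpos: "pi / 2 \<le> t \<Longrightarrow> t \<le> pi \<Longrightarrow> cos t \<le> 0"
  using cos_ge_zero[of "pi - t"] by simp

lemma cos_pos_imp: "\<bar>t\<bar> \<le> pi \<Longrightarrow> cos t > 0 \<Longrightarrow> \<bar>t\<bar> < pi / 2"
  using cos_nonpos[of "\<bar>t\<bar>"] by (cases "\<bar>t\<bar> < pi / 2") auto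

text \<open>The circle has no small subgroups. The first multiple of the argument that reaches a quarter turn
  is still at most a half turn, because each step is shorter than a quarter turn.\<close>

lemma unit_complex_power_leaves_half_plane:
  assumes "norm w = 1" "w \<noteq> 1"
  obtains N :: nat where "Re (w ^ N) \<le> 0"
proof (cases "Re w \<le> 0")
  case True
  then show ?thesis using that[of 1] by simp
next
  case False
  define a where "a = Arg w"
  have w: "w = cis a" unfolding a_def using norm_1_cis_Arg[OF assms(1)] by simp
  have "\<bar>a\<bar> \<le> pi" unfolding a_def using Arg_bounded[of w] by auto
  then have a: "\<bar>a\<bar> < pi / 2" using False w by (intro cos_pos_imp) auto
  have a0: "0 < \<bar>a\<bar>" using assms(2) w by auto
  define N where "N = (LEAST N. pi / 2 \<le> real N * \<bar>a\<bar>)"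
  have ex: "\<exists>N. pi / 2 \<le> real N * \<bar>a\<bar>"
    using reals_Archimedean3[OF a0] less_imp_le by blast
  have N: "pi / 2 \<le> real N * \<bar>a\<bar>" unfolding N_def by (rule LeastI_ex[OF ex])
  then have "N \<noteq> 0" using pi_gt_zero by (metis mult_zero_left of_nat_0 not_le half_gt_zero)
  then have "\<not> pi / 2 \<le> real (N - 1) * \<bar>a\<bar>" unfolding N_def by (intro not_less_Least) simp
  moreover have "real N * \<bar>a\<bar> = real (N - 1) * \<bar>a\<bar> + \<bar>a\<bar>"
    using \<open>N \<noteq> 0\<close> by (cases N) (auto simp: algebra_simps)
  ultimately have "real N * \<bar>a\<bar> \<le> pi" using a by linarith
  then have "cos (real N * \<bar>a\<bar>) \<le> 0" using N by (intro cos_nonpos)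
  moreover have "cos (real N * \<bar>a\<bar>) = cos (real N * a)" by (cases "a \<ge> 0") auto
  ultimately have "Re (w ^ N) \<le> 0" by (simp add: w Complex.DeMoivre)
  then show ?thesis by (rule that)
qed

lemma dist_cis_1: "dist (cis t) 1 \<le> \<bar>t\<bar>"
proof -
  have "dist (cis t) 1 = 2 * \<bar>sin (t / 2)\<bar>"
    using dist_exp_i_1[of t] by (simp add: cis_conv_exp dist_norm)
  also have "\<dots> \<le> 2 * \<bar>t / 2\<bar>"
    using abs_sin_x_le_abs_x[of "t / 2"] by simp
  finally show ?thesis by simp
qed

lemma TH0_character_power:
  assumes f: "f \<in> characters TH0 TH0_topology" and z: "z \<in> carrier TH0"
  shows "f (\<lambda>i. z i ^ n) = f z ^ n \<and> (\<lambda>i. z i ^ n) \<in> carrier TH0"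
proof (induction n)
  case 0
  have "(\<lambda>i. 1) \<in> carrier TH0" by (simp add: TH0_simps)
  then have "f (\<lambda>i. 1) * f (\<lambda>i. 1) = f (\<lambda>i. 1)" "f (\<lambda>i. 1) \<noteq> 0"
    using f by (fastforce simp: characters_iff_pointwise TH0_simps(2))+
  then show ?case by (simp add: TH0_simps)
next
  case (Suc n)
  have "(\<lambda>i. z i * z i ^ n) \<longlonglongrightarrow> 1 * 1"
    using Suc z by (intro tendsto_mult) (auto simp: TH0_simps)
  then have "(\<lambda>i. z i ^ Suc n) \<in> carrier TH0" using z by (simp add: TH0_simps norm_mult norm_power)
  moreover have "f (\<lambda>i. z i * z i ^ n) = f z * f (\<lambda>i. z i ^ n)"
    using f z Suc by (auto simp: characters_iff_pointwise TH0_simps(2))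
  ultimately show ?case using Suc by simp
qed

text \<open>Suppose \<open>f\<close> is nontrivial on the sequences that begin with \<open>m\<close> ones, for every \<open>m\<close>. Choose \<open>e\<close> such
  that \<open>f\<close> has positive real part on the ball of radius \<open>e\<close>. Truncating, taking a power that leaves the right
  half plane, and then coordinatewise \<open>n\<close>-th roots, with \<open>pi / n \<le> e\<close>, gives
  an element \<open>y\<close> of this ball that has finite support beyond \<open>m\<close> and for which \<open>f y\<close> has argument at least
  \<open>d = pi / (2 n)\<close>, a bound independent of \<open>m\<close>. Products of such elements with
  disjoint supports stay in the ball, while their arguments add up. This contradicts positivity of
  the real part once the sum passes \<open>pi / 2\<close>; a single step is too short to jump over the left
  half plane.\<close>

theorem TH0_character_finitely_determined:
  assumes f: "f \<in> characters TH0 TH0_topology"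
  shows "\<exists>m. \<forall>z\<in>carrier TH0. (\<forall>i<m. z i = 1) \<longrightarrow> f z = 1"
proof (rule ccontr)
  assume "\<not> ?thesis"
  then have bad: "\<exists>z\<in>carrier TH0. (\<forall>i<m. z i = 1) \<and> f z \<noteq> 1" for m by blast
  have f_cont: "continuous_map TH0_topology euclidean f"
    and f_mult: "\<And>z w. z \<in> carrier TH0 \<Longrightarrow> w \<in> carrier TH0 \<Longrightarrow> f (\<lambda>i. z i * w i) = f z * f w"
    and f_norm: "\<And>z. z \<in> carrier TH0 \<Longrightarrow> norm (f z) = 1"
    using f by (auto simp: characters_iff_pointwise TH0_simps(2))
  have one: "(\<lambda>i. 1) \<in> carrier TH0" by (simp add: TH0_simps)
  have f1: "f (\<lambda>i. 1) = 1" using TH0_character_power[OF f one, of 0] by simp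
  have "openin TH0_topology {z \<in> topspace TH0_topology. f z \<in> {w. 0 < Re w}}"
    by (rule openin_continuous_map_preimage[OF f_cont]) (simp add: open_halfspace_Re_gt)
  from openin_TH0_ball[OF this, of "\<lambda>i. 1"] f1 one
  obtain e where e: "e > 0" and small: "\<And>w. w \<in> carrier TH0 \<Longrightarrow> (\<And>i. dist 1 (w i) \<le> e) \<Longrightarrow> 0 < Re (f w)"
    by (auto simp: topspace_TH0)
  obtain n :: nat where n: "pi / real n \<le> e" "n > 0"
  proof -
    obtain n where n: "pi / e < real n" using reals_Archimedean2 by blast
    then have "0 < real n" using e by (meson divide_pos_pos less_trans pi_gt_zero)
    then show ?thesis using n e by (intro that[of n]) (auto simp: field_simps)
  qed
  define d where "d = pi / (2 * real n)"
  have d: "d > 0" using n by (simp add: d_def)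
  have small_element: "\<exists>y k t. (\<forall>i. norm (y i) = 1) \<and> (\<forall>i\<ge>k. y i = 1) \<and> (\<forall>i<m. y i = 1) \<and>
      (\<forall>i. dist 1 (y i) \<le> e) \<and> d \<le> t \<and> t < pi / 2 \<and> f y = cis t" for m
  proof -
    obtain z where z: "z \<in> carrier TH0" "\<And>i. i < m \<Longrightarrow> z i = 1" "f z \<noteq> 1" using bad[of m] by blast
    have "openin TH0_topology {z \<in> topspace TH0_topology. f z \<in> - {1}}"
      by (rule openin_continuous_map_preimage[OF f_cont]) auto
    from openin_TH0_ball[OF this, of z] z
    obtain r where r: "r > 0" "\<And>w. w \<in> carrier TH0 \<Longrightarrow> (\<And>i. dist (z i) (w i) \<le> r) \<Longrightarrow> f w \<noteq> 1"
      by (auto simp: topspace_TH0)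
    obtain k where k: "\<And>i. i \<ge> k \<Longrightarrow> dist (z i) 1 < r"
      using z(1) r(1) unfolding TH0_simps by (metis metric_LIMSEQ_D)
    \<comment> \<open>Finite support is needed so that the coordinatewise root below still tends to 1; it also leaves
  room for the next factor.\<close>
    define z1 where "z1 i = (if i < k then z i else 1)" for i
    have z1: "z1 \<in> carrier TH0"
      by (rule eventually_one_in_TH0[of _ k]) (use z(1) in \<open>auto simp: z1_def TH0_simps\<close>)
    have "f z1 \<noteq> 1"
      using r(1) k by (intro r(2) z1) (auto simp: z1_def intro: less_imp_le)
    then obtain N where N: "Re (f z1 ^ N) \<le> 0"
      using unit_complex_power_leaves_half_plane[OF f_norm[OF z1]] by blast
    define y where "y i = cis (Arg (z1 i ^ N) / real n)" for i
    have y_one: "y i = 1" if "z1 i = 1" for i using that by (simp add: y_def)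
    have y_norm: "norm (y i) = 1" for i by (simp add: y_def)
    have y_k: "y i = 1" if "i \<ge> k" for i using that by (intro y_one) (simp add: z1_def)
    have y_m: "y i = 1" if "i < m" for i using that z(2) by (intro y_one) (simp add: z1_def)
    have yT: "y \<in> carrier TH0" by (rule eventually_one_in_TH0[OF y_norm y_k])
    have y_pow: "y i ^ n = z1 i ^ N" for i
    proof -
      have "norm (z1 i ^ N) = 1" using z1 by (simp add: TH0_simps norm_power)
      then have "cis (Arg (z1 i ^ N)) = z1 i ^ N" by (rule norm_1_cis_Arg)
      moreover have "y i ^ n = cis (real n * (Arg (z1 i ^ N) / real n))" unfolding y_def by (rule Complex.DeMoivre)
      ultimately show ?thesis using n(2) by simp
    qed
    have y_e: "dist 1 (y i) \<le> e" for i
    proof -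
      have "dist (y i) 1 \<le> \<bar>Arg (z1 i ^ N) / real n\<bar>" unfolding y_def by (rule dist_cis_1)
      also have "\<dots> \<le> pi / real n"
        using Arg_bounded[of "z1 i ^ N"] n(2) by (auto simp: abs_divide intro!: divide_right_mono)
      finally show ?thesis using n(1) by (simp add: dist_commute)
    qed
    have fy: "f y ^ n = f z1 ^ N"
      using TH0_character_power[OF f yT, of n] TH0_character_power[OF f z1, of N] by (simp add: y_pow)
    define t where "t = Arg (f y)"
    have ft: "f y = cis t" unfolding t_def using norm_1_cis_Arg[OF f_norm[OF yT]] by simp
    have "\<bar>t\<bar> \<le> pi" unfolding t_def using Arg_bounded[of "f y"] by auto
    moreover have "0 < cos t" using small[OF yT y_e] ft by simp
    ultimately have t: "\<bar>t\<bar> < pi / 2" by (rule cos_pos_imp)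
    have "cos (real n * t) \<le> 0" using N unfolding fy[symmetric] ft Complex.DeMoivre by simp
    then have "\<not> \<bar>real n * t\<bar> < pi / 2" using cos_gt_zero_pi[of "real n * t"] by linarith
    then have td: "d \<le> \<bar>t\<bar>" using n(2) by (simp add: d_def field_simps abs_mult)
    show ?thesis
    proof (cases "t \<ge> 0")
      case True
      then show ?thesis using y_norm y_k y_m y_e td t ft by (intro exI[of _ y] exI[of _ k] exI[of _ t]) auto
    next
      case False
      \<comment> \<open>Inversion makes the argument positive.\<close>
      define y' where "y' i = cnj (y i)" for i
      have y'T: "y' \<in> carrier TH0"
        by (rule eventually_one_in_TH0[of _ k]) (use y_norm y_k in \<open>auto simp: y'_def\<close>)
      have "(\<lambda>i. y i * y' i) = (\<lambda>i. 1)"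
        using complex_norm_square[symmetric] by (auto simp: y'_def y_norm fun_eq_iff)
      then have "f y * f y' = 1" using f_mult[OF yT y'T] f1 by simp
      then have "f y' = cis (- t)"
        unfolding ft by (metis cis_mult cis_zero add.commute add.right_inverse mult.left_commute mult_1_right)
      moreover have "dist 1 (y' i) \<le> e" for i
        using y_e[of i] by (metis complex_cnj_one y'_def dist_norm complex_cnj_diff complex_mod_cnj)
      ultimately show ?thesis
        using False y_norm y_k y_m td t
        by (intro exI[of _ y'] exI[of _ k] exI[of _ "- t"]) (auto simp: y'_def)
    qed
  qed
  have large_angle: "\<exists>p k S. (\<forall>i. norm (p i) = 1) \<and> (\<forall>i\<ge>k. p i = 1) \<and> (\<forall>i. dist 1 (p i) \<le> e) \<and>
      real N * d \<le> S \<and> 0 \<le> S \<and> S < pi / 2 \<and> f p = cis S" for N :: nat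
  proof (induction N)
    case 0
    then show ?case using f1 e by (intro exI[of _ "\<lambda>i. 1"] exI[of _ 0]) auto
  next
    case (Suc N)
    then obtain p k S where p: "\<And>i. norm (p i) = 1" "\<And>i. i \<ge> k \<Longrightarrow> p i = 1" "\<And>i. dist 1 (p i) \<le> e"
        and S: "real N * d \<le> S" "0 \<le> S" "S < pi / 2" "f p = cis S"
      by blast
    obtain y k' t where y: "\<And>i. norm (y i) = 1" "\<And>i. i \<ge> k' \<Longrightarrow> y i = 1" "\<And>i. i < k \<Longrightarrow> y i = 1"
        "\<And>i. dist 1 (y i) \<le> e" and t: "d \<le> t" "t < pi / 2" "f y = cis t"
      using small_element[of k] by blast
    let ?q = "\<lambda>i. p i * y i"
    have pT: "p \<in> carrier TH0" and yT: "y \<in> carrier TH0"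
      using eventually_one_in_TH0 p y by blast+
    have q_norm: "norm (?q i) = 1" for i using p y by (simp add: norm_mult)
    have q_k: "?q i = 1" if "i \<ge> max k k'" for i using p(2)[of i] y(2)[of i] that by simp
    have q_e: "dist 1 (?q i) \<le> e" for i
      using p(2)[of i] p(3)[of i] y(3)[of i] y(4)[of i] by (cases "i < k") auto
    have qT: "?q \<in> carrier TH0" by (rule eventually_one_in_TH0[OF q_norm q_k])
    have fq: "f ?q = cis (S + t)" using f_mult[OF pT yT] S t by (simp add: cis_mult)
    have "0 < cos (S + t)" using small[OF qT q_e] fq by simp
    then have "\<bar>S + t\<bar> < pi / 2" using S t d by (intro cos_pos_imp) auto
    then show ?case using q_norm q_k q_e S t d fq
      by (intro exI[of _ ?q] exI[of _ "max k k'"] exI[of _ "S + t"]) (auto simp: algebra_simps)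
  qed
  obtain N :: nat where "pi / 2 < real N * d" using reals_Archimedean3[OF d] by blast
  with large_angle[of N] show False by auto
qed

lemma group_TH0: "group TH0"
  using comm_group_TH0 by (simp add: comm_group_def)

lemma continuous_map_TH0_coordinate: "continuous_map TH0_topology euclidean (\<lambda>z. z n)"
proof -
  interpret M: Metric_space "carrier TH0" d0 by (rule Metric_space_TH0)
  have "\<exists>U. openin TH0_topology U \<and> z \<in> U \<and> (\<forall>w\<in>U. w n \<in> ball (z n) e)"
    if z: "z \<in> carrier TH0" and e: "e > 0" for z e
  proof (intro exI conjI ballI)
    show "openin TH0_topology (M.mball z e)" unfolding TH0_topology_def by (rule M.openin_mball)
    show "z \<in> M.mball z e" using z e by simp
    show "w n \<in> ball (z n) e" if "w \<in> M.mball z e" for w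
    proof -
      have "w \<in> carrier TH0" "d0 z w < e" using that by (auto simp: M.in_mball)
      then show ?thesis using dist_le_d0[OF z, of w n] by simp
    qed
  qed
  then show ?thesis
    using Met_TC.continuous_map_to_metric[of TH0_topology "\<lambda>z. z n"]
    by (simp add: topspace_TH0 del: mem_ball)
qed

definition truncate :: "nat \<Rightarrow> (nat \<Rightarrow> complex) \<Rightarrow> nat \<Rightarrow> complex" where
  "truncate m z i = (if i < m then z i else 1)"

lemma truncate_TH0: "(\<And>i. norm (z i) = 1) \<Longrightarrow> truncate m z \<in> carrier TH0"
  by (rule eventually_one_in_TH0[of _ m]) (auto simp: truncate_def)

lemma continuous_map_truncate:
  assumes "\<And>n. continuous_map T euclidean (u n)" "\<And>n x. x \<in> topspace T \<Longrightarrow> norm (u n x) = 1"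
  shows "continuous_map T TH0_topology (\<lambda>x. truncate m (\<lambda>n. u n x))"
proof -
  interpret M: Metric_space "carrier TH0" d0 by (rule Metric_space_TH0)
  have tr: "truncate m (\<lambda>n. u n x) \<in> carrier TH0" if "x \<in> topspace T" for x
    using assms(2)[OF that] by (rule truncate_TH0)
  have "\<exists>U. openin T U \<and> x \<in> U \<and>
      (\<forall>y\<in>U. truncate m (\<lambda>n. u n y) \<in> M.mball (truncate m (\<lambda>n. u n x)) e)"
    if x: "x \<in> topspace T" and e: "e > 0" for x e
  proof -
    define s where "s y = (\<Sum>i<m. norm (u i x - u i y))" for y
    have "continuous_map T euclideanreal s"
      unfolding s_def by (intro continuous_intros assms(1)) auto
    then have "openin T {y \<in> topspace T. s y \<in> {..<e}}"
      by (rule openin_continuous_map_preimage) auto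
    moreover have "x \<in> {y \<in> topspace T. s y \<in> {..<e}}" using x e by (simp add: s_def)
    moreover have "truncate m (\<lambda>n. u n y) \<in> M.mball (truncate m (\<lambda>n. u n x)) e"
      if y: "y \<in> {y \<in> topspace T. s y \<in> {..<e}}" for y
    proof -
      have "dist (truncate m (\<lambda>n. u n x) i) (truncate m (\<lambda>n. u n y) i) \<le> s y" for i
      proof (cases "i < m")
        case True
        then show ?thesis
          unfolding s_def using member_le_sum[of i "{..<m}" "\<lambda>i. norm (u i x - u i y)"]
          by (simp add: truncate_def dist_norm)
      qed (simp add: truncate_def s_def sum_nonneg)
      then have "d0 (truncate m (\<lambda>n. u n x)) (truncate m (\<lambda>n. u n y)) \<le> s y"
        using x y by (intro d0_le tr) auto
      then show ?thesis using x y tr by (auto simp: M.in_mball)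
    qed
    ultimately show ?thesis by blast
  qed
  then show ?thesis
    unfolding TH0_topology_def M.continuous_map_to_metric by blast
qed

text \<open>The map \<open>x \<mapsto> (u n x)\<^sub>n\<close> need not be continuous into \<open>TH0\<close>, but its truncations are, and a
  character of \<open>TH0\<close> only sees a truncation.\<close>

lemma character_of_product_continuous_on_graph:
  assumes X: "group X" "topspace T = carrier X"
    and u: "\<And>n. u n \<in> characters X T"
    and f: "f \<in> characters (X \<times>\<times> TH0) (prod_topology T TH0_topology)"
  obtains F where "continuous_map T euclidean F"
    "\<And>x. x \<in> carrier X \<Longrightarrow> (\<lambda>n. u n x) \<in> carrier TH0 \<Longrightarrow> f (x, \<lambda>n. u n x) = F x"
proof -
  interpret X: group X by fact
  interpret TH: group TH0 by (rule group_TH0)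
  have u_norm: "norm (u n x) = 1" if "x \<in> carrier X" for n x
    using u[of n] that by (simp add: characters_iff_pointwise)
  have f_mult: "f (x \<otimes>\<^bsub>X\<^esub> y, \<lambda>i. z i * w i) = f (x, z) * f (y, w)" and f_norm: "norm (f (x, z)) = 1"
    if "x \<in> carrier X" "y \<in> carrier X" "z \<in> carrier TH0" "w \<in> carrier TH0" for x y z w
    using f that by (auto simp: characters_iff_pointwise TH0_simps(2))
  have f_cont: "continuous_map (prod_topology T TH0_topology) euclidean f"
    using f by (simp add: characters_iff_pointwise)
  have pair: "continuous_map TH0_topology (prod_topology T TH0_topology) (\<lambda>z. (\<one>\<^bsub>X\<^esub>, z))"
    unfolding continuous_map_pairwise by (simp add: o_def X(2))
  have "continuous_map TH0_topology euclidean (\<lambda>z. f (\<one>\<^bsub>X\<^esub>, z))"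
    using continuous_map_compose[OF pair f_cont] by (simp add: o_def)
  moreover have "f (\<one>\<^bsub>X\<^esub>, z \<otimes>\<^bsub>TH0\<^esub> w) = f (\<one>\<^bsub>X\<^esub>, z) * f (\<one>\<^bsub>X\<^esub>, w)"
    if "z \<in> carrier TH0" "w \<in> carrier TH0" for z w
    using f_mult[OF X.one_closed X.one_closed that] by (simp add: TH0_simps(2))
  ultimately have "(\<lambda>z. f (\<one>\<^bsub>X\<^esub>, z)) \<in> characters TH0 TH0_topology"
    using f_norm[OF X.one_closed X.one_closed] by (auto simp: characters_iff_pointwise topspace_TH0)
  from TH0_character_finitely_determined[OF this]
  obtain m where m: "\<forall>z\<in>carrier TH0. (\<forall>i<m. z i = 1) \<longrightarrow> f (\<one>\<^bsub>X\<^esub>, z) = 1" ..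
  show ?thesis
  proof
    have "continuous_map T TH0_topology (\<lambda>x. truncate m (\<lambda>n. u n x))"
      using u by (intro continuous_map_truncate u_norm) (auto simp: characters_iff_pointwise X(2))
    then have "continuous_map T (prod_topology T TH0_topology) (\<lambda>x. (x, truncate m (\<lambda>n. u n x)))"
      unfolding continuous_map_pairwise by (simp add: o_def)
    from continuous_map_compose[OF this f_cont]
    show "continuous_map T euclidean (\<lambda>x. f (x, truncate m (\<lambda>n. u n x)))" by (simp add: o_def)
    fix x assume x: "x \<in> carrier X" and z: "(\<lambda>n. u n x) \<in> carrier TH0"
    let ?z = "\<lambda>n. u n x"
    \<comment> \<open>The sequence of values is its truncation times \<open>r\<close>, and the character ignores \<open>r\<close>.\<close>
    define r where "r i = (if i < m then 1 else u i x)" for i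
    have "r \<longlonglongrightarrow> 1"
    proof (rule Lim_transform_eventually)
      show "?z \<longlonglongrightarrow> 1" using z by (simp add: TH0_simps)
      show "eventually (\<lambda>i. ?z i = r i) sequentially"
        using eventually_ge_at_top[of m] by eventually_elim (simp add: r_def)
    qed
    then have rT: "r \<in> carrier TH0" using u_norm[OF x] by (simp add: TH0_simps r_def)
    have tT: "truncate m ?z \<in> carrier TH0" using u_norm[OF x] by (rule truncate_TH0)
    have "(\<lambda>i. truncate m ?z i * r i) = ?z" by (auto simp: truncate_def r_def)
    then have "f (x, ?z) = f (x, truncate m ?z) * f (\<one>\<^bsub>X\<^esub>, r)"
      using f_mult[OF x X.one_closed tT rT] x by simp
    also have "f (\<one>\<^bsub>X\<^esub>, r) = 1" using m rT by (simp add: r_def)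
    finally show "f (x, ?z) = f (x, truncate m ?z)" by simp
  qed
qed

theorem characterized_by_iff_dually_closed_graph:
  assumes X: "group X" "topspace T = carrier X" and G: "subgroup G X"
    and dense: "T closure_of G = carrier X" and u: "\<And>n. u n \<in> characters X T"
  shows "characterized_by X u G \<longleftrightarrow>
    (\<exists>Gu. subgroup Gu (X \<times>\<times> TH0) \<and> dually_closed (X \<times>\<times> TH0) (prod_topology T TH0_topology) Gu \<and>
      bij_betw fst Gu G \<and> (\<forall>n. \<forall>(g, \<omega>) \<in> Gu. u n g = \<omega> n))" (is "_ = (\<exists>Gu. ?P Gu)")
proof
  interpret X: group X by fact
  interpret G: subgroup G X by fact
  have u_norm: "norm (u n x) = 1" if "x \<in> carrier X" for n x
    using u[of n] that by (simp add: characters_iff_pointwise)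
  have u_mult: "u n (x \<otimes>\<^bsub>X\<^esub> y) = u n x * u n y" if "x \<in> carrier X" "y \<in> carrier X" for n x y
    using u[of n] that by (simp add: characters_iff_pointwise)
  define j where "j g = (g, \<lambda>n. u n g)" for g
  {
    assume "characterized_by X u G"
    then have Gs: "G = {x \<in> carrier X. (\<lambda>n. u n x) \<longlonglongrightarrow> 1}"
      unfolding characterized_by_def s_set_def .
    have inG: "g \<in> G \<longleftrightarrow> g \<in> carrier X \<and> (\<lambda>n. u n g) \<longlonglongrightarrow> 1" for g
      by (subst Gs) (rule mem_Collect_eq)
    have jG: "j g \<in> carrier (X \<times>\<times> TH0)" if "g \<in> G" for g
      using that u_norm[of g] inG[of g] by (simp add: j_def TH0_simps)
    have hom: "j \<in> hom (X\<lparr>carrier := G\<rparr>) (X \<times>\<times> TH0)"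
      using jG by (auto simp: hom_def j_def u_mult TH0_simps(2))
    have "group_hom (X\<lparr>carrier := G\<rparr>) (X \<times>\<times> TH0) j"
      using hom G.subgroup_is_group[OF X(1)] DirProd_group[OF X(1) group_TH0]
      by (simp add: group_hom_def group_hom_axioms_def)
    from group_hom.img_is_subgroup[OF this] have sub: "subgroup (j ` G) (X \<times>\<times> TH0)" by simp
    have "dually_closed (X \<times>\<times> TH0) (prod_topology T TH0_topology) (j ` G)"
      unfolding dually_closed_def
    proof
      fix p assume p: "p \<in> carrier (X \<times>\<times> TH0) - j ` G"
      then obtain x z where pxz: "p = (x, z)" and x: "x \<in> carrier X" and z: "z \<in> carrier TH0" by auto
      have "\<exists>n. u n x \<noteq> z n"
      proof (rule ccontr)
        assume "\<not> (\<exists>n. u n x \<noteq> z n)"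
        then have eq: "(\<lambda>n. u n x) = z" by auto
        then have "x \<in> G" using z x inG[of x] by (simp add: TH0_simps)
        then show False using p pxz eq by (auto simp: j_def)
      qed
      then obtain n where n: "u n x \<noteq> z n" by blast
      define f where "f q = u n (fst q) * cnj (snd q n)" for q :: "'a \<times> (nat \<Rightarrow> complex)"
      have c1: "continuous_map (prod_topology T TH0_topology) euclidean (\<lambda>q. u n (fst q))"
        using continuous_map_compose[OF continuous_map_fst, of T euclidean "u n" TH0_topology] u[of n]
        by (simp add: o_def characters_iff_pointwise)
      have c2: "continuous_map (prod_topology T TH0_topology) euclidean (\<lambda>q. snd q n)"
        using continuous_map_compose[OF continuous_map_snd continuous_map_TH0_coordinate, of T n]
        by (simp add: o_def)
      have "continuous_map (prod_topology T TH0_topology) (prod_topology euclidean euclidean)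
          (\<lambda>q. (u n (fst q), snd q n))"
        using c1 c2 unfolding continuous_map_pairwise by (simp add: o_def)
      moreover have "continuous_map euclidean euclidean (\<lambda>p. fst p * cnj (snd p) :: complex)"
        by (subst continuous_map_iff_continuous2) (intro continuous_intros)
      ultimately have "continuous_map (prod_topology T TH0_topology) euclidean
          ((\<lambda>p. fst p * cnj (snd p)) \<circ> (\<lambda>q. (u n (fst q), snd q n)))"
        unfolding prod_topology_euclidean by (rule continuous_map_compose)
      then have "continuous_map (prod_topology T TH0_topology) euclidean f"
        by (simp add: f_def[abs_def] o_def)
      moreover have "norm (f q) = 1" if "q \<in> carrier (X \<times>\<times> TH0)" for q
        using that u_norm by (auto simp: f_def norm_mult TH0_simps)
      moreover have "f (q \<otimes>\<^bsub>X \<times>\<times> TH0\<^esub> q') = f q * f q'"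
        if "q \<in> carrier (X \<times>\<times> TH0)" "q' \<in> carrier (X \<times>\<times> TH0)" for q q'
        using that u_mult by (auto simp: f_def TH0_simps(2))
      ultimately have fchar: "f \<in> characters (X \<times>\<times> TH0) (prod_topology T TH0_topology)"
        by (auto simp: characters_iff_pointwise topspace_TH0 X(2))
      have unit: "a * cnj a = 1" if "norm a = 1" for a :: complex
        using complex_norm_square[of a] that by simp
      have "\<forall>h\<in>j ` G. f h = 1"
        using u_norm unit by (auto simp: f_def j_def)
      moreover have "f p \<noteq> 1"
      proof
        assume "f p = 1"
        then have "u n x * cnj (z n) = 1" by (simp add: f_def pxz)
        moreover have "z n * cnj (z n) = 1" using z unit by (simp add: TH0_simps)
        ultimately have "u n x = z n" by (metis mult.assoc mult.commute mult_1)
        with n show False by simp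
      qed
      ultimately show "\<exists>f\<in>characters (X \<times>\<times> TH0) (prod_topology T TH0_topology). (\<forall>h\<in>j ` G. f h = 1) \<and> f p \<noteq> 1"
        using fchar by blast
    qed
    moreover have "bij_betw fst (j ` G) G"
      by (auto simp: bij_betw_def inj_on_def j_def image_image)
    moreover have "\<forall>n. \<forall>(g, \<omega>) \<in> j ` G. u n g = \<omega> n" by (auto simp: j_def)
    ultimately show "\<exists>Gu. ?P Gu" using sub by blast
  next
    assume "\<exists>Gu. ?P Gu"
    then obtain Gu where Gu: "subgroup Gu (X \<times>\<times> TH0)"
        and dc: "dually_closed (X \<times>\<times> TH0) (prod_topology T TH0_topology) Gu"
        and bij: "bij_betw fst Gu G" and coord: "\<forall>n. \<forall>(g, \<omega>) \<in> Gu. u n g = \<omega> n"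
      by blast
    have Gu_carrier: "Gu \<subseteq> carrier X \<times> carrier TH0" using subgroup.subset[OF Gu] by simp
    have second: "\<omega> = (\<lambda>n. u n g)" if "(g, \<omega>) \<in> Gu" for g \<omega>
    proof
      fix n
      have "case (g, \<omega>) of (g, \<omega>) \<Rightarrow> u n g = \<omega> n" using coord that by blast
      then show "\<omega> n = u n g" by simp
    qed
    have inG: "j g \<in> Gu" if g: "g \<in> G" for g
    proof -
      obtain q where "q \<in> Gu" "fst q = g" using g bij by (auto simp: bij_betw_def)
      then show ?thesis using second by (cases q) (auto simp: j_def)
    qed
    have fstG: "x \<in> G" if "(x, z) \<in> Gu" for x z
      using bij_betw_apply[OF bij that] by simp
    have "x \<in> G" if x: "x \<in> carrier X" and lim: "(\<lambda>n. u n x) \<longlonglongrightarrow> 1" for x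
    proof (rule ccontr)
      assume nx: "x \<notin> G"
      have xT: "(\<lambda>n. u n x) \<in> carrier TH0" using lim u_norm[OF x] by (simp add: TH0_simps)
      have "(x, \<lambda>n. u n x) \<in> carrier (X \<times>\<times> TH0) - Gu" using x xT nx fstG by auto
      then obtain f where f: "f \<in> characters (X \<times>\<times> TH0) (prod_topology T TH0_topology)"
          "\<And>h. h \<in> Gu \<Longrightarrow> f h = 1" "f (x, \<lambda>n. u n x) \<noteq> 1"
        using dc unfolding dually_closed_def by blast
      obtain F where F: "continuous_map T euclidean F"
          "\<And>x. x \<in> carrier X \<Longrightarrow> (\<lambda>n. u n x) \<in> carrier TH0 \<Longrightarrow> f (x, \<lambda>n. u n x) = F x"
        by (rule character_of_product_continuous_on_graph[of X T u f, OF X u f(1)]) auto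
      have "F g = 1" if g: "g \<in> G" for g
      proof -
        have "(\<lambda>n. u n g) \<in> carrier TH0" using inG[OF g] Gu_carrier by (auto simp: j_def)
        then show ?thesis using F(2)[of g] f(2)[OF inG[OF g]] g by (simp add: j_def)
      qed
      then have "F x = 1"
        using forall_in_closure_of_eq[of x T G euclidean F "\<lambda>x. 1"] F(1) x dense by auto
      then show False using F(2)[OF x xT] f(3) by simp
    qed
    moreover have "(\<lambda>n. u n g) \<longlonglongrightarrow> 1" if g: "g \<in> G" for g
      using inG[OF g] Gu_carrier by (auto simp: j_def TH0_simps)
    ultimately show "characterized_by X u G"
      by (auto simp: characterized_by_def s_set_def)
  }
qed

section \<open>Characterized subgroups\<close>

theorem theorem1:
  fixes X :: "('a, 'm) monoid_scheme" and T :: "'a topology" and G :: "'a set"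
  assumes "abelian_topological_group X T" "compact_space T" "metrizable_space T"
    and "infinite (carrier X)"
    and "subgroup G X"
  shows "(T closure_of G = carrier X \<longrightarrow>
           (\<forall>u. (\<forall>n. u n \<in> characters X T) \<longrightarrow>
             (characterized_by X u G \<longleftrightarrow>
               (\<exists>Gu. subgroup Gu (X \<times>\<times> TH0) \<and>
                     dually_closed (X \<times>\<times> TH0) (prod_topology T TH0_topology) Gu \<and>
                     bij_betw fst Gu G \<and>
                     (\<forall>n. \<forall>(g, \<omega>) \<in> Gu. u n g = \<omega> n))))) \<and>
         (characterized_in X T G \<longleftrightarrow>
           characterized_in (X\<lparr>carrier := T closure_of G\<rparr>) (subtopology T (T closure_of G)) G)"
proof -
  interpret abelian_topological_group X T by (rule assms(1))
  interpret compact_abelian_group X T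
    by unfold_locales (use assms(2,3) in \<open>auto intro: metrizable_imp_Hausdorff_space\<close>)
  have closure: "subgroup (T closure_of G) X" "closedin T (T closure_of G)"
    using closure_of_subgroup[OF assms(5)] by auto
  have "G \<subseteq> T closure_of G"
    using subgroup.subset[OF assms(5)] by (intro closure_of_subset) (simp add: topspace_eq_carrier)
  then show ?thesis
    using characterized_by_iff_dually_closed_graph[OF is_group topspace_eq_carrier assms(5)]
      characterized_in_closed_subgroup[OF assms(3) closure]
    by blast
qed

end
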